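(* Let $M$ be a closed $n$-dimensional Riemannian manifold, $n\ge3$, and let $W\in C^3(\mathbb{R})$ be a double-well potential with associated min-max values $c_\varepsilon$, $\varepsilon>0$. Then $$0<\liminf_{\varepsilon\to0}c_\varepsilon\le\limsup_{\varepsilon\to0}c_\varepsilon<\infty .$$
   Context: Double-well potential: $W\in C^3(\mathbb{R})$, $W\ge 0$, with exactly three critical points, two of which are non-degenerate minima at $\pm1$ with $W(\pm1)=0$ and $W''(\pm1)>0$, the third being a local maximum $\gamma\in(-1,1)$. Min-max values: for $\varepsilon>0$ let $E_\varepsilon(u)=\int_M\varepsilon\frac{|\nabla u|^2}{2}+\frac{W(u)}{\varepsilon}$ on $H^1(M)$, where for the min-max $W$ is replaced outside $[-1,1]$ by a $C^3$ function that agrees with $W$ on $[-1,1]$, is positive for $|x|>1$, and is constant on $\mathbb{R}\setminus[-2,2]$. Let $\Gamma$ be the set of continuous paths $h:[0,1]\to H^1(M)$ with $h(0)\equiv-1$ and $h(1)\equiv1$, and $c_\varepsilon=\inf_{h\in\Gamma}\max_{t\in[0,1]}E_\varepsilon(h(t))$. *)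

theory Defs
  imports "HOL-Analysis.Analysis"
begin

section \<open>Functions of class $C^k$\<close>

text \<open>Only used on open sets, where \<open>differentiable_on\<close> is differentiability at each point.\<close>

primrec Ck_on :: "nat \<Rightarrow> 'a::real_normed_vector set \<Rightarrow> ('a \<Rightarrow> 'b::real_normed_vector) \<Rightarrow> bool" where
  "Ck_on 0 S f \<longleftrightarrow> continuous_on S f"
| "Ck_on (Suc k) S f \<longleftrightarrow>
     f differentiable_on S \<and> (\<forall>v. Ck_on k S (\<lambda>x. frechet_derivative f (at x) v))"

definition smooth_on :: "'a::real_normed_vector set \<Rightarrow> ('a \<Rightarrow> 'b::real_normed_vector) \<Rightarrow> bool" where
  "smooth_on S f \<longleftrightarrow> (\<forall>k. Ck_on k S f)"

section \<open>Closed Riemannian manifolds\<close>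

text \<open>
  The manifold is the whole type \<open>'m\<close>. A chart is a pair of an open domain and a coordinate map,
  whose values outside the domain are irrelevant. Tensor fields are given classically, by their
  components in each chart of the atlas together with the transformation law.
\<close>

type_synonym ('m, 'n) chart = "'m set \<times> ('m \<Rightarrow> real ^ 'n)"

abbreviation chart_dom :: "('m, 'n::finite) chart \<Rightarrow> 'm set" where
  "chart_dom c \<equiv> fst c"

abbreviation chart_img :: "('m, 'n::finite) chart \<Rightarrow> (real ^ 'n) set" where
  "chart_img c \<equiv> snd c ` fst c"

definition chart_inv :: "('m, 'n::finite) chart \<Rightarrow> real ^ 'n \<Rightarrow> 'm" where
  "chart_inv c = inv_into (fst c) (snd c)"

definition is_chart :: "('m::topological_space, 'n::finite) chart \<Rightarrow> bool" where
  "is_chart c \<longleftrightarrow> open (chart_dom c) \<and> open (chart_img c) \<and>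
     homeomorphism (chart_dom c) (chart_img c) (snd c) (chart_inv c)"

definition transition :: "('m, 'n::finite) chart \<Rightarrow> ('m, 'n) chart \<Rightarrow> real ^ 'n \<Rightarrow> real ^ 'n" where
  "transition c d = snd d \<circ> chart_inv c"

definition smooth_atlas :: "('m::topological_space, 'n::finite) chart set \<Rightarrow> bool" where
  "smooth_atlas A \<longleftrightarrow>
     (\<forall>c\<in>A. is_chart c) \<and> (\<Union>c\<in>A. chart_dom c) = UNIV \<and>
     (\<forall>c\<in>A. \<forall>d\<in>A. smooth_on (snd c ` (chart_dom c \<inter> chart_dom d)) (transition c d))"

definition jacobian :: "('m, 'n::finite) chart \<Rightarrow> ('m, 'n) chart \<Rightarrow> 'm \<Rightarrow> real ^ 'n ^ 'n" where
  "jacobian c d p = matrix (frechet_derivative (transition c d) (at (snd c p)))"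

type_synonym ('m, 'n) metric = "('m, 'n) chart \<Rightarrow> 'm \<Rightarrow> real ^ 'n ^ 'n"

type_synonym ('m, 'n) vfield = "('m, 'n) chart \<Rightarrow> 'm \<Rightarrow> real ^ 'n"

definition riemannian_metric ::
  "('m::topological_space, 'n::finite) chart set \<Rightarrow> ('m, 'n) metric \<Rightarrow> bool" where
  "riemannian_metric A g \<longleftrightarrow>
     (\<forall>c\<in>A. \<forall>p\<in>chart_dom c. transpose (g c p) = g c p \<and> (\<forall>v. v \<noteq> 0 \<longrightarrow> v \<bullet> (g c p *v v) > 0)) \<and>
     (\<forall>c\<in>A. smooth_on (chart_img c) (\<lambda>x. g c (chart_inv c x))) \<and>
     (\<forall>c\<in>A. \<forall>d\<in>A. \<forall>p\<in>chart_dom c \<inter> chart_dom d.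
        g c p = transpose (jacobian c d p) ** g d p ** jacobian c d p)"

definition closed_riemannian_manifold ::
  "('m::{t2_space, second_countable_topology}, 'n::finite) chart set \<Rightarrow> ('m, 'n) metric \<Rightarrow> bool" where
  "closed_riemannian_manifold A g \<longleftrightarrow>
     compact (UNIV :: 'm set) \<and> smooth_atlas A \<and> riemannian_metric A g"

text \<open>
  The Riemannian volume is the Borel measure given by $\sqrt{\det g}\,dx$ in every chart. It is
  unique because countably many chart domains cover the manifold.
\<close>

definition riem_vol ::
  "('m::topological_space, 'n::finite) chart set \<Rightarrow> ('m, 'n) metric \<Rightarrow> 'm measure" where
  "riem_vol A g = (THE \<mu>. sets \<mu> = sets borel \<and>
     (\<forall>c\<in>A. \<forall>B\<in>sets borel. B \<subseteq> chart_dom c \<longrightarrow>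
        emeasure \<mu> B =
          (\<integral>\<^sup>+x\<in>snd c ` B. ennreal (sqrt (det (g c (chart_inv c x)))) \<partial>lborel)))"

definition vector_field ::
  "('m::topological_space, 'n::finite) chart set \<Rightarrow> ('m, 'n) vfield \<Rightarrow> bool" where
  "vector_field A X \<longleftrightarrow>
     (\<forall>c\<in>A. X c \<in> borel_measurable (restrict_space borel (chart_dom c))) \<and>
     (\<forall>c\<in>A. \<forall>d\<in>A. \<forall>p\<in>chart_dom c \<inter> chart_dom d. X d p = jacobian c d p *v X c p)"

definition chart_at :: "('m, 'n::finite) chart set \<Rightarrow> 'm \<Rightarrow> ('m, 'n) chart" where
  "chart_at A p = (SOME c. c \<in> A \<and> p \<in> chart_dom c)"

text \<open>$|X|_g^2$; for a vector field, the value does not depend on the chart chosen at each point.\<close>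

definition norm_sq ::
  "('m, 'n::finite) chart set \<Rightarrow> ('m, 'n) metric \<Rightarrow> ('m, 'n) vfield \<Rightarrow> 'm \<Rightarrow> real" where
  "norm_sq A g X p = (let c = chart_at A p in X c p \<bullet> (g c p *v X c p))"

definition smooth_fun :: "('m, 'n::finite) chart set \<Rightarrow> ('m \<Rightarrow> real) \<Rightarrow> bool" where
  "smooth_fun A u \<longleftrightarrow> (\<forall>c\<in>A. smooth_on (chart_img c) (u \<circ> chart_inv c))"

text \<open>In coordinates, $(\nabla u)^i = g^{ij}\partial_j u$.\<close>

definition grad :: "('m, 'n::finite) metric \<Rightarrow> ('m \<Rightarrow> real) \<Rightarrow> ('m, 'n) vfield" where
  "grad g u c p = matrix_inv (g c p) *v
     (\<chi> j. frechet_derivative (u \<circ> chart_inv c) (at (snd c p)) (axis j 1))"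

section \<open>The Sobolev space $H^1(M)$\<close>

text \<open>
  $H^1(M)$ is the completion of $C^\infty(M)$ for the norm
  $(\int_M u^2 + |\nabla u|^2)^{1/2}$, realized inside $L^2(M)$: \<open>u\<close> belongs to it, with
  gradient \<open>X\<close>, iff some smooth $v_k$ satisfy $v_k \to u$ and $\nabla v_k \to X$ in $L^2$.
  Elements are represented by functions, two of which are identified when they agree almost
  everywhere.
\<close>

definition L2_fun ::
  "('m::topological_space, 'n::finite) chart set \<Rightarrow> ('m, 'n) metric \<Rightarrow> ('m \<Rightarrow> real) \<Rightarrow> bool" where
  "L2_fun A g u \<longleftrightarrow> u \<in> borel_measurable borel \<and> integrable (riem_vol A g) (\<lambda>p. (u p)\<^sup>2)"

definition L2_field ::
  "('m::topological_space, 'n::finite) chart set \<Rightarrow> ('m, 'n) metric \<Rightarrow> ('m, 'n) vfield \<Rightarrow> bool" where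
  "L2_field A g X \<longleftrightarrow> vector_field A X \<and> integrable (riem_vol A g) (norm_sq A g X)"

definition has_sobolev_grad ::
  "('m::topological_space, 'n::finite) chart set \<Rightarrow> ('m, 'n) metric \<Rightarrow>
     ('m \<Rightarrow> real) \<Rightarrow> ('m, 'n) vfield \<Rightarrow> bool" where
  "has_sobolev_grad A g u X \<longleftrightarrow> L2_fun A g u \<and> L2_field A g X \<and>
     (\<exists>v :: nat \<Rightarrow> 'm \<Rightarrow> real. (\<forall>k. smooth_fun A (v k)) \<and>
        (\<lambda>k. \<integral>p. (v k p - u p)\<^sup>2 \<partial>riem_vol A g) \<longlonglongrightarrow> 0 \<and>
        (\<lambda>k. \<integral>p. norm_sq A g (\<lambda>c q. grad g (v k) c q - X c q) p \<partial>riem_vol A g) \<longlonglongrightarrow> 0)"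

definition H1 ::
  "('m::topological_space, 'n::finite) chart set \<Rightarrow> ('m, 'n) metric \<Rightarrow> ('m \<Rightarrow> real) set" where
  "H1 A g = {u. \<exists>X. has_sobolev_grad A g u X}"

text \<open>The gradient of an element of $H^1(M)$ is unique up to null sets.\<close>

definition sobolev_grad ::
  "('m::topological_space, 'n::finite) chart set \<Rightarrow> ('m, 'n) metric \<Rightarrow>
     ('m \<Rightarrow> real) \<Rightarrow> ('m, 'n) vfield" where
  "sobolev_grad A g u = (SOME X. has_sobolev_grad A g u X)"

definition H1_norm ::
  "('m::topological_space, 'n::finite) chart set \<Rightarrow> ('m, 'n) metric \<Rightarrow> ('m \<Rightarrow> real) \<Rightarrow> real" where
  "H1_norm A g u =
     sqrt (\<integral>p. (u p)\<^sup>2 + norm_sq A g (sobolev_grad A g u) p \<partial>riem_vol A g)"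

section \<open>Double-well potentials and min-max values\<close>

definition double_well :: "(real \<Rightarrow> real) \<Rightarrow> bool" where
  "double_well W \<longleftrightarrow> Ck_on 3 UNIV W \<and> (\<forall>x. W x \<ge> 0) \<and>
     W (- 1) = 0 \<and> W 1 = 0 \<and> deriv (deriv W) (- 1) > 0 \<and> deriv (deriv W) 1 > 0 \<and>
     (\<exists>\<gamma>\<in>{- 1<..<1}. {x. deriv W x = 0} = {- 1, \<gamma>, 1} \<and> (\<forall>\<^sub>F x in nhds \<gamma>. W x \<le> W \<gamma>))"

definition minmax_modification :: "(real \<Rightarrow> real) \<Rightarrow> (real \<Rightarrow> real) \<Rightarrow> bool" where
  "minmax_modification W V \<longleftrightarrow> Ck_on 3 UNIV V \<and> (\<forall>x\<in>{- 1..1}. V x = W x) \<and>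
     (\<forall>x. \<bar>x\<bar> > 1 \<longrightarrow> V x > 0) \<and> (\<exists>k. \<forall>x. x \<notin> {- 2..2} \<longrightarrow> V x = k)"

definition energy ::
  "('m::topological_space, 'n::finite) chart set \<Rightarrow> ('m, 'n) metric \<Rightarrow> (real \<Rightarrow> real) \<Rightarrow>
     real \<Rightarrow> ('m \<Rightarrow> real) \<Rightarrow> real" where
  "energy A g V \<epsilon> u =
     (\<integral>p. \<epsilon> * norm_sq A g (sobolev_grad A g u) p / 2 + V (u p) / \<epsilon> \<partial>riem_vol A g)"

text \<open>The endpoint conditions are equalities in $H^1(M)$, i.e. almost everywhere.\<close>

definition minmax_paths ::
  "('m::topological_space, 'n::finite) chart set \<Rightarrow> ('m, 'n) metric \<Rightarrow> (real \<Rightarrow> 'm \<Rightarrow> real) set" where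
  "minmax_paths A g = {h.
     (\<forall>t\<in>{0..1}. h t \<in> H1 A g) \<and>
     (\<forall>t\<in>{0..1}. ((\<lambda>s. H1_norm A g (\<lambda>p. h s p - h t p)) \<longlongrightarrow> 0) (at t within {0..1})) \<and>
     (AE p in riem_vol A g. h 0 p = - 1) \<and> (AE p in riem_vol A g. h 1 p = 1)}"

text \<open>
  The supremum over $[0,1]$ is a maximum, since the energy is continuous on $H^1(M)$. Extended
  reals are used so that infima, suprema and limits are always meaningful.
\<close>

definition minmax_value ::
  "('m::topological_space, 'n::finite) chart set \<Rightarrow> ('m, 'n) metric \<Rightarrow> (real \<Rightarrow> real) \<Rightarrow>
     real \<Rightarrow> ereal" where
  "minmax_value A g V \<epsilon> =
     (INF h\<in>minmax_paths A g. SUP t\<in>{0..1}. ereal (energy A g V \<epsilon> (h t)))"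

end

(*
  Lower bound. Let G be a smooth nondecreasing function with G = -1/2 left of -1/2 and G = 1/2
  right of 1/2. Along a path from -1 to 1 the mean of G over a coordinate ball K passes through 0,
  so by the L^1 Poincare inequality the mean of |G(u)| over K is bounded, at some time, by
  int_K |G'(u)| |grad u|. Young's inequality with weights eps and 1/eps bounds this by the energy,
  because V is bounded below where G' is not zero; and |G(u)| is 1/2 except where V(u) is bounded
  below. The gradient of an H^1 function is the limit of gradients of smooth functions, and it is
  well defined because directional derivatives are closable.

  Upper bound. Cover M by finitely many coordinate balls of half radius. On each of them let the
  sphere |x - y|^2 = t r^2 sweep the ball as t goes from 0 to 1, and let w_t be a cutoff that passes
  from 0 to 1 in a layer of width about eps around it. The path 1 - 2 * (product of the cutoffs)
  leads from -1 to 1, and its energy density is O(1/eps) on a set of volume O(eps) and 0 elsewhere.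
*)
theory Submission
  imports Defs "HOL-Computational_Algebra.Polynomial"
begin

text \<open>Nothing makes \<open>M\<close> connected, so a Poincare inequality on all of
  \<open>M\<close> may fail. A single coordinate ball, convex in its chart, already detects the
  passage from -1 to 1. What is followed along a path is a mean, because a path is continuous only
  in \<open>H1_norm\<close> and the mean of a Lipschitz function of u is continuous in L^2. A chain
  rule for G(u) with u in H^1 is avoided: the Poincare and Young inequalities are applied to smooth
  approximations, and only the resulting bound is passed to the limit. In the upper bound all balls
  are swept simultaneously with one parameter t, which replaces a global Morse function. The spheres
  are parametrized by squared radius: |x - y|^2 is smooth at the centre, and in dimension at least 2
  a layer of thickness \<epsilon> in squared radius has volume O(\<epsilon>) uniformly in t, even
  around the centre. Since \<open>riem_vol\<close> is given by \<open>THE\<close> and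
  \<open>sobolev_grad\<close> by \<open>SOME\<close>, nothing can be computed before existence and
  uniqueness of the volume and uniqueness of the gradient norm are known. The former rests on the
  change of variables, the latter on closability.\<close>

text \<open>
  The change of variables theorem of the library needs a well-ordered index type. It is
  transferred to an arbitrary finite index type along the following copy.
\<close>

typedef ('a::finite) wo = "UNIV :: 'a set" morphisms un_wo mk_wo
  by auto

lemma bij_un_wo: "bij (un_wo :: 'a::finite wo \<Rightarrow> 'a)"
  by (metis bij_iff un_wo_inverse mk_wo_inverse UNIV_I)

instance wo :: (finite) finite
proof
  have "finite (un_wo -` (UNIV :: 'a set))"
    by (rule finite_vimageI) (auto simp: bij_un_wo bij_is_inj)
  then show "finite (UNIV :: 'a wo set)" by simp
qed

text \<open>Any injection will do; the order serves only to meet a class constraint and never enters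
  a result.\<close>

definition wo_index :: "'a::finite \<Rightarrow> nat" where
  "wo_index = (SOME f. inj f)"

lemma inj_wo_index: "inj (wo_index :: 'a::finite \<Rightarrow> nat)"
proof -
  have "\<exists>f :: 'a \<Rightarrow> nat. inj f"
    using finite_imp_inj_to_nat_seg[of "UNIV :: 'a set"] by auto
  then show ?thesis unfolding wo_index_def by (rule someI_ex)
qed

instantiation wo :: (finite) wellorder
begin

definition less_eq_wo :: "'a wo \<Rightarrow> 'a wo \<Rightarrow> bool" where
  "x \<le> y \<longleftrightarrow> wo_index (un_wo x) \<le> wo_index (un_wo y)"

definition less_wo :: "'a wo \<Rightarrow> 'a wo \<Rightarrow> bool" where
  "x < y \<longleftrightarrow> wo_index (un_wo x) < wo_index (un_wo y)"

instance
proof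
  fix x y :: "'a wo"
  show "x \<le> y \<Longrightarrow> y \<le> x \<Longrightarrow> x = y"
    by (metis less_eq_wo_def antisym inj_wo_index injD un_wo_inject)
next
  fix P :: "'a wo \<Rightarrow> bool" and a
  assume step: "\<And>x. (\<And>y. y < x \<Longrightarrow> P y) \<Longrightarrow> P x"
  show "P a"
    by (induction a rule: measure_induct_rule[of "\<lambda>x. wo_index (un_wo x)"])
       (rule step, simp add: less_wo_def)
qed (auto simp: less_eq_wo_def less_wo_def)

end

section \<open>Transfer of Lebesgue measure, determinants and integrals along a relabelling of
  coordinates\<close>

definition to_wo :: "real ^ 'n::finite \<Rightarrow> real ^ 'n wo" where
  "to_wo x = (\<chi> i. x $ un_wo i)"

definition of_wo :: "real ^ 'n::finite wo \<Rightarrow> real ^ 'n" where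
  "of_wo x = (\<chi> i. x $ mk_wo i)"

lemma of_to_wo [simp]: "of_wo (to_wo x) = x" and to_of_wo [simp]: "to_wo (of_wo y) = y"
  by (auto simp: to_wo_def of_wo_def vec_eq_iff mk_wo_inverse un_wo_inverse)

lemma linear_to_wo: "linear to_wo" and linear_of_wo: "linear of_wo"
  by (auto simp: to_wo_def of_wo_def vec_eq_iff intro!: linearI)

lemma measurable_to_wo [measurable]: "to_wo \<in> borel_measurable borel"
  and measurable_of_wo [measurable]: "of_wo \<in> borel_measurable borel"
  using linear_continuous_on[OF linear_conv_bounded_linear[THEN iffD1, OF linear_to_wo]]
    linear_continuous_on[OF linear_conv_bounded_linear[THEN iffD1, OF linear_of_wo]]
  by (auto intro: borel_measurable_continuous_onI)

text \<open>Relabelling coordinates maps boxes to boxes with the same side lengths, and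
  \<open>lborel\<close> is determined by its values on boxes.\<close>

lemma lborel_to_wo: "distr lborel borel to_wo = (lborel :: (real ^ 'n::finite wo) measure)"
proof (rule lborel_eqI[symmetric])
  fix l u :: "real ^ 'n wo"
  assume le: "\<And>b. b \<in> Basis \<Longrightarrow> l \<bullet> b \<le> u \<bullet> b"
  have le': "l $ i \<le> u $ i" for i
    using le[of "axis i 1"] by (auto simp: Basis_vec_def inner_axis)
  \<comment> \<open>Turns the product over \<open>Basis\<close> into one over indices, where
    \<open>un_wo\<close> can act as a reindexing.\<close>
  have prod_eq: "(\<Prod>b\<in>Basis. (u - l) \<bullet> b) = (\<Prod>i\<in>UNIV. u $ i - l $ i)" for u l :: "real ^ 'k::finite"
    by (simp add: Basis_vec_def prod.UNION_disjoint inner_axis axis_eq_axis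
        prod.reindex[of "\<lambda>i. axis i (1::real)", simplified] inj_on_def cart_eq_inner_axis[symmetric]
        UN_singleton image_def[symmetric])
  have "to_wo -` box l u = box (of_wo l) (of_wo u)"
    by (auto simp: mem_box_cart to_wo_def of_wo_def)
       (metis mk_wo_inverse UNIV_I un_wo_inverse)+
  then have "emeasure (distr lborel borel to_wo) (box l u)
      = emeasure lborel (box (of_wo l) (of_wo u))"
    by (simp add: emeasure_distr)
  also have "\<dots> = (\<Prod>b\<in>Basis. (of_wo u - of_wo l) \<bullet> b)"
    using le' by (subst emeasure_lborel_box) (auto simp: Basis_vec_def of_wo_def inner_axis)
  also have "\<dots> = (\<Prod>b\<in>Basis. (u - l) \<bullet> b)"
    unfolding prod_eq
    by (subst prod.reindex_bij_betw[OF bij_un_wo, symmetric]) (simp add: of_wo_def un_wo_inverse)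
  finally show "emeasure (distr lborel borel to_wo) (box l u) = (\<Prod>b\<in>Basis. (u - l) \<bullet> b)" .
qed simp

lemma nn_integral_to_wo:
  fixes f :: "real ^ 'n::finite wo \<Rightarrow> ennreal"
  assumes "f \<in> borel_measurable borel"
  shows "(\<integral>\<^sup>+y. f y \<partial>lborel) = (\<integral>\<^sup>+x. f (to_wo x) \<partial>lborel)"
  using assms by (subst lborel_to_wo[symmetric]) (simp add: nn_integral_distr)

text \<open>In the Leibniz formula, conjugation by the relabelling is a sign-preserving bijection
  between the two permutation groups.\<close>

lemma det_wo:
  fixes A :: "real ^ 'n::finite ^ 'n"
  shows "det (\<chi> i j. A $ un_wo i $ un_wo j) = det A"
proof -
  have 1: "(\<Sum>p | p permutes (UNIV :: 'n set). of_int (sign p) * (\<Prod>i\<in>UNIV. A $ i $ p i))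
     = (\<Sum>p | p permutes (UNIV :: 'n wo set). of_int (sign p) * (\<Prod>i\<in>UNIV. A $ un_wo i $ un_wo (p i)))"
  proof (rule sum.reindex_bij_witness[where
        j = "\<lambda>p. mk_wo \<circ> p \<circ> un_wo" and i = "\<lambda>p. un_wo \<circ> p \<circ> mk_wo"])
    fix p :: "'n \<Rightarrow> 'n" assume p: "p \<in> {p. p permutes UNIV}"
    have bm: "bij_betw mk_wo (UNIV :: 'n set) UNIV"
      by (metis bij_iff un_wo_inverse mk_wo_inverse UNIV_I)
    \<comment> \<open>Conjugation is an instance of \<open>map_permutation\<close>, whose effect on
      the sign is known.\<close>
    have "inv_into UNIV mk_wo = (un_wo :: 'n wo \<Rightarrow> 'n)"
      by (rule inv_equality) (auto simp: mk_wo_inverse un_wo_inverse)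
    then have "map_permutation UNIV mk_wo p = mk_wo \<circ> p \<circ> un_wo"
      using bm by (auto simp: map_permutation_def restrict_id_def bij_betw_def fun_eq_iff)
    moreover have "sign (map_permutation UNIV mk_wo p) = sign p"
      using p bm by (intro sign_map_permutation) (auto simp: bij_betw_def)
    ultimately have s: "sign (mk_wo \<circ> p \<circ> un_wo) = sign p" by simp
    have "(\<Prod>i\<in>UNIV. A $ i $ p i) = (\<Prod>i\<in>UNIV. A $ un_wo i $ p (un_wo i))"
      by (rule prod.reindex_bij_betw[OF bij_un_wo, symmetric])
    with s show "of_int (sign (mk_wo \<circ> p \<circ> un_wo)) *
       (\<Prod>i\<in>UNIV. A $ un_wo i $ un_wo ((mk_wo \<circ> p \<circ> un_wo) i))
       = of_int (sign p) * (\<Prod>i\<in>UNIV. A $ i $ p i)"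
      by (simp add: mk_wo_inverse)
    show "mk_wo \<circ> p \<circ> un_wo \<in> {p. p permutes UNIV}"
      using p bm bij_un_wo by (auto simp: permutes_bij bij_imp_permutes intro!: bij_comp bij_imp_permutes)
  next
    fix p :: "'n wo \<Rightarrow> 'n wo" assume p: "p \<in> {p. p permutes UNIV}"
    have bm: "bij_betw mk_wo (UNIV :: 'n set) UNIV"
      by (metis bij_iff un_wo_inverse mk_wo_inverse UNIV_I)
    show "un_wo \<circ> p \<circ> mk_wo \<in> {p. p permutes UNIV}"
      using p bm bij_un_wo by (auto simp: permutes_bij bij_imp_permutes intro!: bij_comp bij_imp_permutes)
  qed (auto simp: fun_eq_iff mk_wo_inverse un_wo_inverse)
  show ?thesis unfolding det_def by (simp add: 1)
qed

text \<open>The substitution theorem used here is an equivalence: one side is absolutely integrable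
  with a given integral iff the other is. For nonnegative functions, failure of integrability means
  that the integral is \<infinity>, so the equivalence becomes an equality without any integrability
  hypothesis.\<close>

lemma nn_integral_change_of_variables_wo:
  fixes f :: "real ^ 'n::{finite,wellorder} \<Rightarrow> real"
  assumes S: "S \<in> sets borel"
    and TS: "T ` S \<in> sets borel"
    and der: "\<And>x. x \<in> S \<Longrightarrow> (T has_derivative T' x) (at x)"
    and inj: "inj_on T S"
    and f: "f \<in> borel_measurable borel" "\<And>x. 0 \<le> f x"
    and m: "(\<lambda>x. indicator S x * (\<bar>det (matrix (T' x))\<bar> * f (T x))) \<in> borel_measurable borel"
  shows "(\<integral>\<^sup>+y\<in>T ` S. ennreal (f y) \<partial>lborel) =
    (\<integral>\<^sup>+x\<in>S. ennreal (\<bar>det (matrix (T' x))\<bar> * f (T x)) \<partial>lborel)"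
proof -
  let ?F = "\<lambda>x. \<bar>det (matrix (T' x))\<bar> * f (T x)"
  \<comment> \<open>The theorem concerns vector-valued integrands; \<open>real^1\<close> encodes the
    scalar case.\<close>
  have cov: "(?F absolutely_integrable_on S \<and> integral S ?F = b)
     \<longleftrightarrow> (f absolutely_integrable_on (T ` S) \<and> integral (T ` S) f = b)" for b
  proof -
    have "(\<lambda>x. \<bar>det (matrix (T' x))\<bar> *\<^sub>R (vec (f (T x)) :: real^1)) absolutely_integrable_on S \<and>
           integral S (\<lambda>x. \<bar>det (matrix (T' x))\<bar> *\<^sub>R (vec (f(T x)) :: real^1)) = vec b
      \<longleftrightarrow> (\<lambda>x. vec (f x) :: real^1) absolutely_integrable_on (T ` S) \<and>
          integral (T ` S) (\<lambda>x. vec (f x) :: real^1) = vec b"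
      by (rule has_absolute_integral_change_of_variables)
         (use S der inj in \<open>auto intro: has_derivative_at_withinI\<close>)
    then show ?thesis
      by (simp add: absolutely_integrable_on_1_iff integral_on_1_eq)
  qed
  have F0: "0 \<le> ?F x" for x using f by simp
  \<comment> \<open>A Borel nonnegative function that is not absolutely integrable has infinite
    integral, since a finite one would make it integrable.\<close>
  have gen: "(\<integral>\<^sup>+x\<in>B. ennreal (h x) \<partial>lborel) = (if h absolutely_integrable_on B
      then ennreal (integral B h) else \<infinity>)"
    if B: "(\<lambda>x. indicator B x * h x) \<in> borel_measurable borel" and h: "\<And>x. 0 \<le> h x"
    for h and B :: "_ set"
  proof (cases "h absolutely_integrable_on B")
    case True
    then show ?thesis
      by (simp add: nn_integral_has_integral_lebesgue'[OF h integrable_integral]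
          set_lebesgue_integral_eq_integral(1))
  next
    case False
    have "(\<integral>\<^sup>+x\<in>B. ennreal (h x) \<partial>lborel) = \<infinity>"
    proof (rule ccontr)
      assume "\<not> ?thesis"
      moreover have eq: "(\<integral>\<^sup>+x\<in>B. ennreal (h x) \<partial>lborel) = (\<integral>\<^sup>+x. ennreal (indicator B x * h x) \<partial>lborel)"
        by (intro nn_integral_cong) (auto simp: indicator_def)
      ultimately have "integrable lborel (\<lambda>x. indicator B x * h x)"
        using B h by (intro integrableI_bounded) (auto simp: less_top abs_mult)
      then have "h absolutely_integrable_on B"
        unfolding set_integrable_def
        by (metis (mono_tags, lifting) integrable_completion borel_measurable_integrable real_scaleR_def sets_lborel measurable_lborel1 Bochner_Integration.integrable_cong)
      with False show False by simp
    qed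
    with False show ?thesis by simp
  qed
  show ?thesis
    using gen[OF m F0] gen[of "T ` S" f] TS f cov[of "integral S ?F"] cov[of "integral (T ` S) f"]
    by auto
qed

text \<open>Conjugate \<open>T\<close> by the relabelling: it preserves Lebesgue measure, and the
  determinant of the derivative is unchanged by \<open>det_wo\<close>.\<close>

lemma nn_integral_change_of_variables:
  fixes f :: "real ^ 'n::finite \<Rightarrow> real"
  assumes S: "S \<in> sets borel"
    and TS: "T ` S \<in> sets borel"
    and der: "\<And>x. x \<in> S \<Longrightarrow> (T has_derivative T' x) (at x)"
    and inj: "inj_on T S"
    and f: "f \<in> borel_measurable borel" "\<And>x. 0 \<le> f x"
    and m: "(\<lambda>x. indicator S x * (\<bar>det (matrix (T' x))\<bar> * f (T x))) \<in> borel_measurable borel"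
  shows "(\<integral>\<^sup>+y\<in>T ` S. ennreal (f y) \<partial>lborel) =
    (\<integral>\<^sup>+x\<in>S. ennreal (\<bar>det (matrix (T' x))\<bar> * f (T x)) \<partial>lborel)"
proof -
  define R where "R = (\<lambda>x. to_wo (T (of_wo x)))"
  define R' where "R' = (\<lambda>x v. to_wo (T' (of_wo x) (of_wo v)))"
  have img: "to_wo ` B = of_wo -` B" for B :: "(real ^ 'n) set"
    by (auto simp: image_iff) (metis to_of_wo)
  have meas: "to_wo ` B \<in> sets borel" if "B \<in> sets borel" for B :: "(real ^ 'n) set"
    using measurable_sets[OF measurable_of_wo that] by (simp add: img)
  have RS: "R ` to_wo ` S = to_wo ` T ` S"
    by (auto simp: R_def image_image)
  have dR: "(R has_derivative R' x) (at x)" if "x \<in> to_wo ` S" for x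
  proof -
    have "of_wo x \<in> S" using that by auto
    then have "((\<lambda>x. T (of_wo x)) has_derivative (\<lambda>v. T' (of_wo x) (of_wo v))) (at x)"
      using has_derivative_compose[OF linear_imp_has_derivative[OF linear_of_wo] der] by blast
    then show ?thesis unfolding R_def R'_def
      using has_derivative_compose linear_imp_has_derivative[OF linear_to_wo] by blast
  qed
  have det_R: "det (matrix (R' x)) = det (matrix (T' (of_wo x)))" if x: "x \<in> to_wo ` S" for x
  proof -
    have e: "of_wo (axis j 1) = (axis (un_wo j) 1 :: real ^ 'n)" for j :: "'n wo"
      by (auto simp: of_wo_def axis_def vec_eq_iff) (metis mk_wo_inverse UNIV_I un_wo_inverse)+
    have "matrix (R' x) = (\<chi> i j. matrix (T' (of_wo x)) $ un_wo i $ un_wo j)"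
      by (simp add: matrix_def R'_def e vec_eq_iff to_wo_def)
    then show ?thesis by (simp add: det_wo)
  qed
  have inj_to: "inj to_wo" and inj_of: "inj of_wo"
    by (metis injI of_to_wo, metis injI to_of_wo)
  have eqm: "(\<lambda>x. indicator (to_wo ` S) x * (\<bar>det (matrix (R' x))\<bar> * f (of_wo (R x)))) =
     (\<lambda>x. indicator S x * (\<bar>det (matrix (T' x))\<bar> * f (T x))) \<circ> of_wo"
    by (auto simp: fun_eq_iff indicator_def img det_R R_def)
  have m': "(\<lambda>x. indicator (to_wo ` S) x * (\<bar>det (matrix (R' x))\<bar> * f (of_wo (R x)))) \<in> borel_measurable borel"
    unfolding eqm by (rule measurable_comp[OF measurable_of_wo m])
  have pt: "indicator (to_wo ` S) (to_wo x) * (\<bar>det (matrix (R' (to_wo x)))\<bar> * f (of_wo (R (to_wo x))))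
      = indicator S x * (\<bar>det (matrix (T' x))\<bar> * f (T x))" for x
    using fun_cong[OF eqm, of "to_wo x"] by simp
  have "(\<integral>\<^sup>+y\<in>T ` S. ennreal (f y) \<partial>lborel) = (\<integral>\<^sup>+y. ennreal (f (of_wo y)) * indicator (to_wo ` T ` S) y \<partial>lborel)"
    using f TS meas[OF TS]
    by (subst nn_integral_to_wo) (auto simp: inj_image_mem_iff[OF inj_to] indicator_def intro!: nn_integral_cong)
  also have "\<dots> = (\<integral>\<^sup>+y\<in>R ` to_wo ` S. ennreal (f (of_wo y)) \<partial>lborel)"
    by (simp add: RS)
  also have "\<dots> = (\<integral>\<^sup>+x\<in>to_wo ` S. ennreal (\<bar>det (matrix (R' x))\<bar> * f (of_wo (R x))) \<partial>lborel)"
    using f inj dR m' meas[OF S] meas[OF TS]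
    by (intro nn_integral_change_of_variables_wo)
       (auto simp: RS, auto simp: R_def inj_on_def dest!: injD[OF inj_to])
  also have "\<dots> = (\<integral>\<^sup>+x. ennreal (indicator (to_wo ` S) x * (\<bar>det (matrix (R' x))\<bar> * f (of_wo (R x)))) \<partial>lborel)"
    by (intro nn_integral_cong) (auto simp: indicator_def)
  also have "\<dots> = (\<integral>\<^sup>+x. ennreal (indicator S x * (\<bar>det (matrix (T' x))\<bar> * f (T x))) \<partial>lborel)"
    by (subst nn_integral_to_wo[OF measurable_compose[OF m' measurable_ennreal]]) (simp only: pt)
  also have "\<dots> = (\<integral>\<^sup>+x\<in>S. ennreal (\<bar>det (matrix (T' x))\<bar> * f (T x)) \<partial>lborel)"
    by (intro nn_integral_cong) (auto simp: indicator_def)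
  finally show ?thesis .
qed

section \<open>Calculus of smooth functions\<close>

lemma Ck_on_imp_continuous_on: "Ck_on k S f \<Longrightarrow> continuous_on S f"
  using differentiable_imp_continuous_on by (cases k) auto

lemma Ck_on_imp_differentiable:
  assumes "Ck_on (Suc k) S f" "open S" "x \<in> S"
  shows "f differentiable (at x)"
  using assms at_within_open[of x S] unfolding Ck_on.simps differentiable_on_def by metis

lemma Ck_on_Suc_imp: "Ck_on (Suc k) S f \<Longrightarrow> Ck_on k S f"
proof (induction k arbitrary: f)
  case 0
  then show ?case by (auto intro: differentiable_imp_continuous_on)
next
  case (Suc k)
  then show ?case by (metis Ck_on.simps(2))
qed

text \<open>The congruence rule at level k is a hypothesis because this lemma drives the inductive
  step of the proof of that very rule; \<open>Ck_on_SucI\<close> later discharges it.\<close>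

lemma Ck_on_Suc_I:
  fixes f :: "'a::real_normed_vector \<Rightarrow> 'b::real_normed_vector"
  assumes "open S" "\<And>x. x \<in> S \<Longrightarrow> (f has_derivative D x) (at x)"
    and "\<And>v. Ck_on k S (\<lambda>x. D x v)"
    and cong: "\<And>f g :: 'a \<Rightarrow> 'b. (\<And>x. x \<in> S \<Longrightarrow> f x = g x) \<Longrightarrow> Ck_on k S f \<Longrightarrow> Ck_on k S g"
  shows "Ck_on (Suc k) S f"
proof -
  have "D x v = frechet_derivative f (at x) v" if "x \<in> S" for x v
    using frechet_derivative_at[OF assms(2)[OF that]] by simp
  then have "Ck_on k S (\<lambda>x. frechet_derivative f (at x) v)" for v
    by (rule cong[OF _ assms(3)])
  moreover have "f differentiable_on S"
    by (rule differentiable_at_imp_differentiable_on) (rule differentiableI[OF assms(2)])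
  ultimately show ?thesis by simp
qed

text \<open>On an open set the derivative at a point sees only values inside the set, so agreement
  on \<open>S\<close> passes to all derivatives.\<close>

lemma Ck_on_cong:
  assumes "open S" "\<And>x. x \<in> S \<Longrightarrow> f x = g x" "Ck_on k S f"
  shows "Ck_on k S g"
  using assms(2,3)
proof (induction k arbitrary: f g)
  case 0
  then show ?case by (metis Ck_on.simps(1) continuous_on_cong)
next
  case (Suc k)
  show ?case
  proof (rule Ck_on_Suc_I[OF assms(1)])
    fix x assume x: "x \<in> S"
    have "(f has_derivative frechet_derivative f (at x)) (at x)"
      using Ck_on_imp_differentiable[OF Suc.prems(2) assms(1) x] frechet_derivative_works by blast
    then show "(g has_derivative frechet_derivative f (at x)) (at x)"
      by (rule has_derivative_transform_within_open[OF _ assms(1) x]) (simp add: Suc.prems)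
  qed (use Suc in auto)
qed

lemma Ck_on_SucI:
  assumes "open S" "\<And>x. x \<in> S \<Longrightarrow> (f has_derivative D x) (at x)"
    and "\<And>v. Ck_on k S (\<lambda>x. D x v)"
  shows "Ck_on (Suc k) S f"
  by (rule Ck_on_Suc_I[OF assms Ck_on_cong[OF assms(1)]])

lemma Ck_on_has_derivative:
  assumes "Ck_on (Suc k) S f" "open S" "x \<in> S"
  shows "(f has_derivative frechet_derivative f (at x)) (at x)"
  using Ck_on_imp_differentiable[OF assms] frechet_derivative_works by blast

lemma Ck_on_local:
  assumes "open S" "\<And>x. x \<in> S \<Longrightarrow> \<exists>T. open T \<and> x \<in> T \<and> Ck_on k T f"
  shows "Ck_on k S f"
  using assms(2)
proof (induction k arbitrary: f)
  case 0
  show ?case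
    using 0 assms(1)
    by (simp add: continuous_on_eq_continuous_at) (metis continuous_on_eq_continuous_at)
next
  case (Suc k)
  have "f differentiable (at x)" if "x \<in> S" for x
    using Suc.prems[OF that] Ck_on_imp_differentiable by blast
  then have "f differentiable_on S"
    by (simp add: differentiable_at_imp_differentiable_on)
  moreover have "Ck_on k S (\<lambda>x. frechet_derivative f (at x) v)" for v
    using Suc.prems by (intro Suc.IH) (metis Ck_on.simps(2))
  ultimately show ?case by simp
qed

lemma Ck_on_const [simp]: "open S \<Longrightarrow> Ck_on k S (\<lambda>x. c)"
proof (induction k arbitrary: c)
  case (Suc k)
  then show ?case
    by (intro Ck_on_SucI[where D = "\<lambda>x v. 0"]) (auto)
qed simp

lemma Ck_on_add:
  assumes "open S" "Ck_on k S f" "Ck_on k S g"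
  shows "Ck_on k S (\<lambda>x. f x + g x)"
  using assms(2,3)
proof (induction k arbitrary: f g)
  case 0
  then show ?case by (auto intro: continuous_intros)
next
  case (Suc k)
  show ?case
    by (rule Ck_on_SucI[OF assms(1) has_derivative_add[OF Ck_on_has_derivative[OF Suc.prems(1) assms(1)]
            Ck_on_has_derivative[OF Suc.prems(2) assms(1)]]])
       (use Suc in auto)
qed

lemma Ck_on_scaleR:
  fixes a :: "'a::real_normed_vector \<Rightarrow> real"
  assumes "open S" "Ck_on k S a" "Ck_on k S f"
  shows "Ck_on k S (\<lambda>x. a x *\<^sub>R f x)"
  using assms(2,3)
proof (induction k arbitrary: a f)
  case 0
  then show ?case by (auto intro: continuous_intros)
next
  case (Suc k)
  show ?case
  proof (rule Ck_on_SucI[OF assms(1) has_derivative_scaleR[OF Ck_on_has_derivative[OF Suc.prems(1) assms(1)]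
            Ck_on_has_derivative[OF Suc.prems(2) assms(1)]]])
    show "Ck_on k S (\<lambda>x. a x *\<^sub>R frechet_derivative f (at x) v + frechet_derivative a (at x) v *\<^sub>R f x)" for v
      using Suc Ck_on_Suc_imp[OF Suc.prems(1)] Ck_on_Suc_imp[OF Suc.prems(2)]
      by (intro Ck_on_add Suc.IH assms(1)) auto
  qed
qed

lemma Ck_on_mult:
  fixes f g :: "'a::real_normed_vector \<Rightarrow> real"
  assumes "open S" "Ck_on k S f" "Ck_on k S g"
  shows "Ck_on k S (\<lambda>x. f x * g x)"
  using Ck_on_scaleR[OF assms] by simp

lemma Ck_on_uminus:
  assumes "open S" "Ck_on k S f"
  shows "Ck_on k S (\<lambda>x. - f x)"
  using Ck_on_scaleR[OF assms(1) Ck_on_const[OF assms(1), of k "-1"] assms(2)] by simp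

lemma Ck_on_diff:
  assumes "open S" "Ck_on k S f" "Ck_on k S g"
  shows "Ck_on k S (\<lambda>x. f x - g x)"
  using Ck_on_add[OF assms(1,2) Ck_on_uminus[OF assms(1,3)]] by simp

lemma Ck_on_sum:
  assumes "open S" "\<And>i. i \<in> I \<Longrightarrow> Ck_on k S (f i)"
  shows "Ck_on k S (\<lambda>x. \<Sum>i\<in>I. f i x)"
  using assms(2) by (induction I rule: infinite_finite_induct) (auto simp: assms(1) intro: Ck_on_add[OF assms(1)])

lemma Ck_on_prod:
  fixes f :: "'i \<Rightarrow> 'a::real_normed_vector \<Rightarrow> real"
  assumes "open S" "\<And>i. i \<in> I \<Longrightarrow> Ck_on k S (f i)"
  shows "Ck_on k S (\<lambda>x. \<Prod>i\<in>I. f i x)"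
  using assms(2) by (induction I rule: infinite_finite_induct) (auto simp: assms(1) intro: Ck_on_mult[OF assms(1)])

lemma Ck_on_bounded_linear:
  assumes "open S" "bounded_linear L" "Ck_on k S f"
  shows "Ck_on k S (\<lambda>x. L (f x))"
  using assms(3)
proof (induction k arbitrary: f)
  case 0
  then show ?case by (auto intro: bounded_linear.continuous_on[OF assms(2)])
next
  case (Suc k)
  show ?case
    by (rule Ck_on_SucI[OF assms(1) bounded_linear.has_derivative[OF assms(2)
            Ck_on_has_derivative[OF Suc.prems assms(1)]]])
       (use Suc in auto)
qed

lemma Ck_on_bounded_linear_self:
  assumes "open S" "bounded_linear L"
  shows "Ck_on k S L"
proof (cases k)
  case 0
  then show ?thesis using assms by (simp add: linear_continuous_on)
next
  case (Suc j)
  show ?thesis unfolding Suc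
    by (rule Ck_on_SucI[where D = "\<lambda>x. L"]) (use assms in \<open>auto intro: bounded_linear_imp_has_derivative\<close>)
qed

text \<open>In the chain rule the derivative of \<open>f\<close> is evaluated in a direction that
  depends on x, while \<open>Ck_on\<close> only knows fixed directions. Expanding that direction in
  the basis gives a finite sum of products, to which the induction hypothesis applies.\<close>

lemma Ck_on_compose:
  fixes h :: "'a::real_normed_vector \<Rightarrow> 'b::euclidean_space"
  assumes "open S" "open T" "h ` S \<subseteq> T" "Ck_on k S h" "Ck_on k T f"
  shows "Ck_on k S (\<lambda>x. f (h x))"
  using assms(4,5)
proof (induction k arbitrary: f)
  case 0
  then show ?case using assms(3) by (auto intro: continuous_on_compose2)
next
  case (Suc k)
  show ?case
  proof (rule Ck_on_SucI[OF assms(1)])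
    fix x assume x: "x \<in> S"
    have "h x \<in> T" using x assms(3) by auto
    let ?D = "\<lambda>v. \<Sum>b\<in>Basis. (frechet_derivative h (at x) v \<bullet> b) *\<^sub>R frechet_derivative f (at (h x)) b"
    have l: "linear (frechet_derivative f (at (h x)))"
      using Ck_on_imp_differentiable[OF Suc.prems(2) assms(2) \<open>h x \<in> T\<close>]
      by (rule linear_frechet_derivative)
    have "((\<lambda>x. f (h x)) has_derivative (\<lambda>v. frechet_derivative f (at (h x)) (frechet_derivative h (at x) v))) (at x)"
      by (rule has_derivative_compose[OF Ck_on_has_derivative[OF Suc.prems(1) assms(1) x]
            Ck_on_has_derivative[OF Suc.prems(2) assms(2) \<open>h x \<in> T\<close>]])
    moreover have "frechet_derivative f (at (h x)) w = (\<Sum>b\<in>Basis. (w \<bullet> b) *\<^sub>R frechet_derivative f (at (h x)) b)" for w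
      by (subst (1) euclidean_representation[symmetric]) (simp add: linear_sum[OF l] linear_cmul[OF l])
    then have "(\<lambda>v. frechet_derivative f (at (h x)) (frechet_derivative h (at x) v)) = ?D"
      by (intro ext)
    ultimately show "((\<lambda>x. f (h x)) has_derivative ?D) (at x)" by metis
  next
    fix v
    show "Ck_on k S (\<lambda>x. \<Sum>b\<in>Basis. (frechet_derivative h (at x) v \<bullet> b) *\<^sub>R frechet_derivative f (at (h x)) b)"
    proof (intro Ck_on_sum Ck_on_scaleR assms(1))
      fix b :: 'b
      show "Ck_on k S (\<lambda>x. frechet_derivative h (at x) v \<bullet> b)"
        using Suc.prems(1) by (auto intro!: Ck_on_bounded_linear[OF assms(1) bounded_linear_inner_left])
      show "Ck_on k S (\<lambda>x. frechet_derivative f (at (h x)) b)"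
        using Suc.prems(2) by (intro Suc.IH Ck_on_Suc_imp[OF Suc.prems(1)]) simp
    qed
  qed
qed

lemma Ck_on_real_SucI:
  fixes f :: "real \<Rightarrow> real"
  assumes "open S" "\<And>x. x \<in> S \<Longrightarrow> (f has_real_derivative f' x) (at x)" "Ck_on k S f'"
  shows "Ck_on (Suc k) S f"
proof (rule Ck_on_SucI[OF assms(1)])
  show "(f has_derivative (\<lambda>v. f' x * v)) (at x)" if "x \<in> S" for x
    using assms(2)[OF that] by (simp add: has_field_derivative_def)
  show "Ck_on k S (\<lambda>x. f' x * v)" for v
    by (intro Ck_on_mult Ck_on_const assms)
qed

section \<open>A smooth step function\<close>

definition flat_exp :: "real poly \<Rightarrow> real \<Rightarrow> real" where
  "flat_exp p x = (if 0 < x then poly p (1 / x) * exp (- (1 / x)) else 0)"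

text \<open>The class of all \<open>flat_exp p\<close> is closed under differentiation.\<close>

definition flat_deriv :: "real poly \<Rightarrow> real poly" where
  "flat_deriv p = [:0, 0, 1:] * (p - pderiv p)"

text \<open>The power \<open>y ^ n\<close> strengthens the induction over coefficients: peeling off
  the constant coefficient leaves y times a smaller polynomial, and the extra y is absorbed in the
  power.\<close>

lemma poly_exp_tendsto_0: "((\<lambda>y. y ^ n * poly p y * exp (- y)) \<longlongrightarrow> 0) at_top" for p :: "real poly"
proof (induction p arbitrary: n)
  case (pCons a p)
  have "((\<lambda>y::real. a * (y ^ n / exp y) + y ^ Suc n * poly p y * exp (- y)) \<longlongrightarrow> a * 0 + 0) at_top"
    by (intro tendsto_add tendsto_mult tendsto_const tendsto_power_div_exp_0 pCons.IH)
  then show ?case by (simp add: algebra_simps exp_minus divide_inverse)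
qed simp

lemma DERIV_flat_exp: "(flat_exp p has_real_derivative flat_exp (flat_deriv p) x) (at x)"
proof -
  consider "x < 0" | "x = 0" | "0 < x" by linarith
  then show ?thesis
  proof cases
    case 1
    have "((\<lambda>x. 0) has_real_derivative 0) (at x)" by simp
    then have "(flat_exp p has_real_derivative 0) (at x)"
      by (rule has_field_derivative_transform_within_open[where S = "{..<0}"]) (use 1 in \<open>auto simp: flat_exp_def\<close>)
    then show ?thesis using 1 by (simp add: flat_exp_def)
  next
    case 2
    have "((\<lambda>h. flat_exp p h / h) \<longlongrightarrow> 0) (at_right 0)"
    proof -
      \<comment> \<open>With y = 1/h, dividing by h multiplies by y once, hence the exponent
        1.\<close>
      have "((\<lambda>h::real. (inverse h) ^ 1 * poly p (inverse h) * exp (- inverse h)) \<longlongrightarrow> 0) (at_right 0)"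
        by (rule filterlim_compose[OF poly_exp_tendsto_0 filterlim_inverse_at_top_right])
      then show ?thesis
        by (rule Lim_transform_eventually)
           (auto simp: eventually_at_right_field flat_exp_def field_simps intro: exI[of _ 1])
    qed
    moreover have "((\<lambda>h. flat_exp p h / h) \<longlongrightarrow> 0) (at_left 0)"
      by (rule Lim_transform_eventually[OF tendsto_const])
         (auto simp: eventually_at_left_field flat_exp_def intro: exI[of _ "-1"])
    ultimately have "((\<lambda>h. flat_exp p h / h) \<longlongrightarrow> 0) (at 0)"
      by (simp add: filterlim_at_split)
    then show ?thesis using 2 by (simp add: DERIV_def flat_exp_def)
  next
    case 3
    \<comment> \<open>With y = 1/x one has dy/dx = - y^2, and p(y) exp(-y) has y-derivative (p' -
      p)(y) exp(-y); the product is \<open>flat_deriv p\<close> at y times exp(-y).\<close>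
    have "((\<lambda>x. poly p (1 / x) * exp (- (1 / x))) has_real_derivative flat_exp (flat_deriv p) x) (at x)"
      using 3
      by (auto intro!: derivative_eq_intros DERIV_chain2[OF poly_DERIV]
          simp: flat_exp_def flat_deriv_def field_simps power2_eq_square)
    then show ?thesis
      by (rule has_field_derivative_transform_within_open[where S = "{0<..}"]) (use 3 in \<open>auto simp: flat_exp_def\<close>)
  qed
qed

lemma Ck_on_flat_exp: "Ck_on k UNIV (flat_exp p)"
proof (induction k arbitrary: p)
  case 0
  show ?case
    using DERIV_flat_exp[of p] by (auto intro!: DERIV_continuous_on[of _ _ "\<lambda>x. flat_exp (flat_deriv p) x"] simp: )
next
  case (Suc k)
  show ?case by (rule Ck_on_real_SucI[OF _ DERIV_flat_exp Suc]) auto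
qed

lemma bounded_if_vanishing_outside_unit_interval:
  fixes f :: "real \<Rightarrow> real"
  assumes "continuous_on UNIV f" "\<And>x. x \<le> 0 \<or> 1 \<le> x \<Longrightarrow> f x = 0"
  obtains C where "0 < C" "\<And>x. \<bar>f x\<bar> \<le> C"
proof -
  have "bounded (f ` {0..1})"
    by (intro compact_imp_bounded compact_continuous_image continuous_on_subset[OF assms(1)]) auto
  then obtain C where "0 < C" "\<And>x. x \<in> {0..1} \<Longrightarrow> \<bar>f x\<bar> \<le> C"
    unfolding bounded_pos by auto
  then show ?thesis
    using assms(2) by (intro that[of C]) (smt (verit) atLeastAtMost_iff)+
qed

text \<open>A normalized primitive of the bump e(x) e(1 - x), where e(x) = exp(-1/x) for x > 0. The
  single constant C bounds the derivative and serves as Lipschitz constant of both \<sigma> and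
  \<sigma>'. The latter is needed when squares of derivatives pass to a limit and when gradients of
  cutoffs are compared at two times.\<close>

lemma smooth_step:
  obtains \<sigma> \<sigma>' :: "real \<Rightarrow> real" and C :: real
  where "smooth_on UNIV \<sigma>" "\<And>x. (\<sigma> has_real_derivative \<sigma>' x) (at x)" "0 < C"
    "\<And>x. x \<le> 0 \<Longrightarrow> \<sigma> x = 0" "\<And>x. 1 \<le> x \<Longrightarrow> \<sigma> x = 1" "\<And>x. 0 \<le> \<sigma> x" "\<And>x. \<sigma> x \<le> 1"
    "\<And>x. x \<le> 0 \<or> 1 \<le> x \<Longrightarrow> \<sigma>' x = 0"
    "\<And>x. \<bar>\<sigma>' x\<bar> \<le> C" "\<And>x y. \<bar>\<sigma> x - \<sigma> y\<bar> \<le> C * \<bar>x - y\<bar>" "\<And>x y. \<bar>\<sigma>' x - \<sigma>' y\<bar> \<le> C * \<bar>x - y\<bar>"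
proof -
  define e where "e = flat_exp [:1:]"
  define e' where "e' = flat_exp (flat_deriv [:1:])"
  define b where "b = (\<lambda>x. e x * e (1 - x))"
  define b' where "b' = (\<lambda>x. e' x * e (1 - x) - e x * e' (1 - x))"
  have e: "(e has_real_derivative e' x) (at x)" for x
    unfolding e_def e'_def by (rule DERIV_flat_exp)
  have e0: "x \<le> 0 \<Longrightarrow> e x = 0" "x \<le> 0 \<Longrightarrow> e' x = 0" "0 < x \<Longrightarrow> 0 < e x" "0 \<le> e x" for x
    by (auto simp: e_def e'_def flat_exp_def)
  have Ck_aff: "Ck_on k UNIV (\<lambda>x::real. 1 - x)" for k
    by (intro Ck_on_diff Ck_on_const Ck_on_bounded_linear_self) auto
  have Ck_e: "Ck_on k UNIV e" "Ck_on k UNIV (\<lambda>x. e (1 - x))" for k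
    using Ck_on_compose[OF _ _ _ Ck_aff Ck_on_flat_exp] Ck_on_flat_exp unfolding e_def by auto
  have Ck_b: "Ck_on k UNIV b" for k
    unfolding b_def by (intro Ck_on_mult Ck_e) auto
  have b: "(b has_real_derivative b' x) (at x)" for x
    unfolding b_def b'_def
    by (auto intro!: derivative_eq_intros e DERIV_chain2[OF e])
  have cont_e': "continuous_on UNIV e'"
    using Ck_on_flat_exp[of 0] unfolding e'_def by simp
  have cont_b: "continuous_on UNIV b" using Ck_b[of 0] by simp
  have cont_b': "continuous_on UNIV b'"
    unfolding b'_def using Ck_e[of 0] cont_e'
    by (auto intro!: continuous_intros continuous_on_compose2[OF cont_e'])
  have b0: "b x = 0" "b' x = 0" if "x \<le> 0 \<or> 1 \<le> x" for x
    using that e0 by (auto simp: b_def b'_def)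
  have b_pos: "0 < b x" if "0 < x" "x < 1" for x
    using that e0(3) by (simp add: b_def)
  have b_nonneg: "0 \<le> b x" for x
    using e0(4) by (simp add: b_def)
  obtain F where F: "\<And>x. (F has_real_derivative b x) (at x)"
  proof -
    have "\<exists>F. \<forall>x::real. -\<infinity> < ereal x \<longrightarrow> ereal x < \<infinity> \<longrightarrow> (F has_vector_derivative b x) (at x)"
      by (rule einterval_antiderivative) (use cont_b in \<open>auto simp: continuous_on_eq_continuous_at\<close>)
    then show ?thesis
      using that by (auto simp: has_real_derivative_iff_has_vector_derivative)
  qed
  have F_mono: "F x \<le> F y" if "x \<le> y" for x y
    using DERIV_nonneg_imp_nondecreasing[OF that] F b_nonneg by blast
  have F_left: "F x = F 0" if "x \<le> 0" for x
  proof (rule antisym[OF F_mono[OF that]])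
    show "F 0 \<le> F x"
      by (rule DERIV_nonpos_imp_nonincreasing[OF that]) (metis F b0(1) order_refl)
  qed
  have F_right: "F x = F 1" if "1 \<le> x" for x
  proof (rule antisym[OF _ F_mono[OF that]])
    show "F x \<le> F 1"
      by (rule DERIV_nonpos_imp_nonincreasing[OF that]) (metis F b0(1) order_refl)
  qed
  define I where "I = F 1 - F 0"
  \<comment> \<open>The bump is positive on this closed interval, which keeps away from its zeros at
    0 and 1; monotonicity then gives F 0 < F 1.\<close>
  have "F (1/4) < F (3/4)"
  proof (rule DERIV_pos_imp_increasing[where a = "1/4" and b = "3/4"])
    show "\<exists>y. (F has_real_derivative y) (at x) \<and> 0 < y" if "1/4 \<le> x" "x \<le> 3/4" for x
      using F[of x] b_pos[of x] that by auto
  qed simp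
  then have I: "0 < I"
    using F_mono[of 0 "1/4"] F_mono[of "3/4" 1] by (simp add: I_def)
  define \<sigma> where "\<sigma> = (\<lambda>x. inverse I * (F x - F 0))"
  define \<sigma>' where "\<sigma>' = (\<lambda>x. inverse I * b x)"
  have D: "(\<sigma> has_real_derivative \<sigma>' x) (at x)" for x
    unfolding \<sigma>_def \<sigma>'_def by (auto intro!: derivative_eq_intros F)
  have D': "(\<sigma>' has_real_derivative inverse I * b' x) (at x)" for x
    unfolding \<sigma>'_def by (auto intro!: derivative_eq_intros b)
  obtain C1 where C1: "0 < C1" "\<And>x. \<bar>\<sigma>' x\<bar> \<le> C1"
    by (rule bounded_if_vanishing_outside_unit_interval[of \<sigma>'])
       (use cont_b b0 in \<open>auto simp: \<sigma>'_def intro!: continuous_intros\<close>)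
  obtain C2 where C2: "0 < C2" "\<And>x. \<bar>inverse I * b' x\<bar> \<le> C2"
    by (rule bounded_if_vanishing_outside_unit_interval[of "\<lambda>x. inverse I * b' x"])
       (use cont_b' b0 in \<open>auto intro!: continuous_intros\<close>)
  have Ck_\<sigma>': "Ck_on k UNIV \<sigma>'" for k
    unfolding \<sigma>'_def by (intro Ck_on_mult Ck_on_const Ck_b) auto
  show ?thesis
  proof (rule that[of \<sigma> \<sigma>' "max C1 C2"])
    show "smooth_on UNIV \<sigma>"
      unfolding smooth_on_def
      using Ck_on_real_SucI[OF _ D Ck_\<sigma>'] Ck_on_Suc_imp by blast
    show "\<bar>\<sigma> x - \<sigma> y\<bar> \<le> max C1 C2 * \<bar>x - y\<bar>" for x y
      using field_differentiable_bound[of UNIV \<sigma> \<sigma>' "max C1 C2" x y] D C1(2) by (auto simp: le_max_iff_disj)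
    show "\<bar>\<sigma>' x - \<sigma>' y\<bar> \<le> max C1 C2 * \<bar>x - y\<bar>" for x y
      using field_differentiable_bound[of UNIV \<sigma>' "\<lambda>x. inverse I * b' x" "max C1 C2" x y] D' C2(2)
      by (auto simp: le_max_iff_disj)
    show "0 \<le> \<sigma> x" for x
      using F_mono[of 0 x] F_left[of x] I by (cases "x \<le> 0") (auto simp: \<sigma>_def)
    show "\<sigma> x \<le> 1" for x
      using F_mono[of x 1] F_right[of x] I by (cases "x \<le> 1") (auto simp: \<sigma>_def field_simps I_def)
    show "\<sigma> x = 0" if "x \<le> 0" for x
      using F_left[OF that] by (simp add: \<sigma>_def)
    show "\<sigma> x = 1" if "1 \<le> x" for x
      using F_right[OF that] I by (simp add: \<sigma>_def I_def)
    show "\<bar>\<sigma>' x\<bar> \<le> max C1 C2" for x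
      using C1(2)[of x] by simp
  qed (use D C1(1) b0 in \<open>auto simp: \<sigma>'_def\<close>)
qed

section \<open>Integral estimates in Euclidean space\<close>

text \<open>Cauchy-Schwarz up to the constant, from the pointwise bound |f| <= d + f^2 / d. The
  choice d = sqrt(I), with I the integral of f^2, yields the factor
  \<open>measure M (space M) + 1\<close>; if I = 0, d tends to 0 instead.\<close>

lemma integral_abs_le_sqrt_integral_square:
  fixes f :: "'a \<Rightarrow> real"
  assumes "finite_measure M" "f \<in> borel_measurable M" "integrable M (\<lambda>x. (f x)\<^sup>2)"
  shows "integrable M f"
    and "(\<integral>x. \<bar>f x\<bar> \<partial>M) \<le> (measure M (space M) + 1) * sqrt (\<integral>x. (f x)\<^sup>2 \<partial>M)"
proof -
  interpret finite_measure M by fact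
  have pt: "\<bar>f x\<bar> \<le> d + (f x)\<^sup>2 / d" if "0 < d" for d x
  proof (cases "\<bar>f x\<bar> \<le> d")
    case False
    then have "d * \<bar>f x\<bar> \<le> \<bar>f x\<bar> * \<bar>f x\<bar>" by (intro mult_right_mono) auto
    then have "\<bar>f x\<bar> \<le> (f x)\<^sup>2 / d"
      using that by (simp add: field_simps power2_eq_square)
    then show ?thesis using that by simp
  qed (use that in \<open>simp add: add_increasing2\<close>)
  show int: "integrable M f"
    by (rule Bochner_Integration.integrable_bound[of M "\<lambda>x. 1 + (f x)\<^sup>2 / 1"])
       (use assms pt[of 1] in \<open>auto intro: order_trans[OF _ abs_ge_self]\<close>)
  define I where "I = (\<integral>x. (f x)\<^sup>2 \<partial>M)"
  define m where "m = measure M (space M)"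
  have I: "0 \<le> I" and m: "0 \<le> m" by (simp_all add: I_def m_def)
  have bd: "(\<integral>x. \<bar>f x\<bar> \<partial>M) \<le> d * m + I / d" if "0 < d" for d
  proof -
    have "(\<integral>x. \<bar>f x\<bar> \<partial>M) \<le> (\<integral>x. d + (f x)\<^sup>2 / d \<partial>M)"
      using int assms pt[OF that] by (intro integral_mono) auto
    also have "\<dots> = d * m + I / d"
      using assms by (simp add: I_def m_def)
    finally show ?thesis .
  qed
  show "(\<integral>x. \<bar>f x\<bar> \<partial>M) \<le> (m + 1) * sqrt I"
  proof (cases "I = 0")
    case True
    have "(\<integral>x. \<bar>f x\<bar> \<partial>M) \<le> 0 + e" if "0 < e" for e
    proof -
      have "e / (m + 1) * m \<le> e" using that m by (simp add: field_simps)
      then show ?thesis using bd[of "e / (m + 1)"] that m True by simp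
    qed
    then have "(\<integral>x. \<bar>f x\<bar> \<partial>M) \<le> 0" by (rule field_le_epsilon)
    then show ?thesis using True by simp
  next
    case False
    then have "0 < sqrt I" using I by simp
    then show ?thesis using bd[of "sqrt I"] I by (simp add: real_div_sqrt algebra_simps)
  qed
qed

lemma integral_abs_tendsto_0:
  fixes f :: "'i \<Rightarrow> 'a \<Rightarrow> real"
  assumes "finite_measure M" "\<And>i. f i \<in> borel_measurable M" "\<And>i. integrable M (\<lambda>x. (f i x)\<^sup>2)"
    and "((\<lambda>i. \<integral>x. (f i x)\<^sup>2 \<partial>M) \<longlongrightarrow> 0) F"
  shows "((\<lambda>i. \<integral>x. \<bar>f i x\<bar> \<partial>M) \<longlongrightarrow> 0) F"
proof (rule tendsto_sandwich[OF _ _ tendsto_const])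
  have "((\<lambda>i. (measure M (space M) + 1) * sqrt (\<integral>x. (f i x)\<^sup>2 \<partial>M)) \<longlongrightarrow> (measure M (space M) + 1) * sqrt 0) F"
    by (intro tendsto_intros assms)
  then show "((\<lambda>i. (measure M (space M) + 1) * sqrt (\<integral>x. (f i x)\<^sup>2 \<partial>M)) \<longlongrightarrow> 0) F" by simp
  show "\<forall>\<^sub>F i in F. (\<integral>x. \<bar>f i x\<bar> \<partial>M) \<le> (measure M (space M) + 1) * sqrt (\<integral>x. (f i x)\<^sup>2 \<partial>M)"
    using integral_abs_le_sqrt_integral_square(2)[OF assms(1-3)] by simp
qed simp

section \<open>A Poincare inequality on convex sets\<close>

text \<open>Scaling by c multiplies the integral by c^(-n), at most 2^n. It is applied with c = 1 -
  s and s at most 1/2.\<close>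

lemma nn_integral_lborel_affine_le:
  fixes \<phi> :: "'a::euclidean_space \<Rightarrow> ennreal"
  assumes [measurable]: "\<phi> \<in> borel_measurable borel" and c: "1 / 2 \<le> c"
  shows "(\<integral>\<^sup>+x. \<phi> (t + c *\<^sub>R x) \<partial>lborel) \<le> 2 ^ DIM('a) * (\<integral>\<^sup>+x. \<phi> x \<partial>lborel)"
proof -
  have "1 \<le> (2 * c) ^ DIM('a)" using c by (intro one_le_power) simp
  then have one: "(1::ennreal) \<le> 2 ^ DIM('a) * ennreal (\<bar>c\<bar> ^ DIM('a))"
  proof -
    have "(2::ennreal) ^ DIM('a) = ennreal (2 ^ DIM('a))"
      using ennreal_power[of 2 "DIM('a)"] by simp
    then have "2 ^ DIM('a) * ennreal (\<bar>c\<bar> ^ DIM('a)) = ennreal ((2 * c) ^ DIM('a))"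
      using c by (simp add: ennreal_mult'[symmetric] power_mult_distrib)
    then show ?thesis using ennreal_leI[OF \<open>1 \<le> (2 * c) ^ DIM('a)\<close>] by simp
  qed
  have "(\<integral>\<^sup>+x. \<phi> x \<partial>lborel) = ennreal (\<bar>c\<bar> ^ DIM('a)) * (\<integral>\<^sup>+x. \<phi> (t + c *\<^sub>R x) \<partial>lborel)"
    using c arg_cong[OF lborel_affine[of c t], of "\<lambda>M. integral\<^sup>N M \<phi>"]
    by (simp add: nn_integral_density nn_integral_distr nn_integral_cmult)
  then have "2 ^ DIM('a) * (\<integral>\<^sup>+x. \<phi> x \<partial>lborel)
     = (2 ^ DIM('a) * ennreal (\<bar>c\<bar> ^ DIM('a))) * (\<integral>\<^sup>+x. \<phi> (t + c *\<^sub>R x) \<partial>lborel)"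
    by (simp add: mult.assoc)
  also have "\<dots> \<ge> 1 * (\<integral>\<^sup>+x. \<phi> (t + c *\<^sub>R x) \<partial>lborel)"
    by (intro mult_right_mono one) simp
  finally show ?thesis by simp
qed

text \<open>The fundamental theorem of calculus on the half of the segment next to x. The bound is
  stated as an integral with values in \<open>ennreal\<close>, ready for Tonelli.\<close>

lemma abs_diff_midpoint_le:
  fixes f :: "'a::euclidean_space \<Rightarrow> real"
  assumes K: "convex K" and xy: "x \<in> K" "y \<in> K"
    and der: "\<And>z. z \<in> K \<Longrightarrow> (f has_derivative f' z) (at z)"
    and cont: "\<And>v. continuous_on K (\<lambda>z. f' z v)"
    and bd: "\<And>z v. z \<in> K \<Longrightarrow> \<bar>f' z v\<bar> \<le> \<psi> z * norm v"
    and [measurable]: "\<psi> \<in> borel_measurable borel" and \<psi>: "\<And>z. 0 \<le> \<psi> z" and d: "norm (y - x) \<le> d"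
  shows "ennreal \<bar>f x - f ((1 / 2) *\<^sub>R (x + y))\<bar>
     \<le> ennreal d * (\<integral>\<^sup>+s\<in>{0..1/2}. ennreal (\<psi> (x + s *\<^sub>R (y - x))) \<partial>lborel)"
proof -
  define p where "p = (\<lambda>s. x + s *\<^sub>R (y - x))"
  have pK: "p s \<in> K" if "s \<in> {0..1/2}" for s
  proof -
    have "p s = (1 - s) *\<^sub>R x + s *\<^sub>R y" by (simp add: p_def algebra_simps)
    then show ?thesis using that convexD[OF K xy, of "1 - s" s] by auto
  qed
  have cont_p: "continuous_on {0..1/2} p" unfolding p_def by (intro continuous_intros)
  define q where "q = (\<lambda>s. f' (p s) (y - x))"
  have cont_q: "continuous_on {0..1/2} q"
    unfolding q_def by (rule continuous_on_compose2[OF cont cont_p]) (use pK in auto)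
  have "(q has_integral (f (p (1/2)) - f (p 0))) {0..1/2}"
  proof (rule fundamental_theorem_of_calculus)
    fix s :: real assume s: "s \<in> {0..1/2}"
    have "(p has_derivative (\<lambda>h. h *\<^sub>R (y - x))) (at s within {0..1/2})"
      unfolding p_def by (auto intro!: derivative_eq_intros)
    then have "((\<lambda>s. f (p s)) has_derivative (\<lambda>h. f' (p s) (h *\<^sub>R (y - x)))) (at s within {0..1/2})"
      using has_derivative_compose der[OF pK[OF s]] by blast
    moreover have "f' (p s) (h *\<^sub>R (y - x)) = h *\<^sub>R q s" for h
      unfolding q_def using has_derivative_linear[OF der[OF pK[OF s]]] by (simp add: linear_cmul)
    ultimately show "((\<lambda>s. f (p s)) has_vector_derivative q s) (at s within {0..1/2})"
      by (simp add: has_vector_derivative_def)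
  qed simp
  then have eq: "f (p (1/2)) - f (p 0) = integral {0..1/2} q" by (simp add: integral_unique)
  have qi: "(\<lambda>s. \<bar>q s\<bar>) integrable_on {0..1/2}"
    by (intro integrable_continuous_real continuous_intros cont_q)
  have "\<bar>f (p (1/2)) - f (p 0)\<bar> \<le> integral {0..1/2} (\<lambda>s. \<bar>q s\<bar>)"
    unfolding eq using integral_norm_bound_integral[OF integrable_continuous_real[OF cont_q] qi] by simp
  then have "ennreal \<bar>f (p (1/2)) - f (p 0)\<bar> \<le> ennreal (integral {0..1/2} (\<lambda>s. \<bar>q s\<bar>))"
    by (rule ennreal_leI)
  also have "\<dots> = (\<integral>\<^sup>+s. ennreal \<bar>q s\<bar> * indicator {0..1/2} s \<partial>lborel)"
    by (rule nn_integral_has_integral_lebesgue'[symmetric]) (use qi in \<open>auto intro: integrable_integral\<close>)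
  also have "\<dots> \<le> (\<integral>\<^sup>+s. ennreal d * (ennreal (\<psi> (p s)) * indicator {0..1/2} s) \<partial>lborel)"
  proof (intro nn_integral_mono)
    fix s :: real
    show "ennreal \<bar>q s\<bar> * indicator {0..1/2} s \<le> ennreal d * (ennreal (\<psi> (p s)) * indicator {0..1/2} s)"
    proof (cases "s \<in> {0..1/2}")
      case True
      have "\<bar>q s\<bar> \<le> \<psi> (p s) * norm (y - x)" unfolding q_def by (rule bd[OF pK[OF True]])
      also have "\<dots> \<le> d * \<psi> (p s)" using mult_left_mono[OF d \<psi>[of "p s"]] by (simp add: mult.commute)
      finally show ?thesis using True \<psi> order_trans[OF norm_ge_zero d]
        by (simp add: ennreal_mult[symmetric] ennreal_leI)
    qed simp
  qed
  also have "\<dots> = ennreal d * (\<integral>\<^sup>+s\<in>{0..1/2}. ennreal (\<psi> (p s)) \<partial>lborel)"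
    unfolding p_def by (rule nn_integral_cmult) measurable
  moreover have "p 0 = x" by (simp add: p_def)
  moreover have "p (1/2) = (1/2) *\<^sub>R (x + y)"
  proof -
    have "x = (1/2) *\<^sub>R x + (1/2) *\<^sub>R x" by (simp flip: scaleR_add_left)
    then have "p (1/2) = ((1/2) *\<^sub>R x + (1/2) *\<^sub>R x) + (1/2) *\<^sub>R (y - x)" unfolding p_def by simp
    then show ?thesis by (simp add: scaleR_diff_right scaleR_add_right)
  qed
  ultimately show ?thesis
    unfolding p_def[symmetric] by (simp add: abs_minus_commute p_def)
qed

text \<open>
  An $L^1$ Poincar\'e inequality in double-integral form. Splitting at the midpoint keeps the
  parameter of the segment in $[0,1/2]$, where $x \mapsto x + s(y - x)$ contracts by at most $1/2$.
\<close>

lemma poincare_double_integral: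
  fixes f :: "'a::euclidean_space \<Rightarrow> real"
  assumes K: "convex K" and [measurable]: "K \<in> sets borel"
    and der: "\<And>z. z \<in> K \<Longrightarrow> (f has_derivative f' z) (at z)"
    and cont: "\<And>v. continuous_on K (\<lambda>z. f' z v)"
    and bd: "\<And>z v. z \<in> K \<Longrightarrow> \<bar>f' z v\<bar> \<le> \<psi> z * norm v"
    and [measurable]: "\<psi> \<in> borel_measurable borel" "f \<in> borel_measurable borel"
    and \<psi>: "\<And>z. 0 \<le> \<psi> z"
    and d: "\<And>x y. x \<in> K \<Longrightarrow> y \<in> K \<Longrightarrow> norm (y - x) \<le> d"
  shows "(\<integral>\<^sup>+x. \<integral>\<^sup>+y. ennreal \<bar>f x - f y\<bar> * indicator K x * indicator K y \<partial>lborel \<partial>lborel)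
    \<le> ennreal d * 2 ^ DIM('a) * emeasure lborel K * (\<integral>\<^sup>+x\<in>K. ennreal (\<psi> x) \<partial>lborel)"
proof -
  \<comment> \<open>Extending \<psi> by zero allows affine substitutions over the whole space, with
    no need to follow the image of \<open>K\<close>.\<close>
  define \<phi> where "\<phi> = (\<lambda>x. ennreal (\<psi> x) * indicator K x)"
  have [measurable]: "\<phi> \<in> borel_measurable borel" unfolding \<phi>_def by measurable
  define h where "h = (\<lambda>x y. (ennreal d * (\<integral>\<^sup>+s. indicator {0..1/2} s * \<phi> (x + s *\<^sub>R (y - x)) \<partial>lborel)) *
      indicator K x * indicator K y)"
  have hm: "(\<lambda>(x, y). h x y) \<in> borel_measurable (lborel \<Otimes>\<^sub>M lborel)"
    unfolding h_def by measurable
  have mid: "ennreal \<bar>f x - f ((1 / 2) *\<^sub>R (x + y))\<bar> \<le> h x y" if xy: "x \<in> K" "y \<in> K" for x y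
  proof -
    have pK: "x + s *\<^sub>R (y - x) \<in> K" if "s \<in> {0..1/2}" for s :: real
    proof -
      have "x + s *\<^sub>R (y - x) = (1 - s) *\<^sub>R x + s *\<^sub>R y" by (simp add: algebra_simps)
      then show ?thesis using that convexD[OF K xy, of "1 - s" s] by auto
    qed
    have "(\<integral>\<^sup>+s\<in>{0..1/2}. ennreal (\<psi> (x + s *\<^sub>R (y - x))) \<partial>lborel)
       = (\<integral>\<^sup>+s. indicator {0..1/2} s * \<phi> (x + s *\<^sub>R (y - x)) \<partial>lborel)"
      using pK by (intro nn_integral_cong) (auto simp: \<phi>_def indicator_def)
    then show ?thesis
      using abs_diff_midpoint_le[OF K xy der cont bd _ \<psi> d[OF xy]] xy by (simp add: h_def)
  qed
  \<comment> \<open>The midpoint is reached from x along one half of the segment and from y along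
    the other, so both terms have the same form with x and y exchanged.\<close>
  have split: "ennreal \<bar>f x - f y\<bar> * indicator K x * indicator K y \<le> h x y + h y x" for x y
  proof (cases "x \<in> K \<and> y \<in> K")
    case True
    define m where "m = (1 / 2) *\<^sub>R (x + y)"
    have "ennreal \<bar>f x - f y\<bar> \<le> ennreal (\<bar>f x - f m\<bar> + \<bar>f y - f m\<bar>)"
      by (intro ennreal_leI) linarith
    also have "\<dots> = ennreal \<bar>f x - f m\<bar> + ennreal \<bar>f y - f m\<bar>" by simp
    also have "\<dots> \<le> h x y + h y x"
      using mid[of x y] mid[of y x] True unfolding m_def by (intro add_mono) (auto simp: add.commute)
    finally show ?thesis using True by simp
  qed (auto simp: indicator_def)
  \<comment> \<open>Here y is fixed and x is integrated: by Tonelli the parameter s comes outside,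
    and for each s the map x -> s y + (1 - s) x contracts by at most 1/2.\<close>
  have slice: "(\<integral>\<^sup>+x. h x y \<partial>lborel) \<le> ennreal d * (2 ^ DIM('a) * ((\<integral>\<^sup>+x. \<phi> x \<partial>lborel) * ennreal (1/2))) * indicator K y" for y
  proof -
    have "(\<integral>\<^sup>+x. h x y \<partial>lborel) \<le> (\<integral>\<^sup>+x. ennreal d * (\<integral>\<^sup>+s. indicator {0..1/2} s * \<phi> (x + s *\<^sub>R (y - x)) \<partial>lborel) * indicator K y \<partial>lborel)"
      unfolding h_def by (intro nn_integral_mono) (auto simp: indicator_def)
    also have "\<dots> = ennreal d * (\<integral>\<^sup>+x. \<integral>\<^sup>+s. indicator {0..1/2} s * \<phi> (x + s *\<^sub>R (y - x)) \<partial>lborel \<partial>lborel) * indicator K y"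
      by (simp add: nn_integral_cmult nn_integral_multc)
    also have "(\<integral>\<^sup>+x. \<integral>\<^sup>+s. indicator {0..1/2} s * \<phi> (x + s *\<^sub>R (y - x)) \<partial>lborel \<partial>lborel)
       = (\<integral>\<^sup>+s. \<integral>\<^sup>+x. indicator {0..1/2} s * \<phi> (x + s *\<^sub>R (y - x)) \<partial>lborel \<partial>lborel)"
      by (rule lborel_pair.Fubini'[symmetric]) measurable
    also have "\<dots> \<le> (\<integral>\<^sup>+s. (2 ^ DIM('a) * (\<integral>\<^sup>+x. \<phi> x \<partial>lborel)) * indicator {0..1/2::real} s \<partial>lborel)"
    proof (intro nn_integral_mono)
      fix s :: real
      show "(\<integral>\<^sup>+x. indicator {0..1/2} s * \<phi> (x + s *\<^sub>R (y - x)) \<partial>lborel)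
         \<le> (2 ^ DIM('a) * (\<integral>\<^sup>+x. \<phi> x \<partial>lborel)) * indicator {0..1/2} s"
      proof (cases "s \<in> {0..1/2}")
        case True
        have "x + s *\<^sub>R (y - x) = s *\<^sub>R y + (1 - s) *\<^sub>R x" for x by (simp add: algebra_simps)
        then show ?thesis using True nn_integral_lborel_affine_le[of \<phi> "1 - s" "s *\<^sub>R y"] by simp
      qed simp
    qed
    also have "\<dots> = 2 ^ DIM('a) * ((\<integral>\<^sup>+x. \<phi> x \<partial>lborel) * ennreal (1/2))"
      by (subst nn_integral_cmult_indicator) (simp_all add: mult.assoc)
    finally show ?thesis by (simp add: mult_left_mono mult_right_mono)
  qed
  have H: "(\<integral>\<^sup>+y. \<integral>\<^sup>+x. h x y \<partial>lborel \<partial>lborel) \<le> ennreal d * (2 ^ DIM('a) * ((\<integral>\<^sup>+x. \<phi> x \<partial>lborel) * ennreal (1/2))) * emeasure lborel K"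
  proof -
    have "(\<integral>\<^sup>+y. \<integral>\<^sup>+x. h x y \<partial>lborel \<partial>lborel)
      \<le> (\<integral>\<^sup>+y. ennreal d * (2 ^ DIM('a) * ((\<integral>\<^sup>+x. \<phi> x \<partial>lborel) * ennreal (1/2))) * indicator K y \<partial>lborel)"
      by (intro nn_integral_mono slice)
    also have "\<dots> = ennreal d * (2 ^ DIM('a) * ((\<integral>\<^sup>+x. \<phi> x \<partial>lborel) * ennreal (1/2))) * emeasure lborel K"
      by (rule nn_integral_cmult_indicator) simp
    finally show ?thesis .
  qed
  have hm2: "(\<lambda>(x, y). h y x) \<in> borel_measurable (lborel \<Otimes>\<^sub>M lborel)"
    using measurable_pair_swap[OF hm] by simp
  have m1: "(\<lambda>y. h x y) \<in> borel_measurable lborel" "(\<lambda>y. h y x) \<in> borel_measurable lborel" for x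
    using measurable_Pair1[OF hm, of x] measurable_Pair2[OF hm, of x] by simp_all
  have m2: "(\<lambda>x. \<integral>\<^sup>+y. h x y \<partial>lborel) \<in> borel_measurable lborel"
    "(\<lambda>x. \<integral>\<^sup>+y. h y x \<partial>lborel) \<in> borel_measurable lborel"
    by (rule lborel.borel_measurable_nn_integral[OF hm], rule lborel.borel_measurable_nn_integral[OF hm2])
  have "(\<integral>\<^sup>+x. \<integral>\<^sup>+y. ennreal \<bar>f x - f y\<bar> * indicator K x * indicator K y \<partial>lborel \<partial>lborel)
     \<le> (\<integral>\<^sup>+x. \<integral>\<^sup>+y. h x y + h y x \<partial>lborel \<partial>lborel)"
    by (intro nn_integral_mono split)
  also have "\<dots> = (\<integral>\<^sup>+x. \<integral>\<^sup>+y. h x y \<partial>lborel \<partial>lborel) + (\<integral>\<^sup>+x. \<integral>\<^sup>+y. h y x \<partial>lborel \<partial>lborel)"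
    by (simp only: nn_integral_add[OF m1] nn_integral_add[OF m2])
  also have "(\<integral>\<^sup>+x. \<integral>\<^sup>+y. h x y \<partial>lborel \<partial>lborel) = (\<integral>\<^sup>+y. \<integral>\<^sup>+x. h x y \<partial>lborel \<partial>lborel)"
    by (rule lborel_pair.Fubini'[symmetric, OF hm])
  also have "\<dots> + (\<integral>\<^sup>+y. \<integral>\<^sup>+x. h x y \<partial>lborel \<partial>lborel)
     \<le> 2 * (ennreal d * (2 ^ DIM('a) * ((\<integral>\<^sup>+x. \<phi> x \<partial>lborel) * ennreal (1/2))) * emeasure lborel K)"
    using add_mono[OF H H] by (simp add: mult_2)
  also have "\<dots> = ennreal d * 2 ^ DIM('a) * emeasure lborel K * (\<integral>\<^sup>+x. \<phi> x \<partial>lborel) * (2 * ennreal (1/2))"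
    by (simp only: mult_ac)
  \<comment> \<open>The two halves of the segment contribute a factor 2, which cancels the length
    1/2 of the parameter interval.\<close>
  also have "2 * ennreal (1/2) = 1"
    using ennreal_mult[of 2 "1/2"] by simp
  finally show ?thesis unfolding \<phi>_def by simp
qed

section \<open>Closability of directional derivatives\<close>

text \<open>The positive and the negative part of f are densities of two finite measures that agree
  on boxes. Boxes are stable under intersection and generate the Borel sets, so the measures
  coincide, hence so do their densities almost everywhere.\<close>

lemma AE_zero_if_box_integrals_zero:
  fixes f :: "'a::euclidean_space \<Rightarrow> real"
  assumes f: "integrable lborel f"
    and zero: "\<And>l u. (\<integral>x. indicator (box l u) x * f x \<partial>lborel) = 0"
  shows "AE x in lborel. f x = 0"
proof -
  have [measurable]: "f \<in> borel_measurable borel"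
    using borel_measurable_integrable[OF f] by simp
  define P where "P = density lborel (\<lambda>x. ennreal (f x))"
  define N where "N = density lborel (\<lambda>x. ennreal (- f x))"
  have fin: "(\<integral>\<^sup>+x. ennreal (f x) \<partial>lborel) < \<infinity>" "(\<integral>\<^sup>+x. ennreal (- f x) \<partial>lborel) < \<infinity>"
    using f by (auto simp: real_integrable_def less_top)
  have eq_box: "emeasure P (box l u) = emeasure N (box l u)" for l u
  proof -
    let ?g = "\<lambda>x. indicator (box l u) x * f x"
    have g: "integrable lborel ?g"
      using integrable_mult_indicator[OF _ f, of "box l u"] by simp
    have "enn2real (\<integral>\<^sup>+x. ennreal (?g x) \<partial>lborel) = enn2real (\<integral>\<^sup>+x. ennreal (- ?g x) \<partial>lborel)"
      using zero[of l u] real_lebesgue_integral_def[OF g] by simp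
    moreover have "(\<integral>\<^sup>+x. ennreal (?g x) \<partial>lborel) < top" "(\<integral>\<^sup>+x. ennreal (- ?g x) \<partial>lborel) < top"
      using g by (simp_all only: real_integrable_def infinity_ennreal_def less_top)
    ultimately have "(\<integral>\<^sup>+x. ennreal (?g x) \<partial>lborel) = (\<integral>\<^sup>+x. ennreal (- ?g x) \<partial>lborel)"
      using ennreal_enn2real by metis
    moreover have "emeasure P (box l u) = (\<integral>\<^sup>+x. ennreal (?g x) \<partial>lborel)"
      unfolding P_def by (subst emeasure_density) (auto intro!: nn_integral_cong simp: indicator_def)
    moreover have "emeasure N (box l u) = (\<integral>\<^sup>+x. ennreal (- ?g x) \<partial>lborel)"
      unfolding N_def by (subst emeasure_density) (auto intro!: nn_integral_cong simp: indicator_def)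
    ultimately show ?thesis by simp
  qed
  have "P = N"
  proof (rule measure_eqI_generator_eq)
    let ?E = "range (\<lambda>(a, b). box a b :: 'a set)"
    show "Int_stable ?E"
      by (auto simp: Int_stable_def box_Int_box)
    show "?E \<subseteq> Pow UNIV" "sets P = sigma_sets UNIV ?E" "sets N = sigma_sets UNIV ?E"
      by (simp_all add: borel_eq_box P_def N_def)
    let ?A = "\<lambda>n::nat. box (- (real n *\<^sub>R One)) (real n *\<^sub>R One) :: 'a set"
    show "range ?A \<subseteq> ?E" "(\<Union>i. ?A i) = UNIV"
      unfolding UN_box_eq_UNIV by auto
    show "emeasure P (?A i) \<noteq> \<infinity>" for i
    proof -
      have "emeasure P (?A i) \<le> (\<integral>\<^sup>+x. ennreal (f x) \<partial>lborel)"
        unfolding P_def by (subst emeasure_density) (auto intro!: nn_integral_mono simp: indicator_def)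
      then show ?thesis using fin(1) by (auto simp: top_unique)
    qed
    show "emeasure P X = emeasure N X" if "X \<in> ?E" for X
      using that eq_box by auto
  qed
  then have "AE x in lborel. ennreal (f x) = ennreal (- f x)"
    unfolding P_def N_def by (intro sigma_finite_measure.density_unique[OF sigma_finite_lborel]) auto
  moreover have "t = 0" if "ennreal t = ennreal (- t)" for t :: real
    using that by (cases "0 \<le> t") (auto simp: ennreal_neg ennreal_eq_0_iff)
  ultimately show ?thesis by auto
qed

text \<open>Difference quotients have integral 0 by translation invariance. The steps 1/(n+1) are at
  most 1, so all quotients live in one ball of radius R + |b|, and C bounds them there: dominated
  convergence applies.\<close>

lemma integral_directional_derivative_compact_support:
  fixes F :: "'a::euclidean_space \<Rightarrow> real"
  assumes der: "\<And>x. (F has_derivative F' x) (at x)"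
    and supp: "\<And>x. R \<le> norm x \<Longrightarrow> F x = 0"
    and bd: "\<And>x. \<bar>F' x b\<bar> \<le> C"
  shows "(\<integral>x. F' x b \<partial>lborel) = 0"
proof -
  have cont: "continuous_on UNIV F"
    using der by (auto simp: continuous_on_eq_continuous_at intro: has_derivative_continuous)
  have [measurable]: "F \<in> borel_measurable borel"
    by (rule borel_measurable_continuous_onI[OF cont])
  have C: "0 \<le> C" using bd[of 0] by linarith
  define q where "q = (\<lambda>n x. real (Suc n) * (F (x + (1 / real (Suc n)) *\<^sub>R b) - F x))"
  have D: "((\<lambda>t. F (x + t *\<^sub>R b)) has_real_derivative F' (x + t *\<^sub>R b) b) (at t)" for x t
  proof -
    have "((\<lambda>t. x + t *\<^sub>R b) has_derivative (\<lambda>h. h *\<^sub>R b)) (at t)"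
      by (auto intro!: derivative_eq_intros)
    then have "((\<lambda>t. F (x + t *\<^sub>R b)) has_derivative (\<lambda>h. F' (x + t *\<^sub>R b) (h *\<^sub>R b))) (at t)"
      using has_derivative_compose der by blast
    then show ?thesis
      using has_derivative_linear[OF der] by (simp add: has_field_derivative_def linear_cmul mult_commute_abs)
  qed
  have lip: "\<bar>F (x + t *\<^sub>R b) - F x\<bar> \<le> C * \<bar>t\<bar>" for x t
    using field_differentiable_bound[of UNIV "\<lambda>t. F (x + t *\<^sub>R b)" "\<lambda>t. F' (x + t *\<^sub>R b) b" C t 0] D bd
    by auto
  have q_lim: "(\<lambda>n. q n x) \<longlonglongrightarrow> F' x b" for x
  proof -
    have "((\<lambda>h. (F (x + (0 + h) *\<^sub>R b) - F (x + 0 *\<^sub>R b)) / h) \<longlongrightarrow> F' (x + 0 *\<^sub>R b) b) (at 0)"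
      using D[of x 0] by (simp add: DERIV_def)
    moreover have "filterlim (\<lambda>n. 1 / real (Suc n)) (at 0) sequentially"
      using LIMSEQ_inverse_real_of_nat by (auto simp: filterlim_at inverse_eq_divide)
    ultimately have "(\<lambda>n. (F (x + (0 + 1 / real (Suc n)) *\<^sub>R b) - F (x + 0 *\<^sub>R b)) / (1 / real (Suc n)))
       \<longlonglongrightarrow> F' (x + 0 *\<^sub>R b) b"
      by (rule filterlim_compose)
    then show ?thesis by (simp add: q_def mult.commute)
  qed
  have q_zero: "q n x = 0" if "R + norm b \<le> norm x" for n x
  proof -
    have "norm ((1 / real (Suc n)) *\<^sub>R b) \<le> norm b"
      by (simp add: divide_le_eq mult_le_cancel_left1)
    then have "R \<le> norm (x + (1 / real (Suc n)) *\<^sub>R b)"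
      using that norm_triangle_ineq2[of x "- ((1 / real (Suc n)) *\<^sub>R b)"] by simp
    moreover have "R \<le> norm x" using that norm_ge_zero[of b] by linarith
    ultimately show ?thesis by (simp add: q_def supp)
  qed
  have q_bd: "\<bar>q n x\<bar> \<le> C" for n x
  proof -
    have "\<bar>q n x\<bar> = real (Suc n) * \<bar>F (x + (1 / real (Suc n)) *\<^sub>R b) - F x\<bar>"
      unfolding q_def abs_mult by simp
    also have "\<dots> \<le> real (Suc n) * (C * \<bar>1 / real (Suc n)\<bar>)"
      by (intro mult_left_mono lip) simp
    also have "\<dots> = C" by simp
    finally show ?thesis .
  qed
  have Fint: "integrable lborel F"
  proof -
    have "integrable lborel (\<lambda>x. indicator (cball 0 R) x *\<^sub>R F x)"
      by (rule borel_integrable_compact) (auto intro: continuous_on_subset[OF cont])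
    moreover have "(\<lambda>x. indicator (cball 0 R) x *\<^sub>R F x) = F"
      using supp by (auto simp: fun_eq_iff indicator_def)
    ultimately show ?thesis by simp
  qed
  have shift: "(\<integral>x. F (x + c) \<partial>lborel) = (\<integral>x. F x \<partial>lborel)" "integrable lborel (\<lambda>x. F (x + c))" for c
  proof -
    have d: "distr lborel borel (\<lambda>x. x + c) = (lborel :: 'a measure)"
      using lborel_distr_plus[of c] by (simp only: add.commute[of _ c])
    show "(\<integral>x. F (x + c) \<partial>lborel) = (\<integral>x. F x \<partial>lborel)"
      by (subst d[symmetric]) (simp add: integral_distr)
    show "integrable lborel (\<lambda>x. F (x + c))"
      using Fint by (subst (asm) d[symmetric]) (simp add: integrable_distr_eq)
  qed
  have "(\<lambda>n. \<integral>x. q n x \<partial>lborel) \<longlonglongrightarrow> (\<integral>x. F' x b \<partial>lborel)"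
  proof (rule integral_dominated_convergence[where w = "\<lambda>x. C * indicator (cball 0 (R + norm b)) x"])
    show "(\<lambda>x. F' x b) \<in> borel_measurable lborel"
      by (rule borel_measurable_LIMSEQ_real[OF q_lim]) (auto simp: q_def)
    show "integrable lborel (\<lambda>x. C * indicator (cball 0 (R + norm b)) x)"
      by (intro integrable_mult_right integrable_real_indicator) (use emeasure_lborel_cball_finite in auto)
    show "AE x in lborel. norm (q n x) \<le> C * indicator (cball 0 (R + norm b)) x" for n
      using q_bd q_zero C by (intro AE_I2) (auto simp: indicator_def)
  qed (use q_lim in \<open>auto simp: q_def\<close>)
  moreover have "(\<integral>x. q n x \<partial>lborel) = 0" for n
    using Fint shift by (simp add: q_def)
  ultimately show ?thesis by (simp add: LIMSEQ_const_iff)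
qed

text \<open>Integration by parts moves the derivative from v_k to \<phi>. Since v_k tends to 0 and
  its derivative tends to \<xi> in L^1(K), the limit \<xi> is orthogonal to \<phi>. The
  identification of \<xi> as 0 comes later, by varying \<phi>.\<close>

lemma test_function_integral_zero:
  fixes v :: "nat \<Rightarrow> 'a::euclidean_space \<Rightarrow> real" and b :: 'a
  assumes U: "open U" "K \<subseteq> U" and K: "compact K"
    and v: "\<And>k. Ck_on (Suc 0) U (v k)"
    and \<xi>: "(\<lambda>x. indicator K x * \<xi> x) \<in> borel_measurable borel"
    and lim1: "(\<lambda>k. \<integral>\<^sup>+x\<in>K. ennreal \<bar>v k x\<bar> \<partial>lborel) \<longlonglongrightarrow> 0"
    and lim2: "(\<lambda>k. \<integral>\<^sup>+x\<in>K. ennreal \<bar>frechet_derivative (v k) (at x) b - \<xi> x\<bar> \<partial>lborel) \<longlonglongrightarrow> 0"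
    and \<phi>: "Ck_on (Suc 0) UNIV \<phi>" "\<And>x. x \<notin> K \<Longrightarrow> \<phi> x = 0" "\<And>x. \<bar>\<phi> x\<bar> \<le> 1"
  shows "integrable lborel (\<lambda>x. indicator K x * \<xi> x)"
    and "(\<integral>x. indicator K x * \<xi> x * \<phi> x \<partial>lborel) = 0"
proof -
  define D where "D = (\<lambda>k x. frechet_derivative (v k) (at x) b)"
  define \<phi>' where "\<phi>' = (\<lambda>x. frechet_derivative \<phi> (at x))"
  have Kb [measurable]: "K \<in> sets borel" using K by (simp add: compact_imp_closed)
  note [measurable] = \<xi>
  have cv: "continuous_on K (v k)" and cD: "continuous_on K (D k)" for k
    using v[of k] U(2) by (auto simp: D_def intro: continuous_on_subset differentiable_imp_continuous_on)
  have c\<phi>: "continuous_on UNIV \<phi>" and c\<phi>': "continuous_on UNIV (\<lambda>x. \<phi>' x b)"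
    using \<phi>(1) by (auto simp: \<phi>'_def intro: differentiable_imp_continuous_on)
  have [measurable]: "\<phi> \<in> borel_measurable borel" "(\<lambda>x. \<phi>' x b) \<in> borel_measurable borel"
    using c\<phi> c\<phi>' by (auto intro: borel_measurable_continuous_onI)
  have iv: "integrable lborel (\<lambda>x. indicator K x * v k x)" and iD: "integrable lborel (\<lambda>x. indicator K x * D k x)" for k
    using borel_integrable_compact[OF K cv] borel_integrable_compact[OF K cD] by simp_all
  note [measurable] = borel_measurable_integrable[OF iv, simplified] borel_measurable_integrable[OF iD, simplified]
  have [measurable]: "(\<lambda>x. indicator K x * (D k x - \<xi> x)) \<in> borel_measurable borel" for k
    by (simp only: right_diff_distrib) measurable
  \<comment> \<open>Some derivative lies at finite L^1 distance from \<xi> and is itself integrable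
    on the compact \<open>K\<close>, which makes \<xi> integrable.\<close>
  have "eventually (\<lambda>k. (\<integral>\<^sup>+x\<in>K. ennreal \<bar>D k x - \<xi> x\<bar> \<partial>lborel) < 1) sequentially"
    using lim2 unfolding D_def by (rule order_tendstoD(2)) simp
  then obtain k0 where k0: "(\<integral>\<^sup>+x\<in>K. ennreal \<bar>D k0 x - \<xi> x\<bar> \<partial>lborel) < 1"
    using eventually_happens by force
  have eqD: "(\<integral>\<^sup>+x\<in>K. ennreal \<bar>D k x - \<xi> x\<bar> \<partial>lborel) = (\<integral>\<^sup>+x. ennreal (norm (indicator K x * (D k x - \<xi> x))) \<partial>lborel)" for k
    by (intro nn_integral_cong) (auto simp: indicator_def)
  have eqv: "(\<integral>\<^sup>+x\<in>K. ennreal \<bar>v k x\<bar> \<partial>lborel) = (\<integral>\<^sup>+x. ennreal (norm (indicator K x * v k x)) \<partial>lborel)" for k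
    by (intro nn_integral_cong) (auto simp: indicator_def)
  have "integrable lborel (\<lambda>x. indicator K x * (D k0 x - \<xi> x))"
  proof (rule integrableI_bounded)
    show "(\<integral>\<^sup>+x. ennreal (norm (indicator K x * (D k0 x - \<xi> x))) \<partial>lborel) < \<infinity>"
      using order.strict_trans[OF k0 ennreal_one_less_top] unfolding eqD by simp
  qed simp
  from Bochner_Integration.integrable_diff[OF iD[of k0] this]
  show i\<xi>: "integrable lborel (\<lambda>x. indicator K x * \<xi> x)"
    by (simp add: algebra_simps)
  obtain C where C: "0 < C" "\<And>x. x \<in> K \<Longrightarrow> \<bar>\<phi>' x b\<bar> \<le> C"
    using compact_imp_bounded[OF compact_continuous_image[OF continuous_on_subset[OF c\<phi>'] K]]
    unfolding bounded_pos by auto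
  have d\<phi>: "(\<phi> has_derivative \<phi>' x) (at x)" for x
    unfolding \<phi>'_def by (rule Ck_on_has_derivative[OF \<phi>(1)]) auto
  \<comment> \<open>The complement of the compact \<open>K\<close> is open and \<phi> vanishes on
    it.\<close>
  have \<phi>'0: "\<phi>' x = (\<lambda>h. 0)" if "x \<notin> K" for x
  proof -
    have "((\<lambda>x. 0) has_derivative (\<lambda>h. 0)) (at x)" by simp
    then have "(\<phi> has_derivative (\<lambda>h. 0)) (at x)"
      by (rule has_derivative_transform_within_open[where s = "- K"])
         (use K that \<phi>(2) in \<open>auto simp: compact_imp_closed open_Compl\<close>)
    then show ?thesis using d\<phi> has_derivative_unique by blast
  qed
  have by_parts: "(\<integral>x. indicator K x * D k x * \<phi> x \<partial>lborel) = - (\<integral>x. indicator K x * v k x * \<phi>' x b \<partial>lborel)"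
    and i1: "integrable lborel (\<lambda>x. indicator K x * D k x * \<phi> x)"
    and i2: "integrable lborel (\<lambda>x. indicator K x * v k x * \<phi>' x b)" for k
  proof -
    \<comment> \<open>Nothing is known of \<open>v k\<close> outside \<open>U\<close>, but its
      product with \<phi> is identically 0 off \<open>K\<close>, so the product is differentiable
      everywhere.\<close>
    define F' where "F' = (\<lambda>x h. if x \<in> K then v k x * \<phi>' x h + frechet_derivative (v k) (at x) h * \<phi> x else 0)"
    have derF: "((\<lambda>x. v k x * \<phi> x) has_derivative F' x) (at x)" for x
    proof (cases "x \<in> K")
      case True
      then show ?thesis
        using has_derivative_mult[OF Ck_on_has_derivative[OF v U(1)] d\<phi>, of x k] U(2) by (auto simp: F'_def)
    next
      case False
      have "((\<lambda>x. 0) has_derivative (\<lambda>h. 0)) (at x)" by simp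
      then have "((\<lambda>x. v k x * \<phi> x) has_derivative (\<lambda>h. 0)) (at x)"
        by (rule has_derivative_transform_within_open[where s = "- K"])
           (use K False \<phi>(2) in \<open>auto simp: compact_imp_closed open_Compl\<close>)
      then show ?thesis using False by (simp add: F'_def)
    qed
    have "continuous_on K (\<lambda>x. v k x * \<phi>' x b + D k x * \<phi> x)"
      by (intro continuous_intros cv cD continuous_on_subset[OF c\<phi>] continuous_on_subset[OF c\<phi>']) auto
    from compact_imp_bounded[OF compact_continuous_image[OF this K]]
    obtain B where B: "0 < B" "\<And>x. x \<in> K \<Longrightarrow> \<bar>v k x * \<phi>' x b + D k x * \<phi> x\<bar> \<le> B"
      unfolding bounded_pos by auto
    obtain R where R: "\<And>x. x \<in> K \<Longrightarrow> norm x < R"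
      using compact_imp_bounded[OF K] bounded_pos_less by blast
    have "(\<integral>x. F' x b \<partial>lborel) = 0"
    proof (rule integral_directional_derivative_compact_support[OF derF])
      show "v k x * \<phi> x = 0" if "R \<le> norm x" for x
        using R[of x] that \<phi>(2)[of x] by force
      show "\<bar>F' x b\<bar> \<le> B" for x
        using B by (auto simp: F'_def D_def)
    qed
    moreover have "F' x b = indicator K x * v k x * \<phi>' x b + indicator K x * D k x * \<phi> x" for x
      by (auto simp: F'_def D_def)
    moreover show i1: "integrable lborel (\<lambda>x. indicator K x * D k x * \<phi> x)"
      using borel_integrable_compact[OF K continuous_on_mult[OF cD continuous_on_subset[OF c\<phi>]]] by (simp add: mult.assoc)
    moreover show i2: "integrable lborel (\<lambda>x. indicator K x * v k x * \<phi>' x b)"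
      using borel_integrable_compact[OF K continuous_on_mult[OF cv continuous_on_subset[OF c\<phi>']]] by (simp add: mult.assoc)
    ultimately show "(\<integral>x. indicator K x * D k x * \<phi> x \<partial>lborel) = - (\<integral>x. indicator K x * v k x * \<phi>' x b \<partial>lborel)"
      by simp
  qed
  have i3: "integrable lborel (\<lambda>x. indicator K x * \<xi> x * \<phi> x)"
    by (rule Bochner_Integration.integrable_bound[OF i\<xi>])
       (use \<phi>(3) in \<open>auto simp: abs_mult mult_left_le\<close>)
  have bound: "ennreal \<bar>\<integral>x. indicator K x * \<xi> x * \<phi> x \<partial>lborel\<bar>
     \<le> (\<integral>\<^sup>+x\<in>K. ennreal \<bar>D k x - \<xi> x\<bar> \<partial>lborel) + ennreal C * (\<integral>\<^sup>+x\<in>K. ennreal \<bar>v k x\<bar> \<partial>lborel)" for k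
  proof -
    \<comment> \<open>The two subtracted terms add up to the derivative of v_k \<phi>, whose
      integral is 0. What remains is small: \<xi> minus the derivative of v_k, times \<phi>, and v_k
      times the derivative of \<phi>.\<close>
    let ?h = "\<lambda>x. indicator K x * \<xi> x * \<phi> x - indicator K x * D k x * \<phi> x - indicator K x * v k x * \<phi>' x b"
    have "(\<integral>x. indicator K x * \<xi> x * \<phi> x \<partial>lborel) = (\<integral>x. ?h x \<partial>lborel)"
      using i1[of k] i2[of k] i3 by_parts[of k] by simp
    then have "ennreal \<bar>\<integral>x. indicator K x * \<xi> x * \<phi> x \<partial>lborel\<bar> = ennreal (norm (\<integral>x. ?h x \<partial>lborel))" by simp
    also have "\<dots> \<le> (\<integral>\<^sup>+x. ennreal (norm (?h x)) \<partial>lborel)"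
      by (intro integral_norm_bound_ennreal Bochner_Integration.integrable_diff i1 i2 i3)
    also have "\<dots> \<le> (\<integral>\<^sup>+x. ennreal (norm (indicator K x * (D k x - \<xi> x))) + ennreal C * ennreal (norm (indicator K x * v k x)) \<partial>lborel)"
    proof (intro nn_integral_mono)
      fix x
      have "norm (?h x) \<le> norm (indicator K x * (D k x - \<xi> x)) + C * norm (indicator K x * v k x)"
      proof (cases "x \<in> K")
        case True
        have "norm (?h x) = \<bar>(\<xi> x - D k x) * \<phi> x - v k x * \<phi>' x b\<bar>"
          using True by (simp add: algebra_simps)
        also have "\<dots> \<le> \<bar>\<xi> x - D k x\<bar> * \<bar>\<phi> x\<bar> + \<bar>v k x\<bar> * \<bar>\<phi>' x b\<bar>"
          by (metis abs_mult abs_triangle_ineq4)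
        also have "\<dots> \<le> \<bar>\<xi> x - D k x\<bar> * 1 + \<bar>v k x\<bar> * C"
          by (intro add_mono mult_left_mono \<phi>(3) C(2) True) auto
        finally show ?thesis using True by (simp add: mult.commute abs_minus_commute)
      qed simp
      then show "ennreal (norm (?h x)) \<le> ennreal (norm (indicator K x * (D k x - \<xi> x))) + ennreal C * ennreal (norm (indicator K x * v k x))"
        using C(1) by (simp add: ennreal_mult'[symmetric] ennreal_plus[symmetric] ennreal_leI del: ennreal_plus)
    qed
    also have "\<dots> = (\<integral>\<^sup>+x. ennreal (norm (indicator K x * (D k x - \<xi> x))) \<partial>lborel) + ennreal C * (\<integral>\<^sup>+x. ennreal (norm (indicator K x * v k x)) \<partial>lborel)"
      by (subst nn_integral_add) (auto simp: nn_integral_cmult)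
    finally show ?thesis by (simp only: eqD eqv)
  qed
  have "(\<lambda>k. (\<integral>\<^sup>+x\<in>K. ennreal \<bar>D k x - \<xi> x\<bar> \<partial>lborel) + ennreal C * (\<integral>\<^sup>+x\<in>K. ennreal \<bar>v k x\<bar> \<partial>lborel)) \<longlonglongrightarrow> 0 + ennreal C * 0"
    using lim1 lim2 unfolding D_def by (intro tendsto_add ennreal_tendsto_cmult) auto
  then have "ennreal \<bar>\<integral>x. indicator K x * \<xi> x * \<phi> x \<partial>lborel\<bar> \<le> 0 + ennreal C * 0"
    by (rule tendsto_lowerbound) (use bound in auto)
  then show "(\<integral>x. indicator K x * \<xi> x * \<phi> x \<partial>lborel) = 0"
    by (simp add: ennreal_eq_0_iff)
qed

text \<open>Smooth cutoffs converge pointwise to the indicator of any box inside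
  \<open>box L H\<close>. By dominated convergence the orthogonality to test functions turns into
  vanishing integrals over all such boxes, which forces \<xi> = 0.\<close>

lemma directional_derivative_closable:
  fixes v :: "nat \<Rightarrow> 'a::euclidean_space \<Rightarrow> real" and b :: 'a
  assumes U: "open U" "cbox L H \<subseteq> U"
    and v: "\<And>k. Ck_on (Suc 0) U (v k)"
    and \<xi>: "(\<lambda>x. indicator (cbox L H) x * \<xi> x) \<in> borel_measurable borel"
    and lim1: "(\<lambda>k. \<integral>\<^sup>+x\<in>cbox L H. ennreal \<bar>v k x\<bar> \<partial>lborel) \<longlonglongrightarrow> 0"
    and lim2: "(\<lambda>k. \<integral>\<^sup>+x\<in>cbox L H. ennreal \<bar>frechet_derivative (v k) (at x) b - \<xi> x\<bar> \<partial>lborel) \<longlonglongrightarrow> 0"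
  shows "AE x in lborel. x \<in> box L H \<longrightarrow> \<xi> x = 0"
proof -
  let ?K = "cbox L H"
  note test = test_function_integral_zero[OF U compact_cbox v \<xi> lim1 lim2]
  obtain \<sigma> \<sigma>' :: "real \<Rightarrow> real" and C where \<sigma>: "smooth_on UNIV \<sigma>"
    "\<And>x. x \<le> 0 \<Longrightarrow> \<sigma> x = 0" "\<And>x. 1 \<le> x \<Longrightarrow> \<sigma> x = 1" "\<And>x. 0 \<le> \<sigma> x" "\<And>x. \<sigma> x \<le> 1"
    by (rule smooth_step) blast
  \<comment> \<open>Each factor vanishes on the outer side of one face of the box and equals 1 at
    distance at least 1/m inside of it.\<close>
  define \<phi> :: "'a \<Rightarrow> 'a \<Rightarrow> nat \<Rightarrow> 'a \<Rightarrow> real"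
    where "\<phi> = (\<lambda>l u m x. \<Prod>j\<in>Basis. \<sigma> (real m * (x \<bullet> j - l \<bullet> j)) * \<sigma> (real m * (u \<bullet> j - x \<bullet> j)))"
  have Ck\<phi>: "Ck_on k UNIV (\<phi> l u m)" for l u m k
    unfolding \<phi>_def
  proof (intro Ck_on_prod Ck_on_mult)
    have s: "Ck_on k UNIV \<sigma>" using \<sigma>(1) by (simp add: smooth_on_def)
    have "Ck_on k UNIV (\<lambda>x. real m * (x \<bullet> j - l \<bullet> j))" "Ck_on k UNIV (\<lambda>x. real m * (u \<bullet> j - x \<bullet> j))" for j l u :: 'a and m
      by (intro Ck_on_mult Ck_on_diff Ck_on_const Ck_on_bounded_linear_self bounded_linear_inner_left; simp)+
    then show "Ck_on k UNIV (\<lambda>x. \<sigma> (real m * (x \<bullet> j - l \<bullet> j)))" "Ck_on k UNIV (\<lambda>x. \<sigma> (real m * (u \<bullet> j - x \<bullet> j)))" for j l u :: 'a and m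
      by (auto intro!: Ck_on_compose[OF open_UNIV open_UNIV subset_UNIV _ s])
  qed auto
  have \<phi>01: "0 \<le> \<phi> l u m x" "\<phi> l u m x \<le> 1" for l u m x
    unfolding \<phi>_def using \<sigma>(4,5) by (auto intro!: prod_nonneg prod_le_1 mult_nonneg_nonneg mult_le_one)
  have \<phi>0: "\<phi> l u m x = 0" if "x \<notin> box l u" for l u m x
  proof -
    obtain j where j: "j \<in> Basis" "x \<bullet> j \<le> l \<bullet> j \<or> u \<bullet> j \<le> x \<bullet> j"
      using \<open>x \<notin> box l u\<close> by (auto simp: mem_box not_less)
    then have "\<sigma> (real m * (x \<bullet> j - l \<bullet> j)) * \<sigma> (real m * (u \<bullet> j - x \<bullet> j)) = 0"
      using \<sigma>(2) by (auto simp: mult_nonneg_nonpos)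
    then show ?thesis using j(1) unfolding \<phi>_def by (auto intro!: prod_zero)
  qed
  have \<phi>1: "(\<lambda>m. \<phi> l u m x) \<longlonglongrightarrow> indicator (box l u) x" for l u x
  proof (cases "x \<in> box l u")
    case True
    have "eventually (\<lambda>m. \<forall>j\<in>Basis. 1 \<le> real m * (x \<bullet> j - l \<bullet> j) \<and> 1 \<le> real m * (u \<bullet> j - x \<bullet> j)) sequentially"
    proof (intro eventually_ball_finite ballI eventually_conj)
      have ev: "eventually (\<lambda>m. 1 \<le> real m * d) sequentially" if "0 < d" for d :: real
      proof -
        obtain N :: nat where "1 < of_nat N * d" using ex_less_of_nat_mult[OF \<open>0 < d\<close>] by blast
        then show ?thesis using that
          by (intro eventually_sequentiallyI[of N]) (smt (verit) mult_right_mono of_nat_le_iff)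
      qed
      show "eventually (\<lambda>m. 1 \<le> real m * (x \<bullet> j - l \<bullet> j)) sequentially"
        "eventually (\<lambda>m. 1 \<le> real m * (u \<bullet> j - x \<bullet> j)) sequentially" if "j \<in> Basis" for j
        using True that by (intro ev; auto simp: mem_box)+
    qed simp
    then have "eventually (\<lambda>m. \<phi> l u m x = 1) sequentially"
      by eventually_elim (simp add: \<phi>_def \<sigma>(3))
    then show ?thesis using True by (auto intro: tendsto_eventually)
  qed (use \<phi>0 in simp)
  have i\<xi>: "integrable lborel (\<lambda>x. indicator ?K x * \<xi> x)"
    by (rule test(1)[of "\<lambda>x. 0"]) (auto)
  have sub: "box l u \<subseteq> ?K" if "box l u \<subseteq> box L H" for l u
    using that box_subset_cbox by blast
  have zero: "(\<integral>x. indicator (box l u) x * (indicator ?K x * \<xi> x) \<partial>lborel) = 0" if "box l u \<subseteq> box L H" for l u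
  proof -
    note [measurable] = borel_measurable_integrable[OF i\<xi>, simplified]
    have [measurable]: "\<phi> l u m \<in> borel_measurable borel" for m
      using Ck_on_imp_continuous_on[OF Ck\<phi>] by (rule borel_measurable_continuous_onI)
    have "(\<lambda>m. \<integral>x. indicator ?K x * \<xi> x * \<phi> l u m x \<partial>lborel) \<longlonglongrightarrow>
      (\<integral>x. indicator ?K x * \<xi> x * indicator (box l u) x \<partial>lborel)"
    proof (rule integral_dominated_convergence[where w = "\<lambda>x. \<bar>indicator ?K x * \<xi> x\<bar>"])
      show "AE x in lborel. (\<lambda>m. indicator ?K x * \<xi> x * \<phi> l u m x) \<longlonglongrightarrow> indicator ?K x * \<xi> x * indicator (box l u) x"
        by (intro AE_I2 tendsto_mult tendsto_const \<phi>1)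
      show "AE x in lborel. norm (indicator ?K x * \<xi> x * \<phi> l u m x) \<le> \<bar>indicator ?K x * \<xi> x\<bar>" for m
        using \<phi>01[of l u m] by (intro AE_I2) (simp add: abs_mult mult_left_le)
    qed (use i\<xi> in \<open>auto\<close>)
    moreover have "(\<integral>x. indicator ?K x * \<xi> x * \<phi> l u m x \<partial>lborel) = 0" for m
    proof (rule test(2)[OF Ck\<phi>])
      show "\<phi> l u m x = 0" if "x \<notin> ?K" for x
        using \<phi>0[of x l u m] sub[OF \<open>box l u \<subseteq> box L H\<close>] that by blast
      show "\<bar>\<phi> l u m x\<bar> \<le> 1" for x using \<phi>01[of l u m x] by simp
    qed
    ultimately have "(\<integral>x. indicator ?K x * \<xi> x * indicator (box l u) x \<partial>lborel) = 0"
      by (simp add: LIMSEQ_const_iff)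
    then show ?thesis by (simp only: mult_ac)
  qed
  have "AE x in lborel. indicator (box L H) x * (indicator ?K x * \<xi> x) = 0"
  proof (rule AE_zero_if_box_integrals_zero)
    show "integrable lborel (\<lambda>x. indicator (box L H) x * (indicator ?K x * \<xi> x))"
      using integrable_mult_indicator[OF _ i\<xi>, of "box L H"] by simp
    fix l u :: 'a
    obtain l' u' where b: "box l u \<inter> box L H = box l' u'"
      by (simp add: box_Int_box)
    have "(\<lambda>x. indicator (box l u) x * (indicator (box L H) x * (indicator ?K x * \<xi> x)))
      = (\<lambda>x. indicator (box l' u') x * (indicator ?K x * \<xi> x))"
      by (auto simp: fun_eq_iff b[symmetric] indicator_def)
    moreover have "box l' u' \<subseteq> box L H" using b by blast
    ultimately show "(\<integral>x. indicator (box l u) x * (indicator (box L H) x * (indicator ?K x * \<xi> x)) \<partial>lborel) = 0"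
      using zero by simp
  qed
  then show ?thesis
    by eventually_elim (use box_subset_cbox in \<open>auto simp: indicator_def split: if_splits\<close>)
qed

section \<open>Volumes of thin spherical shells\<close>

text \<open>The factor is a^2 - b^2 and not a - b because the thickness of a shell is measured in
  squared radius; the price is two powers, hence the exponent m + 2. The induction splits off a
  (a^(m+2) - b^(m+2)) and bounds b (a - b) by a^2 - b^2.\<close>

lemma power_diff_le:
  fixes a b :: real
  assumes "0 \<le> b" "b \<le> a"
  shows "a ^ (m + 2) - b ^ (m + 2) \<le> real (m + 2) * a ^ m * (a\<^sup>2 - b\<^sup>2)"
proof (induction m)
  case 0
  have "b\<^sup>2 \<le> a\<^sup>2" using assms by (intro power_mono)
  then show ?case by (simp add: power2_eq_square)
next
  case (Suc m)
  have "b ^ (m + 2) * (a - b) = b ^ Suc m * (b * (a - b))" by (simp add: algebra_simps)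
  also have "\<dots> \<le> a ^ Suc m * ((a + b) * (a - b))"
    using assms by (intro mult_mono power_mono mult_right_mono) auto
  also have "\<dots> = a ^ Suc m * (a\<^sup>2 - b\<^sup>2)" by (simp add: algebra_simps power2_eq_square)
  finally have 1: "b ^ (m + 2) * (a - b) \<le> a ^ Suc m * (a\<^sup>2 - b\<^sup>2)" .
  have "a ^ (Suc m + 2) - b ^ (Suc m + 2) = a * (a ^ (m + 2) - b ^ (m + 2)) + b ^ (m + 2) * (a - b)"
    by (simp add: algebra_simps)
  also have "\<dots> \<le> a * (real (m + 2) * a ^ m * (a\<^sup>2 - b\<^sup>2)) + a ^ Suc m * (a\<^sup>2 - b\<^sup>2)"
    using assms by (intro add_mono mult_left_mono Suc.IH 1) auto
  also have "\<dots> = real (Suc m + 2) * a ^ Suc m * (a\<^sup>2 - b\<^sup>2)" by (simp add: algebra_simps)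
  finally show ?case .
qed

text \<open>The bound is linear in e and uniform in s, also for shells degenerating to small balls
  around y. This is where dimension at least 2 enters: a ball of squared radius e has volume of
  order e^(n/2).\<close>

lemma emeasure_shell_le:
  fixes y :: "'a::euclidean_space"
  assumes dim: "2 \<le> DIM('a)" and s: "0 \<le> s" "s \<le> R\<^sup>2" and R: "0 \<le> R" and e: "0 \<le> e"
  shows "emeasure lborel {x. s - e \<le> (dist y x)\<^sup>2 \<and> (dist y x)\<^sup>2 \<le> s}
    \<le> ennreal (unit_ball_vol DIM('a) * DIM('a) * R ^ (DIM('a) - 2) * e)"
proof -
  obtain m where m: "DIM('a) = m + 2" using dim by (metis add.commute le_Suc_ex)
  define a where "a = sqrt s"
  \<comment> \<open>For s < e the shell has no inner sphere; the maximum then gives radius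
    0.\<close>
  define b where "b = sqrt (max 0 (s - e))"
  have ab: "0 \<le> b" "b \<le> a" "a\<^sup>2 = s" "b\<^sup>2 = max 0 (s - e)" "a \<le> R"
    using s e real_le_lsqrt[OF R s(2)] by (auto simp: a_def b_def)
  have "{x. s - e \<le> (dist y x)\<^sup>2 \<and> (dist y x)\<^sup>2 \<le> s} \<subseteq> cball y a - ball y b"
  proof (intro subsetI)
    fix x assume x: "x \<in> {x. s - e \<le> (dist y x)\<^sup>2 \<and> (dist y x)\<^sup>2 \<le> s}"
    have "dist y x \<le> a" unfolding a_def using x by (intro real_le_rsqrt) auto
    moreover have "b \<le> dist y x" unfolding b_def using x by (intro real_le_lsqrt) auto
    ultimately show "x \<in> cball y a - ball y b" by auto
  qed
  then have "emeasure lborel {x. s - e \<le> (dist y x)\<^sup>2 \<and> (dist y x)\<^sup>2 \<le> s} \<le> emeasure lborel (cball y a - ball y b)"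
    by (intro emeasure_mono) auto
  also have "\<dots> = emeasure lborel (cball y a) - emeasure lborel (ball y b)"
    using ab(2) emeasure_lborel_ball_finite[of y b] by (intro emeasure_Diff) auto
  also have "\<dots> = ennreal (unit_ball_vol DIM('a) * a ^ DIM('a) - unit_ball_vol DIM('a) * b ^ DIM('a))"
    using ab by (simp add: emeasure_cball emeasure_ball ennreal_minus)
  also have "\<dots> \<le> ennreal (unit_ball_vol DIM('a) * DIM('a) * R ^ (DIM('a) - 2) * e)"
  proof (intro ennreal_leI)
    have "a ^ DIM('a) - b ^ DIM('a) \<le> real (m + 2) * a ^ m * (a\<^sup>2 - b\<^sup>2)"
      unfolding m by (rule power_diff_le[OF ab(1,2)])
    also have "\<dots> \<le> real (m + 2) * R ^ m * e"
      using ab s e R by (intro mult_mono power_mono) auto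
    finally show "unit_ball_vol DIM('a) * a ^ DIM('a) - unit_ball_vol DIM('a) * b ^ DIM('a)
       \<le> unit_ball_vol DIM('a) * DIM('a) * R ^ (DIM('a) - 2) * e"
      using mult_left_mono[of "a ^ DIM('a) - b ^ DIM('a)" "real (m + 2) * R ^ m * e" "unit_ball_vol DIM('a)"]
      by (simp add: m algebra_simps)
  qed
  finally show ?thesis .
qed

section \<open>Positive definite matrices\<close>

lemma continuous_on_det [continuous_intros]:
  fixes f :: "'a::topological_space \<Rightarrow> real ^ 'n::finite ^ 'n"
  assumes "continuous_on S f"
  shows "continuous_on S (\<lambda>x. det (f x))"
  unfolding det_def using assms by (intro continuous_intros)

lemma continuous_on_matrix_vector_mult [continuous_intros]:
  fixes f :: "'a::topological_space \<Rightarrow> real ^ 'n::finite ^ 'm::finite"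
  assumes "continuous_on S f" "continuous_on S h"
  shows "continuous_on S (\<lambda>x. f x *v h x)"
  unfolding matrix_vector_mult_def using assms by (intro continuous_intros)

lemma matrix_inv_mult:
  fixes G :: "real ^ 'n::finite ^ 'n"
  assumes "det G \<noteq> 0"
  shows "G ** matrix_inv G = mat 1" "matrix_inv G ** G = mat 1"
proof -
  have "\<exists>G'. G ** G' = mat 1 \<and> G' ** G = mat 1"
    using assms by (simp add: invertible_det_nz[symmetric] invertible_def)
  then have "G ** matrix_inv G = mat 1 \<and> matrix_inv G ** G = mat 1"
    unfolding matrix_inv_def by (rule someI_ex)
  then show "G ** matrix_inv G = mat 1" "matrix_inv G ** G = mat 1" by auto
qed

text \<open>The segment from the identity to \<open>G\<close> consists of positive definite
  matrices. These are injective, so the determinant never vanishes along it and keeps the sign it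
  has at the identity.\<close>

lemma pos_def_det_pos:
  fixes G :: "real ^ 'n::finite ^ 'n"
  assumes "\<And>v. v \<noteq> 0 \<Longrightarrow> v \<bullet> (G *v v) > 0"
  shows "det G > 0"
proof (rule ccontr)
  assume nd: "\<not> 0 < det G"
  define H where "H = (\<lambda>t::real. (1 - t) *\<^sub>R mat 1 + t *\<^sub>R G)"
  have "continuous_on {0..1} (\<lambda>t. det (H t))"
    unfolding H_def by (intro continuous_intros)
  then obtain t where t: "0 \<le> t" "t \<le> 1" "det (H t) = 0"
    using IVT2'[of "\<lambda>t. det (H t)" 1 0 0] nd by (auto simp: H_def)
  then have "\<not> invertible (H t)" by (simp add: invertible_det_nz)
  then obtain v where v: "v \<noteq> 0" "H t *v v = 0"
    using matrix_left_invertible_ker[of "H t"] invertible_left_inverse[of "H t"] by blast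
  have "v \<bullet> (H t *v v) = (1 - t) * (v \<bullet> v) + t * (v \<bullet> (G *v v))"
    by (simp add: H_def matrix_vector_mult_add_rdistrib scaleR_matrix_vector_assoc[symmetric] inner_add_right)
  moreover have "0 < (1 - t) * (v \<bullet> v) + t * (v \<bullet> (G *v v))"
  proof (cases "t = 0")
    case False
    then show ?thesis using t assms[OF v(1)] by (intro add_nonneg_pos) auto
  qed (use v in simp)
  ultimately show False using v(2) by simp
qed

text \<open>Extremes over the compact set K x unit sphere, extended to all vectors by homogeneity.
  One pair a, b bounds both the metric and the volume density, so that later estimates carry only
  two constants per ball.\<close>

lemma compact_elliptic:
  fixes G :: "'a::metric_space \<Rightarrow> real ^ 'n::finite ^ 'n"
  assumes K: "compact K" and cont: "continuous_on K G"
    and pos: "\<And>x v. x \<in> K \<Longrightarrow> v \<noteq> 0 \<Longrightarrow> v \<bullet> (G x *v v) > 0"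
  obtains a b where "0 < a" "0 < b"
    "\<And>x v. x \<in> K \<Longrightarrow> a * (norm v)\<^sup>2 \<le> v \<bullet> (G x *v v)"
    "\<And>x v. x \<in> K \<Longrightarrow> norm (G x *v v) \<le> b * norm v"
    "\<And>x. x \<in> K \<Longrightarrow> a \<le> sqrt (det (G x))" "\<And>x. x \<in> K \<Longrightarrow> sqrt (det (G x)) \<le> b"
proof (cases "K = {}")
  case True
  then show ?thesis using that[of 1 1] by simp
next
  case False
  let ?S = "K \<times> sphere (0 :: real ^ 'n) 1"
  have S: "compact ?S" by (intro compact_Times K) auto
  have "norm (axis undefined 1 :: real ^ 'n) = 1" by (simp add: norm_axis_1)
  then have ne: "?S \<noteq> {}" using False by force
  have c1: "continuous_on ?S (\<lambda>p. snd p \<bullet> (G (fst p) *v snd p))"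
    and c2: "continuous_on ?S (\<lambda>p. norm (G (fst p) *v snd p))"
    by (auto intro!: continuous_intros continuous_on_compose2[OF cont])
  have c3: "continuous_on K (\<lambda>x. sqrt (det (G x)))" by (intro continuous_intros cont)
  obtain p where p: "p \<in> ?S" "\<And>q. q \<in> ?S \<Longrightarrow> snd p \<bullet> (G (fst p) *v snd p) \<le> snd q \<bullet> (G (fst q) *v snd q)"
    using continuous_attains_inf[OF S ne c1] by blast
  obtain q where q: "\<And>r. r \<in> ?S \<Longrightarrow> norm (G (fst r) *v snd r) \<le> norm (G (fst q) *v snd q)"
    using continuous_attains_sup[OF S ne c2] by blast
  obtain y where y: "y \<in> K" "\<And>x. x \<in> K \<Longrightarrow> sqrt (det (G y)) \<le> sqrt (det (G x))"
    using continuous_attains_inf[OF K False c3] by blast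
  obtain z where z: "\<And>x. x \<in> K \<Longrightarrow> sqrt (det (G x)) \<le> sqrt (det (G z))"
    using continuous_attains_sup[OF K False c3] by blast
  define a where "a = min (snd p \<bullet> (G (fst p) *v snd p)) (sqrt (det (G y)))"
  define b where "b = max (max (norm (G (fst q) *v snd q)) (sqrt (det (G z)))) 1"
  have "snd p \<noteq> 0" using p(1) by auto
  then have "0 < snd p \<bullet> (G (fst p) *v snd p)" using p(1) pos by auto
  moreover have "0 < sqrt (det (G y))" using pos_def_det_pos[OF pos[OF y(1)]] by simp
  ultimately have "0 < a" by (simp add: a_def)
  show ?thesis
  proof (rule that[of a b])
    fix x and v :: "real ^ 'n" assume x: "x \<in> K"
    show "a * (norm v)\<^sup>2 \<le> v \<bullet> (G x *v v)"
    proof (cases "v = 0")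
      case False
      define w where "w = (1 / norm v) *\<^sub>R v"
      have v: "v = norm v *\<^sub>R w" using False by (simp add: w_def)
      have "(x, w) \<in> ?S" using x False by (simp add: w_def)
      then have "a \<le> w \<bullet> (G x *v w)" using p(2)[of "(x, w)"] by (simp add: a_def)
      then have "a * (norm v)\<^sup>2 \<le> (w \<bullet> (G x *v w)) * (norm v)\<^sup>2" by (intro mult_right_mono) auto
      also have "\<dots> = v \<bullet> (G x *v v)"
        by (subst (2 3) v) (simp add: matrix_vector_mult_scaleR power2_eq_square)
      finally show ?thesis .
    qed simp
    show "norm (G x *v v) \<le> b * norm v"
    proof (cases "v = 0")
      case False
      define w where "w = (1 / norm v) *\<^sub>R v"
      have v: "v = norm v *\<^sub>R w" using False by (simp add: w_def)
      have "(x, w) \<in> ?S" using x False by (simp add: w_def)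
      then have "norm (G x *v w) \<le> b" using q[of "(x, w)"] by (simp add: b_def)
      then have "norm (G x *v w) * norm v \<le> b * norm v" by (intro mult_right_mono) auto
      moreover have "norm (G x *v v) = norm (G x *v w) * norm v"
        by (subst v) (simp add: matrix_vector_mult_scaleR)
      ultimately show ?thesis by simp
    qed simp
  next
    fix x assume x: "x \<in> K"
    show "a \<le> sqrt (det (G x))"
      unfolding a_def using y(2)[OF x] by (rule min.coboundedI2)
    show "sqrt (det (G x)) \<le> b"
      unfolding b_def using z[OF x] by (intro max.coboundedI1 max.coboundedI2)
  qed (use \<open>0 < a\<close> in \<open>auto simp: b_def\<close>)
qed

section \<open>Charts and the Riemannian volume\<close>

lemma emeasure_finite_disjoint_cover:
  assumes "finite I" "\<And>i. i \<in> I \<Longrightarrow> P i \<in> sets M" "disjoint_family_on P I" "B \<subseteq> (\<Union>i\<in>I. P i)" "B \<in> sets M"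
  shows "emeasure M B = (\<Sum>i\<in>I. emeasure M (B \<inter> P i))"
proof -
  have "B = (\<Union>i\<in>I. B \<inter> P i)" using assms(4) by blast
  then have "emeasure M B = emeasure M (\<Union>i\<in>I. B \<inter> P i)" by simp
  also have "\<dots> = (\<Sum>i\<in>I. emeasure M (B \<inter> P i))"
    using assms by (intro sum_emeasure[symmetric]) (auto simp: disjoint_family_on_def)
  finally show ?thesis .
qed

locale closed_riemannian =
  fixes A :: "('m::{t2_space, second_countable_topology}, 'n::finite) chart set"
    and g :: "('m, 'n) metric"
  assumes closed_riemannian: "closed_riemannian_manifold A g"
begin

lemma compact_M: "compact (UNIV :: 'm set)"
  and atlas: "smooth_atlas A" and metric: "riemannian_metric A g"
  using closed_riemannian by (auto simp: closed_riemannian_manifold_def)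

lemma chart_exists: "\<exists>c\<in>A. p \<in> chart_dom c"
  using atlas unfolding smooth_atlas_def by blast

lemma
  assumes "c \<in> A"
  shows open_dom: "open (chart_dom c)" and open_img: "open (chart_img c)"
    and homeo: "homeomorphism (chart_dom c) (chart_img c) (snd c) (chart_inv c)"
  using atlas assms unfolding smooth_atlas_def is_chart_def by blast+

lemma
  assumes "c \<in> A"
  shows chart_inv_chart: "p \<in> chart_dom c \<Longrightarrow> chart_inv c (snd c p) = p"
    and chart_chart_inv: "x \<in> chart_img c \<Longrightarrow> snd c (chart_inv c x) = x"
    and chart_inv_dom: "x \<in> chart_img c \<Longrightarrow> chart_inv c x \<in> chart_dom c"
    and continuous_on_chart: "continuous_on (chart_dom c) (snd c)"
    and continuous_on_chart_inv: "continuous_on (chart_img c) (chart_inv c)"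
  using homeomorphism_apply1[OF homeo[OF assms]] homeomorphism_apply2[OF homeo[OF assms]]
    homeomorphism_image2[OF homeo[OF assms]] homeomorphism_cont1[OF homeo[OF assms]]
    homeomorphism_cont2[OF homeo[OF assms]]
  by blast+

lemma chart_image_eq:
  assumes "c \<in> A"
  shows "snd c ` (B \<inter> chart_dom c) = chart_img c \<inter> chart_inv c -` B"
proof
  show "snd c ` (B \<inter> chart_dom c) \<subseteq> chart_img c \<inter> chart_inv c -` B"
    using chart_inv_chart[OF assms] by auto
  show "chart_img c \<inter> chart_inv c -` B \<subseteq> snd c ` (B \<inter> chart_dom c)"
  proof
    fix x assume x: "x \<in> chart_img c \<inter> chart_inv c -` B"
    then have "chart_inv c x \<in> B \<inter> chart_dom c" using chart_inv_dom[OF assms] by blast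
    then have "snd c (chart_inv c x) \<in> snd c ` (B \<inter> chart_dom c)" by (rule imageI)
    then show "x \<in> snd c ` (B \<inter> chart_dom c)" using chart_chart_inv[OF assms] x by simp
  qed
qed

lemma open_chart_image:
  assumes "c \<in> A" "open B"
  shows "open (snd c ` (B \<inter> chart_dom c))"
  unfolding chart_image_eq[OF assms(1)]
  by (rule continuous_open_preimage[OF continuous_on_chart_inv[OF assms(1)] open_img[OF assms(1)] assms(2)])

lemma open_chart_inv_image:
  assumes "c \<in> A" "open B" "B \<subseteq> chart_img c"
  shows "open (chart_inv c ` B)"
proof -
  have "chart_inv c ` B = chart_dom c \<inter> snd c -` B"
  proof
    show "chart_inv c ` B \<subseteq> chart_dom c \<inter> snd c -` B"
      using assms(3) chart_inv_dom[OF assms(1)] chart_chart_inv[OF assms(1)] by auto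
    show "chart_dom c \<inter> snd c -` B \<subseteq> chart_inv c ` B"
      using chart_inv_chart[OF assms(1)] by (metis (no_types, lifting) IntE imageI subsetI vimageE)
  qed
  then show ?thesis
    using continuous_open_preimage[OF continuous_on_chart[OF assms(1)] open_dom[OF assms(1)] assms(2)] by simp
qed

lemma compact_chart_inv_image:
  assumes "c \<in> A" "compact B" "B \<subseteq> chart_img c"
  shows "compact (chart_inv c ` B)"
  by (rule compact_continuous_image[OF continuous_on_subset[OF continuous_on_chart_inv[OF assms(1)] assms(3)] assms(2)])

lemma finite_subatlas:
  obtains F where "finite F" "F \<subseteq> A" "(\<Union>c\<in>F. chart_dom c) = UNIV"
proof -
  have "\<And>S. S \<in> fst ` A \<Longrightarrow> open S" "UNIV \<subseteq> \<Union> (fst ` A)"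
    using open_dom chart_exists by auto
  from compactE[OF compact_M this(2) this(1)] obtain D where D: "D \<subseteq> fst ` A" "finite D" "UNIV \<subseteq> \<Union> D"
    by auto
  then obtain F where "F \<subseteq> A" "finite F" "D = fst ` F"
    by (meson finite_subset_image)
  then show ?thesis using D(3) by (intro that[of F]) auto
qed

text \<open>The half-size balls cover, while the concentric closed balls stay in the chart images.
  The gap leaves room for cutoffs, and compactness of the larger balls gives uniform bounds on the
  metric.\<close>

lemma finite_chart_balls:
  obtains I :: "(('m, 'n) chart \<times> (real ^ 'n) \<times> real) set" where "finite I"
    "\<forall>c y r. (c, y, r) \<in> I \<longrightarrow> c \<in> A \<and> 0 < r \<and> cball y r \<subseteq> chart_img c"
    "(\<Union>(c, y, r)\<in>I. chart_inv c ` ball y (r / 2)) = UNIV"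
proof -
  define J :: "(('m, 'n) chart \<times> (real ^ 'n) \<times> real) set"
    where "J = {(c, y, r). c \<in> A \<and> 0 < r \<and> cball y r \<subseteq> chart_img c}"
  define N where "N = (\<lambda>(c :: ('m, 'n) chart, y, r). chart_inv c ` ball y (r / 2))"
  have sub: "ball y (r / 2) \<subseteq> chart_img c" if "(c, y, r) \<in> J" for c y r
    using that by (force simp: J_def)
  have "p \<in> \<Union> (N ` J)" for p
  proof -
    obtain c where c: "c \<in> A" "p \<in> chart_dom c" using chart_exists by blast
    then obtain r where r: "0 < r" "cball (snd c p) r \<subseteq> chart_img c"
      using open_img[OF c(1)] open_contains_cball by blast
    have "p \<in> chart_inv c ` ball (snd c p) (r / 2)"
      using r chart_inv_chart[OF c] by (intro image_eqI[of _ _ "snd c p"]) auto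
    moreover have "(c, snd c p, r) \<in> J" using c r by (simp add: J_def)
    ultimately show ?thesis unfolding N_def by blast
  qed
  then have cov: "UNIV \<subseteq> \<Union> (N ` J)" by blast
  have "\<And>S. S \<in> N ` J \<Longrightarrow> open S"
    using sub open_chart_inv_image by (auto simp: N_def J_def)
  from compactE[OF compact_M cov this] obtain D where D: "D \<subseteq> N ` J" "finite D" "UNIV \<subseteq> \<Union> D"
    by auto
  then obtain I where "I \<subseteq> J" "finite I" "D = N ` I"
    by (meson finite_subset_image)
  then show ?thesis
    using D(3) by (intro that[of I]) (unfold J_def N_def, blast+)
qed

lemma
  assumes "c \<in> A" "p \<in> chart_dom c"
  shows metric_sym: "transpose (g c p) = g c p"
    and metric_pos: "v \<noteq> 0 \<Longrightarrow> v \<bullet> (g c p *v v) > 0"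
  using metric assms unfolding riemannian_metric_def by blast+

lemma metric_nonneg: "c \<in> A \<Longrightarrow> p \<in> chart_dom c \<Longrightarrow> v \<bullet> (g c p *v v) \<ge> 0"
  using metric_pos[of c p v] by (cases "v = 0") auto

lemma det_metric_pos: "c \<in> A \<Longrightarrow> p \<in> chart_dom c \<Longrightarrow> det (g c p) > 0"
  by (rule pos_def_det_pos) (rule metric_pos)

lemma metric_sym_inner:
  assumes "c \<in> A" "p \<in> chart_dom c"
  shows "v \<bullet> (g c p *v w) = w \<bullet> (g c p *v v)"
  by (metis assms dot_lmul_matrix inner_commute metric_sym transpose_matrix_vector)

lemma metric_transform:
  "c \<in> A \<Longrightarrow> d \<in> A \<Longrightarrow> p \<in> chart_dom c \<Longrightarrow> p \<in> chart_dom d \<Longrightarrow>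
    g c p = transpose (jacobian c d p) ** g d p ** jacobian c d p"
  using metric unfolding riemannian_metric_def by blast

lemma continuous_on_metric:
  assumes "c \<in> A"
  shows "continuous_on (chart_img c) (\<lambda>x. g c (chart_inv c x))"
  using metric assms unfolding riemannian_metric_def smooth_on_def by (metis Ck_on.simps(1))

lemma continuous_on_metric_dom:
  assumes "c \<in> A"
  shows "continuous_on (chart_dom c) (g c)"
proof -
  have "continuous_on (chart_dom c) (\<lambda>p. g c (chart_inv c (snd c p)))"
    by (rule continuous_on_compose2[OF continuous_on_metric continuous_on_chart]) (use assms in auto)
  then show ?thesis
    by (rule continuous_on_eq) (simp add: chart_inv_chart[OF assms])
qed

lemma metric_bounds:
  assumes "c \<in> A" "compact K" "K \<subseteq> chart_img c"
  obtains a b where "0 < a" "0 < b"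
    "\<And>x v. x \<in> K \<Longrightarrow> a * (norm v)\<^sup>2 \<le> v \<bullet> (g c (chart_inv c x) *v v)"
    "\<And>x v. x \<in> K \<Longrightarrow> norm (g c (chart_inv c x) *v v) \<le> b * norm v"
    "\<And>x. x \<in> K \<Longrightarrow> a \<le> sqrt (det (g c (chart_inv c x)))"
    "\<And>x. x \<in> K \<Longrightarrow> sqrt (det (g c (chart_inv c x))) \<le> b"
proof (rule compact_elliptic[OF assms(2) continuous_on_subset[OF continuous_on_metric[OF assms(1)] assms(3)]])
  show "v \<bullet> (g c (chart_inv c x) *v v) > 0" if "x \<in> K" "v \<noteq> 0" for x v
    using that assms chart_inv_dom metric_pos by blast
qed (rule that)

lemma transition_derivative:
  assumes "c \<in> A" "d \<in> A" "p \<in> chart_dom c" "p \<in> chart_dom d"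
  shows "(transition c d has_derivative (*v) (jacobian c d p)) (at (snd c p))"
proof -
  have "Ck_on (Suc 0) (snd c ` (chart_dom c \<inter> chart_dom d)) (transition c d)"
    using atlas assms unfolding smooth_atlas_def smooth_on_def by blast
  moreover have "open (snd c ` (chart_dom c \<inter> chart_dom d))"
    using open_chart_image[OF assms(1) open_dom[OF assms(2)]] by (simp add: Int_commute)
  ultimately have "(transition c d has_derivative frechet_derivative (transition c d) (at (snd c p))) (at (snd c p))"
    by (rule Ck_on_has_derivative) (use assms in auto)
  then show ?thesis
    unfolding jacobian_def by (simp add: matrix_vector_mul(2)[OF has_derivative_linear])
qed

lemma jacobian_inverse:
  assumes "c \<in> A" "d \<in> A" "p \<in> chart_dom c" "p \<in> chart_dom d"
  shows "jacobian d c p ** jacobian c d p = mat 1"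
proof -
  let ?S = "snd c ` (chart_dom d \<inter> chart_dom c)"
  have t: "transition c d (snd c p) = snd d p"
    by (simp add: transition_def chart_inv_chart[OF assms(1,3)])
  have "((\<lambda>x. transition d c (transition c d x)) has_derivative (\<lambda>v. jacobian d c p *v (jacobian c d p *v v))) (at (snd c p))"
    by (rule has_derivative_compose[OF transition_derivative[OF assms]])
       (use transition_derivative[OF assms(2,1,4,3)] t in simp)
  moreover have "((\<lambda>x. transition d c (transition c d x)) has_derivative (\<lambda>v. v)) (at (snd c p))"
  proof (rule has_derivative_transform_within_open[where s = ?S and f = "\<lambda>x. x"])
    show "open ?S" by (rule open_chart_image[OF assms(1) open_dom[OF assms(2)]])
    show "x = transition d c (transition c d x)" if "x \<in> ?S" for x
      using that assms by (auto simp: transition_def chart_inv_chart)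
  qed (use assms in auto)
  ultimately have "(\<lambda>v. jacobian d c p *v (jacobian c d p *v v)) = (\<lambda>v. v)"
    by (rule has_derivative_unique)
  then have "(jacobian d c p ** jacobian c d p) *v v = mat 1 *v v" for v
    by (metis matrix_vector_mul_assoc matrix_vector_mul_lid)
  then show ?thesis by (simp add: matrix_eq)
qed

section \<open>Existence and uniqueness of the Riemannian volume\<close>

definition dens :: "('m, 'n) chart \<Rightarrow> real ^ 'n \<Rightarrow> real" where
  "dens c x = sqrt (det (g c (chart_inv c x)))"

lemma dens_pos: "c \<in> A \<Longrightarrow> x \<in> chart_img c \<Longrightarrow> 0 < dens c x"
  unfolding dens_def using det_metric_pos chart_inv_dom by simp

lemma continuous_on_dens: "c \<in> A \<Longrightarrow> continuous_on (chart_img c) (dens c)"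
  unfolding dens_def by (intro continuous_intros continuous_on_metric)

lemma borel_img [measurable]: "c \<in> A \<Longrightarrow> chart_img c \<in> sets borel"
  and borel_dom [measurable]: "c \<in> A \<Longrightarrow> chart_dom c \<in> sets borel"
  using open_img open_dom by auto

lemma borel_chart_image:
  assumes "c \<in> A" "B \<in> sets borel"
  shows "snd c ` (B \<inter> chart_dom c) \<in> sets borel"
proof -
  have "chart_inv c \<in> borel_measurable (restrict_space borel (chart_img c))"
    by (rule borel_measurable_continuous_on_restrict[OF continuous_on_chart_inv[OF assms(1)]])
  from measurable_sets[OF this assms(2)] show ?thesis
    using borel_img[OF assms(1)]
    by (simp add: chart_image_eq[OF assms(1)] space_restrict_space sets_restrict_space_iff Int_commute)
qed

text \<open>Determinants in the transformation law of the metric give det g_c = (det J)^2 det g_d.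
  The square root produces exactly the Jacobian factor |det J| of the substitution by the transition
  map.\<close>

lemma nn_integral_dens_transition:
  assumes c: "c \<in> A" and d: "d \<in> A" and B: "B \<in> sets borel" "B \<subseteq> chart_dom c" "B \<subseteq> chart_dom d"
  shows "(\<integral>\<^sup>+x\<in>snd d ` B. ennreal (dens d x) \<partial>lborel) = (\<integral>\<^sup>+x\<in>snd c ` B. ennreal (dens c x) \<partial>lborel)"
proof -
  let ?T = "transition c d"
  \<comment> \<open>Extension by zero makes the density nonnegative and Borel on the whole space, as
    the substitution theorem requires.\<close>
  define f where "f = (\<lambda>y. indicator (chart_img d) y * dens d y)"
  have sB: "snd c ` B \<in> sets borel" "snd d ` B \<in> sets borel"
    using borel_chart_image[OF c B(1)] borel_chart_image[OF d B(1)] B(2,3) by (simp_all add: Int_absorb2)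
  have fm: "f \<in> borel_measurable borel"
    unfolding f_def using borel_measurable_continuous_on_indicator[OF borel_img[OF d] continuous_on_dens[OF d]] by simp
  have f0: "0 \<le> f y" for y
    using dens_pos[OF d, of y] by (auto simp: f_def indicator_def)
  have Tp: "?T (snd c p) = snd d p" if "p \<in> B" for p
    using that B chart_inv_chart[OF c] by (auto simp: transition_def)
  have img: "?T ` (snd c ` B) = snd d ` B"
    by (auto simp: image_image Tp intro!: image_cong)
  have inj: "inj_on ?T (snd c ` B)"
  proof (rule inj_onI, clarify)
    fix p q assume pq: "p \<in> B" "q \<in> B" "?T (snd c p) = ?T (snd c q)"
    then have "snd d p = snd d q" by (simp add: Tp)
    then have "p = q" using pq(1,2) B(3) chart_inv_chart[OF d] by (metis subsetD)
    then show "snd c p = snd c q" by simp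
  qed
  define T' where "T' = (\<lambda>x. (*v) (jacobian c d (chart_inv c x)))"
  have der: "(?T has_derivative T' x) (at x)" if x: "x \<in> snd c ` B" for x
  proof -
    obtain p where p: "p \<in> B" "x = snd c p" using x by auto
    then have "p \<in> chart_dom c" "p \<in> chart_dom d" using B by auto
    then show ?thesis using transition_derivative[OF c d] by (simp add: T'_def p chart_inv_chart[OF c])
  qed
  have key: "\<bar>det (matrix (T' x))\<bar> * f (?T x) = dens c x" if x: "x \<in> snd c ` B" for x
  proof -
    obtain p where p: "p \<in> B" "x = snd c p" using x by auto
    have pc: "p \<in> chart_dom c" "p \<in> chart_dom d" using p B by auto
    have "det (g c p) = det (jacobian c d p) ^ 2 * det (g d p)"
      unfolding metric_transform[OF c d pc] by (simp add: det_mul power2_eq_square)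
    then have "sqrt (det (g c p)) = \<bar>det (jacobian c d p)\<bar> * sqrt (det (g d p))"
      by (simp add: real_sqrt_mult)
    then show ?thesis
      using p pc by (simp add: T'_def f_def dens_def Tp chart_inv_chart[OF c] chart_inv_chart[OF d])
  qed
  have m: "(\<lambda>x. indicator (snd c ` B) x * (\<bar>det (matrix (T' x))\<bar> * f (?T x))) \<in> borel_measurable borel"
  proof -
    have "(\<lambda>x. indicator (snd c ` B) x *\<^sub>R dens c x) \<in> borel_measurable borel"
      by (rule borel_measurable_continuous_on_indicator[OF sB(1) continuous_on_subset[OF continuous_on_dens[OF c]]])
         (use B in auto)
    moreover have "(\<lambda>x. indicator (snd c ` B) x * (\<bar>det (matrix (T' x))\<bar> * f (?T x))) = (\<lambda>x. indicator (snd c ` B) x *\<^sub>R dens c x)"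
      by (auto simp: fun_eq_iff indicator_def key)
    ultimately show ?thesis by simp
  qed
  have "(\<integral>\<^sup>+y\<in>?T ` (snd c ` B). ennreal (f y) \<partial>lborel)
     = (\<integral>\<^sup>+x\<in>snd c ` B. ennreal (\<bar>det (matrix (T' x))\<bar> * f (?T x)) \<partial>lborel)"
    by (rule nn_integral_change_of_variables[OF sB(1) _ der inj fm f0 m]) (simp_all add: img sB)
  moreover have "(\<integral>\<^sup>+y\<in>?T ` (snd c ` B). ennreal (f y) \<partial>lborel) = (\<integral>\<^sup>+x\<in>snd d ` B. ennreal (dens d x) \<partial>lborel)"
    unfolding img using B(3) by (intro nn_integral_cong) (auto simp: f_def indicator_def)
  moreover have "(\<integral>\<^sup>+x\<in>snd c ` B. ennreal (\<bar>det (matrix (T' x))\<bar> * f (?T x)) \<partial>lborel) = (\<integral>\<^sup>+x\<in>snd c ` B. ennreal (dens c x) \<partial>lborel)"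
    by (intro nn_integral_cong) (auto simp: indicator_def key)
  ultimately show ?thesis by simp
qed

text \<open>The inverse chart is made constant outside the image so that it is Borel on the whole
  space; the density vanishes there, so the value is immaterial.\<close>

definition chart_vol :: "('m, 'n) chart \<Rightarrow> 'm measure" where
  "chart_vol c = distr (density lborel (\<lambda>x. indicator (chart_img c) x * ennreal (dens c x))) borel
     (\<lambda>x. if x \<in> chart_img c then chart_inv c x else undefined)"

lemma measurable_chart_inv [measurable]:
  assumes "c \<in> A"
  shows "(\<lambda>x. if x \<in> chart_img c then chart_inv c x else undefined) \<in> borel_measurable borel"
proof (rule measurable_If_restrict_space_iff[THEN iffD2])
  show "chart_inv c \<in> borel_measurable (restrict_space borel {x. x \<in> chart_img c}) \<and>
     (\<lambda>x. undefined) \<in> borel_measurable (restrict_space borel {x. x \<notin> chart_img c})"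
    using borel_measurable_continuous_on_restrict[OF continuous_on_chart_inv[OF assms]] by simp
qed (use assms in measurable)

lemma measurable_dens [measurable]:
  assumes "c \<in> A"
  shows "(\<lambda>x. indicator (chart_img c) x * ennreal (dens c x)) \<in> borel_measurable borel"
proof -
  have "(\<lambda>x. ennreal (indicator (chart_img c) x *\<^sub>R dens c x)) \<in> borel_measurable borel"
    using borel_measurable_continuous_on_indicator[OF borel_img[OF assms] continuous_on_dens[OF assms]]
    by measurable
  moreover have "(\<lambda>x. ennreal (indicator (chart_img c) x *\<^sub>R dens c x)) = (\<lambda>x. indicator (chart_img c) x * ennreal (dens c x))"
    by (auto simp: fun_eq_iff indicator_def)
  ultimately show ?thesis by simp
qed

lemma nn_integral_chart_vol:
  assumes "c \<in> A" "f \<in> borel_measurable borel"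
  shows "(\<integral>\<^sup>+p. f p \<partial>chart_vol c) = (\<integral>\<^sup>+x\<in>chart_img c. ennreal (dens c x) * f (chart_inv c x) \<partial>lborel)"
proof -
  note [measurable] = assms(2) measurable_chart_inv[OF assms(1)] measurable_dens[OF assms(1)]
  show ?thesis
    unfolding chart_vol_def
    by (simp add: nn_integral_distr nn_integral_density) (auto intro!: nn_integral_cong simp: indicator_def)
qed

lemma sets_chart_vol [simp]: "sets (chart_vol c) = sets borel"
  by (simp add: chart_vol_def)

lemma emeasure_chart_vol:
  assumes c: "c \<in> A" and B: "B \<in> sets borel"
  shows "emeasure (chart_vol c) B = (\<integral>\<^sup>+x\<in>snd c ` (B \<inter> chart_dom c). ennreal (dens c x) \<partial>lborel)"
proof -
  have "emeasure (chart_vol c) B = (\<integral>\<^sup>+p. indicator B p \<partial>chart_vol c)"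
    using B by simp
  also have "\<dots> = (\<integral>\<^sup>+x\<in>chart_img c. ennreal (dens c x) * indicator B (chart_inv c x) \<partial>lborel)"
    using B by (intro nn_integral_chart_vol c) auto
  also have "\<dots> = (\<integral>\<^sup>+x\<in>snd c ` (B \<inter> chart_dom c). ennreal (dens c x) \<partial>lborel)"
    unfolding chart_image_eq[OF c] by (intro nn_integral_cong) (auto simp: indicator_def)
  finally show ?thesis .
qed

text \<open>The property that characterizes \<open>riem_vol\<close>, isolated so that its
  \<open>THE\<close> can be resolved.\<close>

definition volume_form_measure :: "'m measure \<Rightarrow> bool" where
  "volume_form_measure \<mu> \<longleftrightarrow> sets \<mu> = sets borel \<and>
     (\<forall>c\<in>A. \<forall>B\<in>sets borel. B \<subseteq> chart_dom c \<longrightarrow>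
        emeasure \<mu> B = (\<integral>\<^sup>+x\<in>snd c ` B. ennreal (dens c x) \<partial>lborel))"

lemma riem_vol_eq: "riem_vol A g = (THE \<mu>. volume_form_measure \<mu>)"
  unfolding riem_vol_def volume_form_measure_def dens_def ..

text \<open>A finite Borel partition subordinate to the atlas. It glues measures given in charts
  without a smooth partition of unity.\<close>

definition chart_partition :: "nat set \<Rightarrow> (nat \<Rightarrow> ('m, 'n) chart) \<Rightarrow> (nat \<Rightarrow> 'm set) \<Rightarrow> bool" where
  "chart_partition I ch P \<longleftrightarrow> finite I \<and> (\<forall>i\<in>I. ch i \<in> A) \<and> (\<forall>i. P i \<subseteq> chart_dom (ch i)) \<and>
    (\<forall>i\<in>I. P i \<in> sets borel) \<and> disjoint_family_on P I \<and> (\<Union>i\<in>I. P i) = UNIV"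

lemma chart_partitionD:
  assumes "chart_partition I ch P"
  shows "finite I" "\<And>i. i \<in> I \<Longrightarrow> ch i \<in> A" "\<And>i. P i \<subseteq> chart_dom (ch i)"
    "\<And>i. i \<in> I \<Longrightarrow> P i \<in> sets borel" "disjoint_family_on P I" "(\<Union>i\<in>I. P i) = UNIV"
  using assms unfolding chart_partition_def by blast+

lemma chart_partition_exists: "\<exists>I ch P. chart_partition I ch P"
proof -
  obtain F where F: "finite F" "F \<subseteq> A" "(\<Union>c\<in>F. chart_dom c) = UNIV" by (rule finite_subatlas)
  obtain cs where cs: "set cs = F" using finite_list[OF F(1)] by blast
  \<comment> \<open>Removing the earlier domains makes the pieces disjoint; a point falls into the
    piece of the first domain containing it.\<close>
  define P where "P = (\<lambda>i. chart_dom (cs ! i) - (\<Union>j<i. chart_dom (cs ! j)))"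
  have inA: "cs ! i \<in> A" if "i < length cs" for i using that F(2) cs by auto
  have "\<forall>i\<in>{..<length cs}. P i \<in> sets borel"
    unfolding P_def using inA by (intro ballI sets.Diff sets.finite_UN borel_dom) auto
  moreover have "disjoint_family_on P {..<length cs}"
      unfolding disjoint_family_on_def
    proof (intro ballI impI)
      fix i j :: nat assume "i \<noteq> j"
      then consider "i < j" | "j < i" by linarith
      then show "P i \<inter> P j = {}" by cases (auto simp: P_def)
    qed
  moreover have "(\<Union>i\<in>{..<length cs}. P i) = UNIV"
    proof -
      have "p \<in> (\<Union>i\<in>{..<length cs}. P i)" for p
      proof -
        have "\<exists>i. i < length cs \<and> p \<in> chart_dom (cs ! i)"
          using F(3) cs by (metis UN_E UNIV_I in_set_conv_nth)
        then obtain i where "i < length cs \<and> p \<in> chart_dom (cs ! i)"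
          "\<And>j. j < i \<Longrightarrow> \<not> (j < length cs \<and> p \<in> chart_dom (cs ! j))"
          using exists_least_iff[of "\<lambda>i. i < length cs \<and> p \<in> chart_dom (cs ! i)"] by blast
        then show ?thesis unfolding P_def by (auto intro: less_trans)
      qed
      then show ?thesis by blast
    qed
  moreover have "\<forall>i\<in>{..<length cs}. cs ! i \<in> A" "\<forall>i. P i \<subseteq> chart_dom (cs ! i)"
    using inA by (auto simp: P_def)
  ultimately show ?thesis
    by (intro exI[of _ "{..<length cs}"] exI[of _ "(!) cs"] exI[of _ P]) (simp add: chart_partition_def)
qed

text \<open>Each piece of a chart partition is measured in its own chart. For a set inside the
  domain of another chart c, the charts may be exchanged piece by piece by
  \<open>nn_integral_dens_transition\<close>, so the sum has the prescribed form in c as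
  well.\<close>

lemma volume_form_measure_exists: "\<exists>\<mu>. volume_form_measure \<mu>"
proof -
  obtain I ch P where part: "chart_partition I ch P" using chart_partition_exists by blast
  note I = chart_partitionD[OF part]
  define m where "m = (\<lambda>B. \<Sum>i\<in>I. emeasure (chart_vol (ch i)) (B \<inter> P i))"
  define \<mu> where "\<mu> = measure_of UNIV (sets borel) m"
  have sets_\<mu>: "sets \<mu> = sets borel"
    unfolding \<mu>_def by (simp add: sets.sigma_sets_eq[of borel, simplified])
  have em: "emeasure \<mu> B = m B" if B: "B \<in> sets borel" for B
    unfolding \<mu>_def
  proof (rule emeasure_measure_of_sigma[OF _ _ _ B])
    show "sigma_algebra UNIV (sets borel)"
      using sets.sigma_algebra_axioms[of borel] by simp
    show "positive (sets borel) m" by (simp add: positive_def m_def)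
    show "countably_additive (sets borel) m"
    proof (rule countably_additiveI)
      fix E :: "nat \<Rightarrow> 'm set" assume E: "range E \<subseteq> sets borel" "disjoint_family E"
      have "(\<Sum>n. m (E n)) = (\<Sum>i\<in>I. \<Sum>n. emeasure (chart_vol (ch i)) (E n \<inter> P i))"
        unfolding m_def by (rule suminf_sum) simp
      also have "\<dots> = (\<Sum>i\<in>I. emeasure (chart_vol (ch i)) ((\<Union>n. E n) \<inter> P i))"
      proof (rule sum.cong)
        fix i assume i: "i \<in> I"
        have u: "(\<Union>n. E n) \<inter> P i = (\<Union>n. E n \<inter> P i)" by blast
        have "(\<Sum>n. emeasure (chart_vol (ch i)) (E n \<inter> P i)) = emeasure (chart_vol (ch i)) (\<Union>n. E n \<inter> P i)"
          using E I(4)[OF i] by (intro suminf_emeasure) (auto simp: disjoint_family_on_def)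
        then show "(\<Sum>n. emeasure (chart_vol (ch i)) (E n \<inter> P i)) = emeasure (chart_vol (ch i)) ((\<Union>n. E n) \<inter> P i)"
          by (simp only: u)
      qed simp
      finally show "(\<Sum>n. m (E n)) = m (\<Union> (range E))" by (simp add: m_def)
    qed
  qed
  have "emeasure \<mu> B = (\<integral>\<^sup>+x\<in>snd c ` B. ennreal (dens c x) \<partial>lborel)"
    if c: "c \<in> A" and B: "B \<in> sets borel" "B \<subseteq> chart_dom c" for c B
  proof -
    have "emeasure \<mu> B = (\<Sum>i\<in>I. emeasure (chart_vol (ch i)) (B \<inter> P i))"
      by (simp add: em[OF B(1)] m_def)
    also have "\<dots> = (\<Sum>i\<in>I. emeasure (chart_vol c) (B \<inter> P i))"
    proof (rule sum.cong)
      fix i assume i: "i \<in> I"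
      have BP: "B \<inter> P i \<in> sets borel" using B I(4)[OF i] by auto
      have e: "B \<inter> P i \<inter> chart_dom (ch i) = B \<inter> P i" "B \<inter> P i \<inter> chart_dom c = B \<inter> P i"
        using I(3)[of i] B(2) by auto
      show "emeasure (chart_vol (ch i)) (B \<inter> P i) = emeasure (chart_vol c) (B \<inter> P i)"
        unfolding emeasure_chart_vol[OF c BP] emeasure_chart_vol[OF I(2)[OF i] BP] e
        by (rule nn_integral_dens_transition[OF c I(2)[OF i] BP]) (use I(3)[of i] B(2) in auto)
    qed simp
    also have "\<dots> = emeasure (chart_vol c) B"
      using I B by (intro emeasure_finite_disjoint_cover[symmetric]) auto
    also have "\<dots> = (\<integral>\<^sup>+x\<in>snd c ` B. ennreal (dens c x) \<partial>lborel)"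
      using B by (simp add: emeasure_chart_vol[OF c B(1)] Int_absorb2)
    finally show ?thesis .
  qed
  then have "volume_form_measure \<mu>"
    unfolding volume_form_measure_def using sets_\<mu> by blast
  then show ?thesis by blast
qed

text \<open>Every Borel set splits into finitely many parts lying in single charts, where the value
  is prescribed.\<close>

lemma volume_form_measure_unique:
  assumes "volume_form_measure \<mu>" "volume_form_measure \<nu>"
  shows "\<mu> = \<nu>"
proof (rule measure_eqI)
  show "sets \<mu> = sets \<nu>" using assms by (simp add: volume_form_measure_def)
  fix B assume "B \<in> sets \<mu>"
  then have B: "B \<in> sets borel" "B \<in> sets \<mu>" "B \<in> sets \<nu>" using assms by (simp_all add: volume_form_measure_def)
  obtain I ch P where part: "chart_partition I ch P" using chart_partition_exists by blast
  note I = chart_partitionD[OF part]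
  have "emeasure \<mu> (B \<inter> P i) = emeasure \<nu> (B \<inter> P i)" if i: "i \<in> I" for i
  proof -
    have "B \<inter> P i \<in> sets borel" "B \<inter> P i \<subseteq> chart_dom (ch i)" using B I(4)[OF i] I(3)[of i] by auto
    then show ?thesis using assms I(2)[OF i] by (simp add: volume_form_measure_def)
  qed
  moreover have "emeasure \<mu> B = (\<Sum>i\<in>I. emeasure \<mu> (B \<inter> P i))" "emeasure \<nu> B = (\<Sum>i\<in>I. emeasure \<nu> (B \<inter> P i))"
    using I B assms by (auto intro!: emeasure_finite_disjoint_cover simp: volume_form_measure_def)
  ultimately show "emeasure \<mu> B = emeasure \<nu> B" by simp
qed

abbreviation vol :: "'m measure" where "vol \<equiv> riem_vol A g"

lemma volume_form_vol: "volume_form_measure vol"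
  unfolding riem_vol_eq using volume_form_measure_exists volume_form_measure_unique by (metis theI)

lemma sets_vol [simp, measurable_cong]: "sets vol = sets borel"
  using volume_form_vol by (simp add: volume_form_measure_def)

lemma space_vol [simp]: "space vol = UNIV"
  using sets_eq_imp_space_eq[OF sets_vol] by simp

section \<open>Integration over \<open>M\<close> in charts\<close>

lemma density_vol_chart:
  assumes c: "c \<in> A"
  shows "density vol (indicator (chart_dom c)) = chart_vol c"
proof (rule measure_eqI)
  fix B assume "B \<in> sets (density vol (indicator (chart_dom c)))"
  then have B: "B \<in> sets borel" by simp
  have "emeasure (density vol (indicator (chart_dom c))) B = emeasure vol (B \<inter> chart_dom c)"
    using B borel_dom[OF c] by (simp add: emeasure_density indicator_inter_arith[symmetric] Int_commute mult.commute)
  also have "\<dots> = emeasure (chart_vol c) B"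
    using volume_form_vol B borel_dom[OF c] c
    by (simp add: volume_form_measure_def emeasure_chart_vol)
  finally show "emeasure (density vol (indicator (chart_dom c))) B = emeasure (chart_vol c) B" .
qed simp

lemma nn_integral_vol_chart:
  assumes c: "c \<in> A" and f: "f \<in> borel_measurable borel"
  shows "(\<integral>\<^sup>+p\<in>chart_dom c. f p \<partial>vol) = (\<integral>\<^sup>+x\<in>chart_img c. ennreal (dens c x) * f (chart_inv c x) \<partial>lborel)"
proof -
  note [measurable] = f borel_dom[OF c]
  have "(\<integral>\<^sup>+p\<in>chart_dom c. f p \<partial>vol) = (\<integral>\<^sup>+p. f p \<partial>density vol (indicator (chart_dom c)))"
    by (simp add: nn_integral_density mult.commute)
  then show ?thesis
    by (simp add: density_vol_chart[OF c] nn_integral_chart_vol[OF c f])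
qed

lemma borel_measurable_vol [simp]: "borel_measurable vol = borel_measurable borel"
  by (rule measurable_cong_sets) simp_all

lemma nn_integral_chart_le:
  assumes c: "c \<in> A" and K: "K \<in> sets borel" "K \<subseteq> chart_img c"
    and a: "\<And>x. x \<in> K \<Longrightarrow> a \<le> dens c x" and f: "f \<in> borel_measurable borel"
  shows "ennreal a * (\<integral>\<^sup>+x\<in>K. f (chart_inv c x) \<partial>lborel) \<le> (\<integral>\<^sup>+p. f p \<partial>vol)"
proof -
  note [measurable] = f K(1) measurable_chart_inv[OF c]
  have "(\<lambda>x. f (if x \<in> chart_img c then chart_inv c x else undefined) * indicator K x) \<in> borel_measurable borel"
    by measurable
  moreover have "(\<lambda>x. f (if x \<in> chart_img c then chart_inv c x else undefined) * indicator K x) = (\<lambda>x. f (chart_inv c x) * indicator K x)"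
    using K(2) by (auto simp: fun_eq_iff indicator_def)
  ultimately have [measurable]: "(\<lambda>x. f (chart_inv c x) * indicator K x) \<in> borel_measurable borel" by simp
  have "ennreal a * (\<integral>\<^sup>+x\<in>K. f (chart_inv c x) \<partial>lborel) = (\<integral>\<^sup>+x. ennreal a * (f (chart_inv c x) * indicator K x) \<partial>lborel)"
    by (rule nn_integral_cmult[symmetric]) simp
  also have "\<dots> \<le> (\<integral>\<^sup>+x\<in>chart_img c. ennreal (dens c x) * f (chart_inv c x) \<partial>lborel)"
  proof (intro nn_integral_mono)
    fix x
    show "ennreal a * (f (chart_inv c x) * indicator K x) \<le> ennreal (dens c x) * f (chart_inv c x) * indicator (chart_img c) x"
    proof (cases "x \<in> K")
      case True
      then have "x \<in> chart_img c" using K(2) by blast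
      then show ?thesis using True a[OF True] by (simp add: mult_right_mono ennreal_leI)
    qed simp
  qed
  also have "\<dots> = (\<integral>\<^sup>+p\<in>chart_dom c. f p \<partial>vol)"
    by (rule nn_integral_vol_chart[OF c f, symmetric])
  also have "\<dots> \<le> (\<integral>\<^sup>+p. f p \<partial>vol)"
    by (intro nn_integral_mono) (auto simp: indicator_def)
  finally show ?thesis .
qed

lemma emeasure_vol_chart_inv_le:
  assumes c: "c \<in> A" and K: "K \<in> sets borel" "K \<subseteq> chart_img c"
    and b: "\<And>x. x \<in> K \<Longrightarrow> dens c x \<le> b"
  shows "chart_inv c ` K \<in> sets borel"
    and "emeasure vol (chart_inv c ` K) \<le> ennreal b * emeasure lborel K"
proof -
  have eq: "chart_inv c ` K = chart_dom c \<inter> snd c -` K"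
  proof
    show "chart_inv c ` K \<subseteq> chart_dom c \<inter> snd c -` K"
      using K(2) chart_inv_dom[OF c] chart_chart_inv[OF c] by auto
    show "chart_dom c \<inter> snd c -` K \<subseteq> chart_inv c ` K"
      using chart_inv_chart[OF c] by (metis (no_types, lifting) IntE imageI subsetI vimageE)
  qed
  have "snd c \<in> borel_measurable (restrict_space borel (chart_dom c))"
    by (rule borel_measurable_continuous_on_restrict[OF continuous_on_chart[OF c]])
  from measurable_sets[OF this K(1)] show m: "chart_inv c ` K \<in> sets borel"
    using borel_dom[OF c] unfolding eq by (simp add: space_restrict_space sets_restrict_space_iff Int_commute)
  have "snd c ` chart_inv c ` K = K"
    using K(2) chart_chart_inv[OF c] by (auto simp: image_image subset_iff intro!: image_eqI)
  moreover have "chart_inv c ` K \<subseteq> chart_dom c" using eq by blast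
  ultimately have "emeasure vol (chart_inv c ` K) = (\<integral>\<^sup>+x\<in>K. ennreal (dens c x) \<partial>lborel)"
    using volume_form_vol c m unfolding volume_form_measure_def by simp
  also have "\<dots> \<le> (\<integral>\<^sup>+x. ennreal b * indicator K x \<partial>lborel)"
    using b by (intro nn_integral_mono) (auto simp: indicator_def ennreal_leI)
  also have "\<dots> = ennreal b * emeasure lborel K"
    using K(1) by (simp add: nn_integral_cmult_indicator)
  finally show "emeasure vol (chart_inv c ` K) \<le> ennreal b * emeasure lborel K" .
qed

text \<open>Finitely many coordinate balls cover \<open>M\<close>, and each has finite volume
  because the density is bounded on a compact ball.\<close>

lemma finite_measure_vol: "finite_measure vol"
proof
  obtain I :: "(('m, 'n) chart \<times> (real ^ 'n) \<times> real) set" where I: "finite I"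
    "\<forall>c y r. (c, y, r) \<in> I \<longrightarrow> c \<in> A \<and> 0 < r \<and> cball y r \<subseteq> chart_img c"
    "(\<Union>(c, y, r)\<in>I. chart_inv c ` ball y (r / 2)) = UNIV"
    by (rule finite_chart_balls)
  let ?N = "\<lambda>(c :: ('m, 'n) chart, y, r). chart_inv c ` ball y (r / 2)"
  have N: "?N i \<in> sets vol \<and> emeasure vol (?N i) < \<infinity>" if i: "i \<in> I" for i
  proof -
    obtain c y r where cyr: "i = (c, y, r)" by (cases i) auto
    have c: "c \<in> A" and r: "0 < r" "cball y r \<subseteq> chart_img c" using I(2) i cyr by blast+
    have sub: "ball y (r / 2) \<subseteq> cball y r" using r(1) by auto
    obtain b where b: "\<And>x. x \<in> cball y r \<Longrightarrow> dens c x \<le> b"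
      using metric_bounds[OF c compact_cball r(2)] unfolding dens_def by metis
    have "ball y (r / 2) \<subseteq> chart_img c" using sub r(2) by blast
    note e = emeasure_vol_chart_inv_le[OF c _ this, of b]
    have "emeasure vol (chart_inv c ` ball y (r / 2)) \<le> ennreal b * emeasure lborel (ball y (r / 2))"
      using b sub by (intro e(2)) auto
    also have "\<dots> < \<infinity>"
      using emeasure_lborel_ball_finite[of y "r / 2"] by (simp add: ennreal_mult_less_top)
    finally have "emeasure vol (chart_inv c ` ball y (r / 2)) < \<infinity>" .
    moreover have "chart_inv c ` ball y (r / 2) \<in> sets borel"
      using b sub by (intro e(1)) auto
    ultimately show ?thesis by (simp add: cyr)
  qed
  have "emeasure vol (space vol) = emeasure vol (\<Union>i\<in>I. ?N i)"
    using I(3) by simp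
  also have "\<dots> \<le> (\<Sum>i\<in>I. emeasure vol (?N i))"
    using N by (intro emeasure_subadditive_finite I(1)) auto
  also have "\<dots> < \<infinity>" using N I(1) by (simp add: ennreal_sum_less_top less_top)
  finally show "emeasure vol (space vol) \<noteq> \<infinity>" by simp
qed

section \<open>Vector fields and gradients\<close>

text \<open>The algebraic half of \<open>vector_field\<close>: independence of
  \<open>norm_sq\<close> from the chart rests on the transformation law alone, so measurability is
  kept apart.\<close>

definition tensorial :: "('m, 'n) vfield \<Rightarrow> bool" where
  "tensorial X \<longleftrightarrow> (\<forall>c\<in>A. \<forall>d\<in>A. \<forall>p\<in>chart_dom c \<inter> chart_dom d. X d p = jacobian c d p *v X c p)"

lemma chart_at: "chart_at A p \<in> A" "p \<in> chart_dom (chart_at A p)"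
proof -
  have "\<exists>c. c \<in> A \<and> p \<in> chart_dom c" using chart_exists by blast
  then have "chart_at A p \<in> A \<and> p \<in> chart_dom (chart_at A p)" unfolding chart_at_def by (rule someI_ex)
  then show "chart_at A p \<in> A" "p \<in> chart_dom (chart_at A p)" by auto
qed

lemma norm_sq_chart_at: "norm_sq A g X p = X (chart_at A p) p \<bullet> (g (chart_at A p) p *v X (chart_at A p) p)"
  by (simp add: norm_sq_def Let_def)

text \<open>The Jacobian in the law for vectors cancels against the two Jacobians in the law for the
  metric; the arbitrary \<open>chart_at\<close> can be replaced by any convenient chart.\<close>

lemma norm_sq_chart:
  assumes X: "tensorial X" and c: "c \<in> A" "p \<in> chart_dom c"
  shows "norm_sq A g X p = X c p \<bullet> (g c p *v X c p)"
proof -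
  let ?d = "chart_at A p" let ?J = "jacobian c ?d p"
  have "X ?d p = ?J *v X c p"
    using X c chart_at unfolding tensorial_def by blast
  moreover have "g c p = transpose ?J ** g ?d p ** ?J"
    using c chart_at by (intro metric_transform)
  then have "g c p *v X c p = transpose ?J *v (g ?d p *v (?J *v X c p))"
    by (simp add: matrix_vector_mul_assoc matrix_mul_assoc del: transpose_matrix_vector)
  then have "X c p \<bullet> (g c p *v X c p) = (?J *v X c p) \<bullet> (g ?d p *v (?J *v X c p))"
    by (metis dot_lmul_matrix inner_commute transpose_matrix_vector)
  ultimately show ?thesis by (simp add: norm_sq_chart_at)
qed

lemma norm_sq_nonneg [simp]: "0 \<le> norm_sq A g X p"
  unfolding norm_sq_chart_at by (rule metric_nonneg[OF chart_at])

lemma norm_sq_eq_0_iff: "norm_sq A g X p = 0 \<longleftrightarrow> X (chart_at A p) p = 0"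
  unfolding norm_sq_chart_at using metric_pos[OF chart_at, of "X (chart_at A p) p" p]
  by (cases "X (chart_at A p) p = 0") simp_all

lemma norm_sq_cong:
  "X (chart_at A p) p = Y (chart_at A p) p \<Longrightarrow> norm_sq A g X p = norm_sq A g Y p"
  by (simp add: norm_sq_chart_at)

lemma norm_sq_scaleR:
  "norm_sq A g (\<lambda>c q. f q *\<^sub>R X c q) p = (f p)\<^sup>2 * norm_sq A g X p"
  by (simp add: norm_sq_chart_at matrix_vector_mult_scaleR power2_eq_square)

lemma norm_sq_uminus: "norm_sq A g (\<lambda>c q. - X c q) p = norm_sq A g X p"
  using norm_sq_scaleR[of "\<lambda>_. -1" X p] by simp

text \<open>Expand |X - Y|^2 >= 0. With its factor 2 this replaces the triangle inequality wherever
  squared norms only need to be small or bounded.\<close>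

lemma norm_sq_add_le:
  "norm_sq A g (\<lambda>c q. X c q + Y c q) p \<le> 2 * norm_sq A g X p + 2 * norm_sq A g Y p"
proof -
  let ?c = "chart_at A p"
  have "0 \<le> (X ?c p - Y ?c p) \<bullet> (g ?c p *v (X ?c p - Y ?c p))"
    by (rule metric_nonneg[OF chart_at])
  then show ?thesis
    using metric_sym_inner[OF chart_at, of "X ?c p" p "Y ?c p"]
    by (simp add: norm_sq_chart_at matrix_vector_mult_diff_distrib matrix_vector_right_distrib
        inner_add_left inner_add_right inner_diff_left inner_diff_right)
qed

lemma norm_sq_diff_le:
  "norm_sq A g (\<lambda>c q. X c q - Y c q) p \<le> 2 * norm_sq A g X p + 2 * norm_sq A g Y p"
  using norm_sq_add_le[of X "\<lambda>c q. - Y c q" p] by (simp add: norm_sq_uminus)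

lemma vector_field_diff:
  assumes "vector_field A X" "vector_field A Y"
  shows "vector_field A (\<lambda>c q. X c q - Y c q)"
  unfolding vector_field_def
proof (intro conjI ballI)
  show "(\<lambda>q. X c q - Y c q) \<in> borel_measurable (restrict_space borel (chart_dom c))" if "c \<in> A" for c
    using assms that unfolding vector_field_def by (intro borel_measurable_diff) blast+
  show "X d p - Y d p = jacobian c d p *v (X c p - Y c p)"
    if "c \<in> A" "d \<in> A" "p \<in> chart_dom c \<inter> chart_dom d" for c d p
  proof -
    have "X d p = jacobian c d p *v X c p" "Y d p = jacobian c d p *v Y c p"
      using assms that unfolding vector_field_def by blast+
    then show ?thesis by (simp only: matrix_vector_mult_diff_distrib)
  qed
qed

lemma vector_field_tensorial: "vector_field A X \<Longrightarrow> tensorial X"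
  unfolding vector_field_def tensorial_def by blast

lemma borel_measurable_local:
  assumes "\<And>c. c \<in> A \<Longrightarrow> f \<in> borel_measurable (restrict_space borel (chart_dom c))"
  shows "f \<in> borel_measurable borel"
proof -
  obtain F where F: "finite F" "F \<subseteq> A" "(\<Union>c\<in>F. chart_dom c) = UNIV" by (rule finite_subatlas)
  show ?thesis
  proof (rule measurable_piecewise_restrict[of "fst ` F"])
    show "f \<in> borel_measurable (restrict_space borel \<Omega>)" if "\<Omega> \<in> fst ` F" for \<Omega>
      using that assms F(2) by auto
    show "\<Omega> \<inter> space borel \<in> sets borel" if "\<Omega> \<in> fst ` F" for \<Omega>
    proof -
      obtain c where "c \<in> F" "\<Omega> = chart_dom c" using \<open>\<Omega> \<in> fst ` F\<close> by blast
      then show ?thesis using borel_dom[of c] F(2) by auto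
    qed
  qed (use F in \<open>auto intro: countable_finite\<close>)
qed

lemma borel_measurable_vec_nth_iff:
  fixes f :: "'x \<Rightarrow> real ^ 'k::finite"
  shows "f \<in> borel_measurable M \<longleftrightarrow> (\<forall>i. (\<lambda>x. f x $ i) \<in> borel_measurable M)"
proof
  show "\<forall>i. (\<lambda>x. f x $ i) \<in> borel_measurable M" if "f \<in> borel_measurable M"
    using that by (simp add: cart_eq_inner_axis)
  show "f \<in> borel_measurable M" if "\<forall>i. (\<lambda>x. f x $ i) \<in> borel_measurable M"
    unfolding borel_measurable_euclidean_space[of f M]
    using that by (auto simp: Basis_vec_def cart_eq_inner_axis)
qed

lemma measurable_norm_sq_chart:
  assumes c: "c \<in> A" and X: "X \<in> borel_measurable (restrict_space borel (chart_dom c))"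
  shows "(\<lambda>p. g c p *v X p) \<in> borel_measurable (restrict_space borel (chart_dom c))"
    and "(\<lambda>p. X p \<bullet> (g c p *v X p)) \<in> borel_measurable (restrict_space borel (chart_dom c))"
proof -
  have "continuous_on (chart_dom c) (\<lambda>p. g c p $ i $ j)" for i j
    by (intro continuous_intros continuous_on_metric_dom c)
  then have [measurable]: "(\<lambda>p. g c p $ i $ j) \<in> borel_measurable (restrict_space borel (chart_dom c))" for i j
    by (rule borel_measurable_continuous_on_restrict)
  have [measurable]: "(\<lambda>p. X p $ i) \<in> borel_measurable (restrict_space borel (chart_dom c))" for i
    using X borel_measurable_vec_nth_iff by blast
  show gX: "(\<lambda>p. g c p *v X p) \<in> borel_measurable (restrict_space borel (chart_dom c))"
    unfolding borel_measurable_vec_nth_iff matrix_vector_mult_def by simp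
  show "(\<lambda>p. X p \<bullet> (g c p *v X p)) \<in> borel_measurable (restrict_space borel (chart_dom c))"
    using X gX by (rule borel_measurable_inner)
qed

lemma measurable_norm_sq:
  assumes X: "vector_field A X"
  shows "norm_sq A g X \<in> borel_measurable borel"
proof (rule borel_measurable_local)
  fix c assume c: "c \<in> A"
  have "X c \<in> borel_measurable (restrict_space borel (chart_dom c))"
    using X c by (simp add: vector_field_def)
  then have "(\<lambda>p. X c p \<bullet> (g c p *v X c p)) \<in> borel_measurable (restrict_space borel (chart_dom c))"
    by (rule measurable_norm_sq_chart[OF c])
  then show "norm_sq A g X \<in> borel_measurable (restrict_space borel (chart_dom c))"
    by (rule measurable_cong[THEN iffD1, rotated])
       (simp add: space_restrict_space norm_sq_chart[OF vector_field_tensorial[OF X] c])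
qed

section \<open>Gradients of smooth functions\<close>

text \<open>The differential of u as a covector in the chart. \<open>grad\<close> raises its index,
  and \<open>metric_grad\<close> lowers it again, which keeps the inverse matrix out of the
  estimates.\<close>

definition dcoord :: "('m \<Rightarrow> real) \<Rightarrow> ('m, 'n) chart \<Rightarrow> 'm \<Rightarrow> real ^ 'n" where
  "dcoord u c p = (\<chi> j. frechet_derivative (u \<circ> chart_inv c) (at (snd c p)) (axis j 1))"

lemma grad_eq: "grad g u c p = matrix_inv (g c p) *v dcoord u c p"
  by (simp add: grad_def dcoord_def)

lemma metric_grad: "c \<in> A \<Longrightarrow> p \<in> chart_dom c \<Longrightarrow> g c p *v grad g u c p = dcoord u c p"
  using matrix_inv_mult(1)[of "g c p"] det_metric_pos[of c p]
  by (simp add: grad_eq matrix_vector_mul_assoc)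

lemma metric_inj:
  assumes "c \<in> A" "p \<in> chart_dom c" "g c p *v X = g c p *v Y"
  shows "X = Y"
  using metric_pos[OF assms(1,2), of "X - Y"] assms(3)
  by (auto simp: matrix_vector_mult_diff_distrib)

lemma smooth_fun_Ck: "smooth_fun A u \<Longrightarrow> c \<in> A \<Longrightarrow> Ck_on k (chart_img c) (u \<circ> chart_inv c)"
  by (simp add: smooth_fun_def smooth_on_def)

lemma smooth_fun_derivative:
  assumes u: "smooth_fun A u" and c: "c \<in> A" and p: "p \<in> chart_dom c"
  shows "((u \<circ> chart_inv c) has_derivative (\<lambda>v. dcoord u c p \<bullet> v)) (at (snd c p))"
proof -
  let ?D = "frechet_derivative (u \<circ> chart_inv c) (at (snd c p))"
  have D: "((u \<circ> chart_inv c) has_derivative ?D) (at (snd c p))"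
    using p by (intro Ck_on_has_derivative[OF smooth_fun_Ck[OF u c] open_img[OF c]]) auto
  have lin: "linear ?D" by (rule has_derivative_linear[OF D])
  have "?D v = dcoord u c p \<bullet> v" for v
  proof -
    have "?D v = ?D (\<Sum>i\<in>UNIV. v $ i *\<^sub>R axis i 1)"
      using basis_expansion[of v] by (simp add: scalar_mult_eq_scaleR)
    also have "\<dots> = (\<Sum>i\<in>UNIV. v $ i * ?D (axis i 1))"
      by (simp add: linear_sum[OF lin] linear_cmul[OF lin])
    also have "\<dots> = dcoord u c p \<bullet> v"
      by (simp add: dcoord_def inner_vec_def mult.commute)
    finally show ?thesis .
  qed
  then have "?D = (\<lambda>v. dcoord u c p \<bullet> v)" by (rule ext)
  then show ?thesis using D by simp
qed

lemma dcoord_eqI: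
  assumes "((u \<circ> chart_inv c) has_derivative (\<lambda>v. w \<bullet> v)) (at (snd c p))"
  shows "dcoord u c p = w"
  using frechet_derivative_at[OF assms, symmetric] by (simp add: dcoord_def vec_eq_iff inner_axis)

lemma dcoord_transform:
  assumes u: "smooth_fun A u" and c: "c \<in> A" "p \<in> chart_dom c" and d: "d \<in> A" "p \<in> chart_dom d"
  shows "dcoord u c p = transpose (jacobian c d p) *v dcoord u d p"
proof (rule dcoord_eqI)
  let ?S = "snd c ` (chart_dom d \<inter> chart_dom c)"
  have t: "transition c d (snd c p) = snd d p"
    by (simp add: transition_def chart_inv_chart[OF c])
  have "((\<lambda>x. (u \<circ> chart_inv d) (transition c d x)) has_derivative (\<lambda>v. dcoord u d p \<bullet> (jacobian c d p *v v))) (at (snd c p))"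
    by (rule has_derivative_compose[OF transition_derivative[OF c(1) d(1) c(2) d(2)]])
       (use smooth_fun_derivative[OF u d] t in \<open>simp add: o_def\<close>)
  then have "((u \<circ> chart_inv c) has_derivative (\<lambda>v. dcoord u d p \<bullet> (jacobian c d p *v v))) (at (snd c p))"
  proof (rule has_derivative_transform_within_open[where s = ?S])
    show "open ?S" by (rule open_chart_image[OF c(1) open_dom[OF d(1)]])
    show "(u \<circ> chart_inv d) (transition c d x) = (u \<circ> chart_inv c) x" if "x \<in> ?S" for x
      using that by (auto simp: transition_def chart_inv_chart[OF c(1)] chart_inv_chart[OF d(1)])
  qed (use c d in auto)
  moreover have "dcoord u d p \<bullet> (jacobian c d p *v v) = (transpose (jacobian c d p) *v dcoord u d p) \<bullet> v" for v
    by (simp add: dot_lmul_matrix)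
  ultimately show "((u \<circ> chart_inv c) has_derivative (\<lambda>v. (transpose (jacobian c d p) *v dcoord u d p) \<bullet> v)) (at (snd c p))"
    by simp
qed

text \<open>Metric and differential transform by the transposed Jacobian. This factor is invertible,
  so it cancels from the equation g grad u = du, and the metric in the second chart determines the
  gradient there.\<close>

lemma tensorial_grad:
  assumes u: "smooth_fun A u"
  shows "tensorial (grad g u)"
  unfolding tensorial_def
proof (intro ballI)
  fix c d p assume c: "c \<in> A" and d: "d \<in> A" and "p \<in> chart_dom c \<inter> chart_dom d"
  then have p: "p \<in> chart_dom c" "p \<in> chart_dom d" by auto
  let ?J = "jacobian c d p" let ?J' = "jacobian d c p"
  have JJ: "?J ** ?J' = mat 1" by (rule jacobian_inverse[OF d c p(2,1)])
  have "transpose ?J *v (g d p *v (?J *v grad g u c p)) = g c p *v grad g u c p"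
    unfolding metric_transform[OF c d p] by (simp add: matrix_vector_mul_assoc matrix_mul_assoc del: transpose_matrix_vector)
  also have "\<dots> = transpose ?J *v dcoord u d p"
    unfolding metric_grad[OF c p(1)] by (rule dcoord_transform[OF u c p(1) d p(2)])
  finally have "transpose ?J' *v (transpose ?J *v (g d p *v (?J *v grad g u c p))) = transpose ?J' *v (transpose ?J *v dcoord u d p)"
    by simp
  moreover have "transpose ?J' ** transpose ?J = mat 1"
    using JJ by (simp add: matrix_transpose_mul[symmetric])
  ultimately have "g d p *v (?J *v grad g u c p) = dcoord u d p"
    by (simp add: matrix_vector_mul_assoc matrix_mul_assoc del: transpose_matrix_vector)
  then have "g d p *v (?J *v grad g u c p) = g d p *v grad g u d p"
    by (simp add: metric_grad[OF d p(2)])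
  then show "grad g u d p = ?J *v grad g u c p"
    using metric_inj[OF d p(2)] by metis
qed

lemma continuous_on_dcoord:
  assumes u: "smooth_fun A u" and c: "c \<in> A"
  shows "continuous_on (chart_dom c) (dcoord u c)"
  unfolding dcoord_def
proof (intro continuous_intros)
  fix j :: 'n
  have "continuous_on (chart_img c) (\<lambda>x. frechet_derivative (u \<circ> chart_inv c) (at x) (axis j 1))"
    using smooth_fun_Ck[OF u c, of "Suc 0"] by simp
  then show "continuous_on (chart_dom c) (\<lambda>p. frechet_derivative (u \<circ> chart_inv c) (at (snd c p)) (axis j 1))"
    by (rule continuous_on_compose2[OF _ continuous_on_chart[OF c]]) simp
qed

text \<open>Cramer's rule writes the components as quotients of determinants of continuous matrices,
  so continuity of matrix inversion is not called upon.\<close>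

lemma continuous_on_grad:
  assumes u: "smooth_fun A u" and c: "c \<in> A"
  shows "continuous_on (chart_dom c) (grad g u c)"
proof -
  have "grad g u c p = (\<chi> k. det (\<chi> i j. if j = k then dcoord u c p $ i else g c p $ i $ j) / det (g c p))"
    if "p \<in> chart_dom c" for p
    using cramer[of "g c p" "grad g u c p" "dcoord u c p"] metric_grad[OF c that] det_metric_pos[OF c that] by simp
  moreover have "continuous_on (chart_dom c)
    (\<lambda>p. (\<chi> k. det (\<chi> i j. if j = k then dcoord u c p $ i else g c p $ i $ j) / det (g c p)) :: real ^ 'n)"
  proof (intro continuous_on_vec_lambda continuous_on_divide continuous_on_det continuous_on_metric_dom c)
    show "continuous_on (chart_dom c) (\<lambda>p. if j = k then dcoord u c p $ i else g c p $ i $ j)" for i j k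
      by (cases "j = k") (auto intro!: continuous_intros continuous_on_dcoord[OF u c] continuous_on_metric_dom[OF c])
    show "\<forall>p\<in>chart_dom c. det (g c p) \<noteq> 0" using det_metric_pos[OF c] by force
  qed
  ultimately show ?thesis by (subst continuous_on_cong[OF refl]) auto
qed

lemma vector_field_grad:
  assumes u: "smooth_fun A u"
  shows "vector_field A (grad g u)"
  using tensorial_grad[OF u] borel_measurable_continuous_on_restrict[OF continuous_on_grad[OF u]]
  unfolding vector_field_def tensorial_def by blast

lemma continuous_on_M_local:
  assumes "\<And>c. c \<in> A \<Longrightarrow> continuous_on (chart_dom c) f"
  shows "continuous_on (UNIV :: 'm set) f"
proof -
  have "continuous_on (\<Union>c\<in>A. chart_dom c) f"
    by (rule continuous_on_open_UN) (use assms open_dom in auto)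
  moreover have "(\<Union>c\<in>A. chart_dom c) = UNIV" using chart_exists by blast
  ultimately show ?thesis by simp
qed

lemma continuous_on_norm_sq_grad:
  assumes u: "smooth_fun A u"
  shows "continuous_on UNIV (norm_sq A g (grad g u))"
proof (rule continuous_on_M_local)
  fix c assume c: "c \<in> A"
  have "continuous_on (chart_dom c) (\<lambda>p. grad g u c p \<bullet> (g c p *v grad g u c p))"
    by (intro continuous_intros continuous_on_grad[OF u c] continuous_on_metric_dom[OF c])
  then show "continuous_on (chart_dom c) (norm_sq A g (grad g u))"
    by (rule continuous_on_eq) (simp add: norm_sq_chart[OF tensorial_grad[OF u] c])
qed

lemma continuous_on_smooth:
  assumes u: "smooth_fun A u"
  shows "continuous_on UNIV u"
proof (rule continuous_on_M_local)
  fix c assume c: "c \<in> A"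
  have "continuous_on (chart_dom c) (\<lambda>p. (u \<circ> chart_inv c) (snd c p))"
    by (rule continuous_on_compose2[OF Ck_on_imp_continuous_on[OF smooth_fun_Ck[OF u c]] continuous_on_chart[OF c]]) simp
  then show "continuous_on (chart_dom c) u"
    by (rule continuous_on_eq) (simp add: chart_inv_chart[OF c])
qed

lemma integrable_continuous_M:
  fixes f :: "'m \<Rightarrow> real"
  assumes "continuous_on UNIV f"
  shows "integrable vol f"
proof -
  interpret finite_measure vol by (rule finite_measure_vol)
  have "bounded (range f)"
    using compact_M assms by (intro compact_imp_bounded compact_continuous_image)
  then obtain B where "\<And>p. norm (f p) \<le> B" unfolding bounded_iff by auto
  then show ?thesis
    using assms by (intro integrable_const_bound[of _ B]) (auto intro: borel_measurable_continuous_onI)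
qed

section \<open>The Sobolev space\<close>

lemma L2_fun_smooth: "smooth_fun A u \<Longrightarrow> L2_fun A g u"
  unfolding L2_fun_def
  by (intro conjI borel_measurable_continuous_onI integrable_continuous_M continuous_on_power continuous_on_smooth)

lemma L2_field_grad: "smooth_fun A u \<Longrightarrow> L2_field A g (grad g u)"
  unfolding L2_field_def
  by (intro conjI vector_field_grad integrable_continuous_M continuous_on_norm_sq_grad)

lemma norm_sq_zero [simp]: "norm_sq A g (\<lambda>c q. 0) = (\<lambda>p. 0)"
  by (simp add: norm_sq_chart_at fun_eq_iff)

lemma has_sobolev_grad_smooth:
  assumes "smooth_fun A u"
  shows "has_sobolev_grad A g u (grad g u)"
  unfolding has_sobolev_grad_def
  using L2_fun_smooth[OF assms] L2_field_grad[OF assms] assms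
  by (intro conjI exI[of _ "\<lambda>_. u"] allI) simp_all

lemma square_add_le: "(a + b)\<^sup>2 \<le> 2 * a\<^sup>2 + 2 * (b::real)\<^sup>2"
  using zero_le_power2[of "a - b"] by (simp add: power2_sum power2_diff)

lemma square_diff_le: "(a - b)\<^sup>2 \<le> 2 * a\<^sup>2 + 2 * (b::real)\<^sup>2"
  using square_add_le[of a "- b"] by simp

lemma L2_fun_diff:
  assumes "L2_fun A g u" "L2_fun A g v"
  shows "L2_fun A g (\<lambda>p. u p - v p)"
proof -
  have [measurable]: "u \<in> borel_measurable borel" "v \<in> borel_measurable borel"
    using assms by (auto simp: L2_fun_def)
  have "integrable vol (\<lambda>p. (u p - v p)\<^sup>2)"
  proof (rule Bochner_Integration.integrable_bound[of _ "\<lambda>p. 2 * (u p)\<^sup>2 + 2 * (v p)\<^sup>2"])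
    show "integrable vol (\<lambda>p. 2 * (u p)\<^sup>2 + 2 * (v p)\<^sup>2)" using assms by (simp add: L2_fun_def)
  qed (use square_diff_le in auto)
  then show ?thesis by (simp add: L2_fun_def)
qed

lemma L2_field_diff:
  assumes "L2_field A g X" "L2_field A g Y"
  shows "L2_field A g (\<lambda>c q. X c q - Y c q)"
proof -
  have vf: "vector_field A (\<lambda>c q. X c q - Y c q)"
    using assms by (intro vector_field_diff) (auto simp: L2_field_def)
  have "integrable vol (norm_sq A g (\<lambda>c q. X c q - Y c q))"
  proof (rule Bochner_Integration.integrable_bound[of _ "\<lambda>p. 2 * norm_sq A g X p + 2 * norm_sq A g Y p"])
    show "integrable vol (\<lambda>p. 2 * norm_sq A g X p + 2 * norm_sq A g Y p)" using assms by (simp add: L2_field_def)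
    show "AE p in vol. norm (norm_sq A g (\<lambda>c q. X c q - Y c q) p) \<le> norm (2 * norm_sq A g X p + 2 * norm_sq A g Y p)"
      using norm_sq_diff_le by (intro AE_I2) simp
  qed (use measurable_norm_sq[OF vf] in simp)
  with vf show ?thesis by (simp add: L2_field_def)
qed

lemma smooth_fun_diff:
  assumes "smooth_fun A u" "smooth_fun A v"
  shows "smooth_fun A (\<lambda>p. u p - v p)"
  unfolding smooth_fun_def smooth_on_def o_def
proof (intro ballI allI)
  fix c k assume c: "c \<in> A"
  show "Ck_on k (chart_img c) (\<lambda>x. u (chart_inv c x) - v (chart_inv c x))"
    by (rule Ck_on_diff[OF open_img[OF c] smooth_fun_Ck[OF assms(1) c, unfolded o_def]
          smooth_fun_Ck[OF assms(2) c, unfolded o_def]])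
qed

lemma smooth_fun_mult:
  assumes "smooth_fun A u" "smooth_fun A v"
  shows "smooth_fun A (\<lambda>p. u p * v p)"
  unfolding smooth_fun_def smooth_on_def o_def
proof (intro ballI allI)
  fix c k assume c: "c \<in> A"
  show "Ck_on k (chart_img c) (\<lambda>x. u (chart_inv c x) * v (chart_inv c x))"
    by (rule Ck_on_mult[OF open_img[OF c] smooth_fun_Ck[OF assms(1) c, unfolded o_def]
          smooth_fun_Ck[OF assms(2) c, unfolded o_def]])
qed

lemma smooth_fun_const: "smooth_fun A (\<lambda>p. k)"
  unfolding smooth_fun_def smooth_on_def o_def by (intro ballI allI Ck_on_const open_img)

lemma grad_diff:
  assumes "smooth_fun A u" "smooth_fun A v" "c \<in> A" "p \<in> chart_dom c"
  shows "grad g (\<lambda>p. u p - v p) c p = grad g u c p - grad g v c p"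
proof -
  have "dcoord (\<lambda>p. u p - v p) c p = dcoord u c p - dcoord v c p"
    by (rule dcoord_eqI)
       (use has_derivative_diff[OF smooth_fun_derivative[OF assms(1,3,4)] smooth_fun_derivative[OF assms(2,3,4)]]
         in \<open>simp add: o_def inner_diff_left\<close>)
  then show ?thesis by (simp add: grad_eq matrix_vector_mult_diff_distrib)
qed

lemma grad_mult:
  assumes "smooth_fun A u" "smooth_fun A v" "c \<in> A" "p \<in> chart_dom c"
  shows "grad g (\<lambda>p. u p * v p) c p = u p *\<^sub>R grad g v c p + v p *\<^sub>R grad g u c p"
proof -
  have "dcoord (\<lambda>p. u p * v p) c p = u p *\<^sub>R dcoord v c p + v p *\<^sub>R dcoord u c p"
    by (rule dcoord_eqI)
       (use has_derivative_mult[OF smooth_fun_derivative[OF assms(1,3,4)] smooth_fun_derivative[OF assms(2,3,4)]]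
         in \<open>simp add: o_def inner_add_left chart_inv_chart[OF assms(3,4)] mult.commute\<close>)
  then show ?thesis by (simp add: grad_eq matrix_vector_right_distrib matrix_vector_mult_scaleR)
qed

text \<open>Differences of the approximating sequences approximate the difference. The result serves
  twice: for uniqueness of gradients and for the increments of a path.\<close>

lemma has_sobolev_grad_diff:
  assumes u: "has_sobolev_grad A g u X" and v: "has_sobolev_grad A g v Y"
  shows "has_sobolev_grad A g (\<lambda>p. u p - v p) (\<lambda>c q. X c q - Y c q)"
proof -
  obtain U where U: "\<And>k. smooth_fun A (U k)" "(\<lambda>k. \<integral>p. (U k p - u p)\<^sup>2 \<partial>vol) \<longlonglongrightarrow> 0"
    "(\<lambda>k. \<integral>p. norm_sq A g (\<lambda>c q. grad g (U k) c q - X c q) p \<partial>vol) \<longlonglongrightarrow> 0"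
    using u unfolding has_sobolev_grad_def by blast
  obtain W where W: "\<And>k. smooth_fun A (W k)" "(\<lambda>k. \<integral>p. (W k p - v p)\<^sup>2 \<partial>vol) \<longlonglongrightarrow> 0"
    "(\<lambda>k. \<integral>p. norm_sq A g (\<lambda>c q. grad g (W k) c q - Y c q) p \<partial>vol) \<longlonglongrightarrow> 0"
    using v unfolding has_sobolev_grad_def by blast
  have L2: "L2_fun A g u" "L2_fun A g v" "L2_field A g X" "L2_field A g Y"
    using u v unfolding has_sobolev_grad_def by auto
  have i1: "integrable vol (\<lambda>p. (U k p - u p)\<^sup>2)" "integrable vol (\<lambda>p. (W k p - v p)\<^sup>2)" for k
    using L2_fun_diff[OF L2_fun_smooth[OF U(1)] L2(1)] L2_fun_diff[OF L2_fun_smooth[OF W(1)] L2(2)]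
    by (simp_all add: L2_fun_def)
  have i2: "integrable vol (norm_sq A g (\<lambda>c q. grad g (U k) c q - X c q))"
    "integrable vol (norm_sq A g (\<lambda>c q. grad g (W k) c q - Y c q))" for k
    using L2_field_diff[OF L2_field_grad[OF U(1)] L2(3)] L2_field_diff[OF L2_field_grad[OF W(1)] L2(4)]
    by (simp_all add: L2_field_def)
  define Z where "Z = (\<lambda>k p. U k p - W k p)"
  have Z: "smooth_fun A (Z k)" for k unfolding Z_def by (rule smooth_fun_diff[OF U(1) W(1)])
  have L2d: "L2_fun A g (\<lambda>p. u p - v p)" "L2_field A g (\<lambda>c q. X c q - Y c q)"
    by (rule L2_fun_diff[OF L2(1,2)], rule L2_field_diff[OF L2(3,4)])
  have i3: "integrable vol (\<lambda>p. (Z k p - (u p - v p))\<^sup>2)" for k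
    using L2_fun_diff[OF L2_fun_smooth[OF Z] L2d(1)] by (simp add: L2_fun_def)
  have i4: "integrable vol (norm_sq A g (\<lambda>c q. grad g (Z k) c q - (X c q - Y c q)))" for k
    using L2_field_diff[OF L2_field_grad[OF Z] L2d(2)] by (simp add: L2_field_def)
  have "(\<lambda>k. \<integral>p. (Z k p - (u p - v p))\<^sup>2 \<partial>vol) \<longlonglongrightarrow> 0"
  proof (rule tendsto_sandwich[OF _ _ tendsto_const])
    have "(\<lambda>k. 2 * (\<integral>p. (U k p - u p)\<^sup>2 \<partial>vol) + 2 * (\<integral>p. (W k p - v p)\<^sup>2 \<partial>vol)) \<longlonglongrightarrow> 2 * 0 + 2 * 0"
      by (intro tendsto_intros U W)
    then show "(\<lambda>k. 2 * (\<integral>p. (U k p - u p)\<^sup>2 \<partial>vol) + 2 * (\<integral>p. (W k p - v p)\<^sup>2 \<partial>vol)) \<longlonglongrightarrow> 0" by simp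
    show "\<forall>\<^sub>F k in sequentially. (\<integral>p. (Z k p - (u p - v p))\<^sup>2 \<partial>vol)
        \<le> 2 * (\<integral>p. (U k p - u p)\<^sup>2 \<partial>vol) + 2 * (\<integral>p. (W k p - v p)\<^sup>2 \<partial>vol)"
    proof (intro always_eventually allI)
      fix k
      have "(\<integral>p. (Z k p - (u p - v p))\<^sup>2 \<partial>vol) \<le> (\<integral>p. 2 * (U k p - u p)\<^sup>2 + 2 * (W k p - v p)\<^sup>2 \<partial>vol)"
      proof (intro integral_mono i3)
        show "(Z k p - (u p - v p))\<^sup>2 \<le> 2 * (U k p - u p)\<^sup>2 + 2 * (W k p - v p)\<^sup>2" for p
          using square_diff_le[of "U k p - u p" "W k p - v p"] by (simp add: Z_def algebra_simps)
      qed (use i1 in simp)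
      then show "(\<integral>p. (Z k p - (u p - v p))\<^sup>2 \<partial>vol) \<le> 2 * (\<integral>p. (U k p - u p)\<^sup>2 \<partial>vol) + 2 * (\<integral>p. (W k p - v p)\<^sup>2 \<partial>vol)"
        using i1 by simp
    qed
  qed simp
  moreover have "(\<lambda>k. \<integral>p. norm_sq A g (\<lambda>c q. grad g (Z k) c q - (X c q - Y c q)) p \<partial>vol) \<longlonglongrightarrow> 0"
  proof (rule tendsto_sandwich[OF _ _ tendsto_const])
    let ?a = "\<lambda>k p. norm_sq A g (\<lambda>c q. grad g (U k) c q - X c q) p"
    let ?b = "\<lambda>k p. norm_sq A g (\<lambda>c q. grad g (W k) c q - Y c q) p"
    have "(\<lambda>k. 2 * (\<integral>p. ?a k p \<partial>vol) + 2 * (\<integral>p. ?b k p \<partial>vol)) \<longlonglongrightarrow> 2 * 0 + 2 * 0"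
      by (intro tendsto_intros U W)
    then show "(\<lambda>k. 2 * (\<integral>p. ?a k p \<partial>vol) + 2 * (\<integral>p. ?b k p \<partial>vol)) \<longlonglongrightarrow> 0" by simp
    show "\<forall>\<^sub>F k in sequentially. (\<integral>p. norm_sq A g (\<lambda>c q. grad g (Z k) c q - (X c q - Y c q)) p \<partial>vol)
       \<le> 2 * (\<integral>p. ?a k p \<partial>vol) + 2 * (\<integral>p. ?b k p \<partial>vol)"
    proof (intro always_eventually allI)
      fix k
      have "norm_sq A g (\<lambda>c q. grad g (Z k) c q - (X c q - Y c q)) p \<le> 2 * ?a k p + 2 * ?b k p" for p
      proof -
        have "norm_sq A g (\<lambda>c q. grad g (Z k) c q - (X c q - Y c q)) p
           = norm_sq A g (\<lambda>c q. (grad g (U k) c q - X c q) - (grad g (W k) c q - Y c q)) p"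
          unfolding Z_def by (rule norm_sq_cong) (simp add: grad_diff[OF U(1) W(1) chart_at] algebra_simps)
        then show ?thesis using norm_sq_diff_le by simp
      qed
      then have "(\<integral>p. norm_sq A g (\<lambda>c q. grad g (Z k) c q - (X c q - Y c q)) p \<partial>vol) \<le> (\<integral>p. 2 * ?a k p + 2 * ?b k p \<partial>vol)"
        using i2 by (intro integral_mono i4) auto
      then show "(\<integral>p. norm_sq A g (\<lambda>c q. grad g (Z k) c q - (X c q - Y c q)) p \<partial>vol) \<le> 2 * (\<integral>p. ?a k p \<partial>vol) + 2 * (\<integral>p. ?b k p \<partial>vol)"
        using i2 by simp
    qed
  qed (simp add: integral_nonneg_AE)
  ultimately show ?thesis
    unfolding has_sobolev_grad_def using L2d Z by blast
qed

section \<open>Estimates in coordinates and uniqueness of the Sobolev gradient\<close>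

text \<open>A version of u composed with the inverse chart that is Borel on the whole space, for use
  under integrals restricted to subsets of the chart image.\<close>

definition pull :: "('m, 'n) chart \<Rightarrow> ('m \<Rightarrow> 'b) \<Rightarrow> real ^ 'n \<Rightarrow> 'b" where
  "pull c u x = u (if x \<in> chart_img c then chart_inv c x else undefined)"

lemma pull_eq: "x \<in> chart_img c \<Longrightarrow> pull c u x = u (chart_inv c x)"
  by (simp add: pull_def)

lemma measurable_pull:
  assumes "c \<in> A" "u \<in> borel_measurable borel"
  shows "pull c u \<in> borel_measurable borel"
  using measurable_compose[OF measurable_chart_inv[OF assms(1)] assms(2)]
  by (simp add: pull_def[abs_def])

lemma nn_integral_pull_le:
  assumes c: "c \<in> A" and K: "K \<in> sets borel" "K \<subseteq> chart_img c" and a: "0 < a"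
    and dens: "\<And>x. x \<in> K \<Longrightarrow> a \<le> dens c x" and f: "f \<in> borel_measurable borel"
  shows "(\<integral>\<^sup>+x\<in>K. f (chart_inv c x) \<partial>lborel) \<le> ennreal (1 / a) * (\<integral>\<^sup>+p. f p \<partial>vol)"
proof -
  have "ennreal (1 / a) * ennreal a = 1"
    using a by (simp add: ennreal_mult[symmetric])
  then have "(\<integral>\<^sup>+x\<in>K. f (chart_inv c x) \<partial>lborel) = ennreal (1 / a) * (ennreal a * (\<integral>\<^sup>+x\<in>K. f (chart_inv c x) \<partial>lborel))"
    by (simp add: mult.assoc[symmetric])
  also have "\<dots> \<le> ennreal (1 / a) * (\<integral>\<^sup>+p. f p \<partial>vol)"
    by (intro mult_left_mono nn_integral_chart_le[OF c K dens f]) auto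
  finally show ?thesis .
qed

text \<open>L^2 convergence on \<open>M\<close> gives L^1 convergence because the volume is finite,
  and L^1 convergence in coordinates because the density is at least a on \<open>K\<close>.\<close>

lemma chart_L1_tendsto_0:
  fixes f :: "'i \<Rightarrow> 'm \<Rightarrow> real"
  assumes c: "c \<in> A" and K: "K \<in> sets borel" "K \<subseteq> chart_img c" and a: "0 < a"
    and dens: "\<And>x. x \<in> K \<Longrightarrow> a \<le> dens c x"
    and f: "\<And>i. f i \<in> borel_measurable borel" "\<And>i. integrable vol (\<lambda>p. (f i p)\<^sup>2)"
    and lim: "((\<lambda>i. \<integral>p. (f i p)\<^sup>2 \<partial>vol) \<longlongrightarrow> 0) F"
  shows "((\<lambda>i. \<integral>\<^sup>+x\<in>K. ennreal \<bar>f i (chart_inv c x)\<bar> \<partial>lborel) \<longlongrightarrow> 0) F"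
proof (rule tendsto_sandwich[OF _ _ tendsto_const])
  have l: "((\<lambda>i. \<integral>p. \<bar>f i p\<bar> \<partial>vol) \<longlongrightarrow> 0) F"
    using integral_abs_tendsto_0[OF finite_measure_vol _ f(2) lim] f(1) by simp
  have "((\<lambda>i. ennreal (1 / a) * ennreal (\<integral>p. \<bar>f i p\<bar> \<partial>vol)) \<longlongrightarrow> ennreal (1 / a) * ennreal 0) F"
    by (intro ennreal_tendsto_cmult tendsto_ennrealI l) simp
  then show "((\<lambda>i. ennreal (1 / a) * ennreal (\<integral>p. \<bar>f i p\<bar> \<partial>vol)) \<longlongrightarrow> 0) F" by simp
  show "\<forall>\<^sub>F i in F. (\<integral>\<^sup>+x\<in>K. ennreal \<bar>f i (chart_inv c x)\<bar> \<partial>lborel) \<le> ennreal (1 / a) * ennreal (\<integral>p. \<bar>f i p\<bar> \<partial>vol)"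
  proof (intro always_eventually allI)
    fix i
    have "integrable vol (f i)"
      by (rule integral_abs_le_sqrt_integral_square(1)[OF finite_measure_vol _ f(2)]) (simp add: f(1))
    then have "ennreal (\<integral>p. \<bar>f i p\<bar> \<partial>vol) = (\<integral>\<^sup>+p. ennreal \<bar>f i p\<bar> \<partial>vol)"
      by (intro nn_integral_eq_integral[symmetric]) auto
    then show "(\<integral>\<^sup>+x\<in>K. ennreal \<bar>f i (chart_inv c x)\<bar> \<partial>lborel) \<le> ennreal (1 / a) * ennreal (\<integral>p. \<bar>f i p\<bar> \<partial>vol)"
      using nn_integral_pull_le[OF c K a dens, of "\<lambda>p. ennreal \<bar>f i p\<bar>"] f(1)[of i] by simp
  qed
qed simp

text \<open>Compares the Euclidean length of the covector gX, whose entries are partial derivatives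
  when X is a gradient, with the Riemannian length of X: b bounds |gX| by |X|, and 1 / sqrt a bounds
  |X| by |X|_g.\<close>

lemma norm_covector_le:
  assumes X: "tensorial X" and c: "c \<in> A" "p \<in> chart_dom c" and ab: "0 < a" "0 < b"
    "a * (norm (X c p))\<^sup>2 \<le> X c p \<bullet> (g c p *v X c p)" "norm (g c p *v X c p) \<le> b * norm (X c p)"
  shows "norm (g c p *v X c p) \<le> b / sqrt a * sqrt (norm_sq A g X p)"
proof -
  have "sqrt (a * (norm (X c p))\<^sup>2) \<le> sqrt (norm_sq A g X p)"
    unfolding norm_sq_chart[OF X c] by (rule real_sqrt_le_mono[OF ab(3)])
  then have "sqrt a * norm (X c p) \<le> sqrt (norm_sq A g X p)"
    by (simp add: real_sqrt_mult)
  then have "norm (X c p) \<le> sqrt (norm_sq A g X p) / sqrt a"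
    using ab(1) by (simp add: field_simps)
  then have "b * norm (X c p) \<le> b * (sqrt (norm_sq A g X p) / sqrt a)"
    using ab(2) by (intro mult_left_mono) auto
  then show ?thesis using ab(4) by (simp add: field_simps)
qed

text \<open>Closability concerns partial derivatives, so the index of Z is lowered first: the
  partial derivatives of v_k are the entries of g grad v_k, and they converge in L^1 to those of gZ.
  Since v_k tends to 0, gZ vanishes and then so does Z.\<close>

lemma weak_gradient_zero_chart:
  assumes Z: "L2_field A g Z" and v: "\<And>k. smooth_fun A (v k)"
    and lim1: "(\<lambda>k. \<integral>p. (v k p)\<^sup>2 \<partial>vol) \<longlonglongrightarrow> 0"
    and lim2: "(\<lambda>k. \<integral>p. norm_sq A g (\<lambda>c q. grad g (v k) c q - Z c q) p \<partial>vol) \<longlonglongrightarrow> 0"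
    and c: "c \<in> A" and K: "cbox L H \<subseteq> chart_img c"
  shows "AE x in lborel. x \<in> box L H \<longrightarrow> Z c (chart_inv c x) = 0"
proof -
  let ?K = "cbox L H"
  obtain a b where ab: "0 < a" "0 < b"
    "\<And>x v. x \<in> ?K \<Longrightarrow> a * (norm v)\<^sup>2 \<le> v \<bullet> (g c (chart_inv c x) *v v)"
    "\<And>x v. x \<in> ?K \<Longrightarrow> norm (g c (chart_inv c x) *v v) \<le> b * norm v"
    "\<And>x. x \<in> ?K \<Longrightarrow> a \<le> dens c x"
    using metric_bounds[OF c compact_cbox K] unfolding dens_def by metis
  define N where "N = (\<lambda>k. norm_sq A g (\<lambda>c q. grad g (v k) c q - Z c q))"
  \<comment> \<open>The components of Z with lowered index, the expected limits of the partial
    derivatives.\<close>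
  define \<xi> where "\<xi> = (\<lambda>j x. (g c (chart_inv c x) *v Z c (chart_inv c x)) $ j)"
  have Kb: "?K \<in> sets borel" by simp
  have vZ: "L2_field A g (\<lambda>c q. grad g (v k) c q - Z c q)" for k
    by (rule L2_field_diff[OF L2_field_grad[OF v] Z])
  have tens: "tensorial (\<lambda>c q. grad g (v k) c q - Z c q)" for k
    using vZ[of k] by (intro vector_field_tensorial) (simp add: L2_field_def)
  have N: "N k \<in> borel_measurable borel" "integrable vol (N k)" for k
    using vZ[of k] measurable_norm_sq by (auto simp: N_def L2_field_def)
  have N0: "0 \<le> N k p" for k p by (simp add: N_def)
  have lN: "(\<lambda>k. \<integral>\<^sup>+x\<in>?K. ennreal \<bar>sqrt (N k (chart_inv c x))\<bar> \<partial>lborel) \<longlonglongrightarrow> 0"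
    using c Kb K ab(1,5)
  proof (rule chart_L1_tendsto_0[where f = "\<lambda>k p. sqrt (N k p)"])
    show "(\<lambda>k. \<integral>p. (sqrt (N k p))\<^sup>2 \<partial>vol) \<longlonglongrightarrow> 0"
      using lim2 N0 by (simp add: N_def)
    show "(\<lambda>p. sqrt (N k p)) \<in> borel_measurable borel" for k using N(1) by measurable
    show "integrable vol (\<lambda>p. (sqrt (N k p))\<^sup>2)" for k using N(2) N0 by simp
  qed
  have lv: "(\<lambda>k. \<integral>\<^sup>+x\<in>?K. ennreal \<bar>(v k \<circ> chart_inv c) x\<bar> \<partial>lborel) \<longlonglongrightarrow> 0"
    unfolding o_def using c Kb K ab(1,5)
  proof (rule chart_L1_tendsto_0[OF _ _ _ _ _ _ _ lim1])
    show "v k \<in> borel_measurable borel" "integrable vol (\<lambda>p. (v k p)\<^sup>2)" for k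
      using L2_fun_smooth[OF v[of k]] by (auto simp: L2_fun_def)
  qed
  have zero: "AE x in lborel. x \<in> box L H \<longrightarrow> \<xi> j x = 0" for j
  proof (rule directional_derivative_closable[where v = "\<lambda>k. v k \<circ> chart_inv c" and b = "axis j 1", OF open_img[OF c] K smooth_fun_Ck[OF v c] _ lv])
    have "Z c \<in> borel_measurable (restrict_space borel (chart_dom c))"
      using Z c unfolding L2_field_def vector_field_def by blast
    then have "(\<lambda>p. g c p *v Z c p) \<in> borel_measurable (restrict_space borel (chart_dom c))"
      by (rule measurable_norm_sq_chart(1)[OF c])
    \<comment> \<open>Zero off the chart domain makes the covector Borel on all of \<open>M\<close>,
      as \<open>measurable_pull\<close> demands.\<close>
    then have m: "(\<lambda>p. indicator (chart_dom c) p *\<^sub>R (g c p *v Z c p)) \<in> borel_measurable borel"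
      using borel_dom[OF c] by (subst (asm) borel_measurable_restrict_space_iff) auto
    have "(\<lambda>x. indicator ?K x * pull c (\<lambda>p. indicator (chart_dom c) p *\<^sub>R (g c p *v Z c p)) x $ j) \<in> borel_measurable borel"
      using measurable_pull[OF c m] borel_measurable_vec_nth_iff by (intro borel_measurable_times) auto
    moreover have "(\<lambda>x. indicator ?K x * pull c (\<lambda>p. indicator (chart_dom c) p *\<^sub>R (g c p *v Z c p)) x $ j) = (\<lambda>x. indicator ?K x * \<xi> j x)"
    proof
      fix x
      show "indicator ?K x * pull c (\<lambda>p. indicator (chart_dom c) p *\<^sub>R (g c p *v Z c p)) x $ j = indicator ?K x * \<xi> j x"
      proof (cases "x \<in> ?K")
        case True
        then have "x \<in> chart_img c" using K by blast
        then show ?thesis using True chart_inv_dom[OF c] by (simp add: pull_eq \<xi>_def)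
      qed simp
    qed
    ultimately show "(\<lambda>x. indicator ?K x * \<xi> j x) \<in> borel_measurable borel" by simp
    show "(\<lambda>k. \<integral>\<^sup>+x\<in>?K. ennreal \<bar>frechet_derivative (v k \<circ> chart_inv c) (at x) (axis j 1) - \<xi> j x\<bar> \<partial>lborel) \<longlonglongrightarrow> 0"
    proof (rule tendsto_sandwich[OF _ _ tendsto_const])
      have "(\<lambda>k. ennreal (b / sqrt a) * (\<integral>\<^sup>+x\<in>?K. ennreal \<bar>sqrt (N k (chart_inv c x))\<bar> \<partial>lborel)) \<longlonglongrightarrow> ennreal (b / sqrt a) * 0"
        by (intro ennreal_tendsto_cmult lN) simp
      then show "(\<lambda>k. ennreal (b / sqrt a) * (\<integral>\<^sup>+x\<in>?K. ennreal \<bar>sqrt (N k (chart_inv c x))\<bar> \<partial>lborel)) \<longlonglongrightarrow> 0" by simp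
      show "\<forall>\<^sub>F k in sequentially. (\<integral>\<^sup>+x\<in>?K. ennreal \<bar>frechet_derivative (v k \<circ> chart_inv c) (at x) (axis j 1) - \<xi> j x\<bar> \<partial>lborel)
         \<le> ennreal (b / sqrt a) * (\<integral>\<^sup>+x\<in>?K. ennreal \<bar>sqrt (N k (chart_inv c x))\<bar> \<partial>lborel)"
      proof (intro always_eventually allI)
        fix k
        have pt: "\<bar>frechet_derivative (v k \<circ> chart_inv c) (at x) (axis j 1) - \<xi> j x\<bar> \<le> b / sqrt a * sqrt (N k (chart_inv c x))"
          if x: "x \<in> ?K" for x
        proof -
          define p where "p = chart_inv c x"
          have xi: "x \<in> chart_img c" using x K by blast
          then have p: "p \<in> chart_dom c" "snd c p = x"
            by (simp_all add: p_def chart_inv_dom[OF c] chart_chart_inv[OF c])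
          have "frechet_derivative (v k \<circ> chart_inv c) (at x) (axis j 1) = (g c p *v grad g (v k) c p) $ j"
            unfolding metric_grad[OF c p(1)] by (simp add: dcoord_def p(2))
          then have "\<bar>frechet_derivative (v k \<circ> chart_inv c) (at x) (axis j 1) - \<xi> j x\<bar>
             = \<bar>(g c p *v (grad g (v k) c p - Z c p)) $ j\<bar>"
            by (simp add: \<xi>_def p_def matrix_vector_mult_diff_distrib)
          also have "\<dots> \<le> norm (g c p *v (grad g (v k) c p - Z c p))" by (rule component_le_norm_cart)
          also have "\<dots> \<le> b / sqrt a * sqrt (N k p)"
            unfolding N_def by (rule norm_covector_le[OF tens c p(1) ab(1,2)]) (use ab(3,4)[OF x] in \<open>simp_all add: p_def\<close>)
          finally show ?thesis by (simp add: p_def)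
        qed
        have [measurable]: "pull c (N k) \<in> borel_measurable borel" by (rule measurable_pull[OF c N(1)])
        have bd: "ennreal (b / sqrt a) * (ennreal \<bar>sqrt (N k (chart_inv c x))\<bar> * indicator ?K x)
          = ennreal (b / sqrt a) * (ennreal \<bar>sqrt (pull c (N k) x)\<bar> * indicator ?K x)" for x
          using K by (auto simp: indicator_def pull_eq subset_iff)
        have "(\<integral>\<^sup>+x\<in>?K. ennreal \<bar>frechet_derivative (v k \<circ> chart_inv c) (at x) (axis j 1) - \<xi> j x\<bar> \<partial>lborel)
          \<le> (\<integral>\<^sup>+x. ennreal (b / sqrt a) * (ennreal \<bar>sqrt (N k (chart_inv c x))\<bar> * indicator ?K x) \<partial>lborel)"
        proof (intro nn_integral_mono)
          fix x
          show "ennreal \<bar>frechet_derivative (v k \<circ> chart_inv c) (at x) (axis j 1) - \<xi> j x\<bar> * indicator ?K x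
            \<le> ennreal (b / sqrt a) * (ennreal \<bar>sqrt (N k (chart_inv c x))\<bar> * indicator ?K x)"
          proof (cases "x \<in> ?K")
            case True
            have "ennreal \<bar>frechet_derivative (v k \<circ> chart_inv c) (at x) (axis j 1) - \<xi> j x\<bar>
              \<le> ennreal (b / sqrt a * sqrt (N k (chart_inv c x)))"
              by (rule ennreal_leI[OF pt[OF True]])
            also have "\<dots> = ennreal (b / sqrt a) * ennreal \<bar>sqrt (N k (chart_inv c x))\<bar>"
              using N0 ab(1,2) by (subst ennreal_mult) auto
            finally show ?thesis using True by simp
          qed simp
        qed
        also have "\<dots> = ennreal (b / sqrt a) * (\<integral>\<^sup>+x. ennreal \<bar>sqrt (pull c (N k) x)\<bar> * indicator ?K x \<partial>lborel)"
          unfolding bd by (rule nn_integral_cmult) measurable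
        also have "(\<integral>\<^sup>+x. ennreal \<bar>sqrt (pull c (N k) x)\<bar> * indicator ?K x \<partial>lborel) = (\<integral>\<^sup>+x\<in>?K. ennreal \<bar>sqrt (N k (chart_inv c x))\<bar> \<partial>lborel)"
          using K by (intro nn_integral_cong) (auto simp: indicator_def pull_eq subset_iff)
        finally show "(\<integral>\<^sup>+x\<in>?K. ennreal \<bar>frechet_derivative (v k \<circ> chart_inv c) (at x) (axis j 1) - \<xi> j x\<bar> \<partial>lborel)
          \<le> ennreal (b / sqrt a) * (\<integral>\<^sup>+x\<in>?K. ennreal \<bar>sqrt (N k (chart_inv c x))\<bar> \<partial>lborel)" .
      qed
    qed simp
  qed
  have "AE x in lborel. \<forall>j. x \<in> box L H \<longrightarrow> \<xi> j x = 0"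
    by (rule iffD2[OF AE_all_countable]) (intro allI zero)
  then show ?thesis
  proof eventually_elim
    fix x assume *: "\<forall>j. x \<in> box L H \<longrightarrow> \<xi> j x = 0"
    show "x \<in> box L H \<longrightarrow> Z c (chart_inv c x) = 0"
    proof
      assume x: "x \<in> box L H"
      then have "x \<in> chart_img c" using K box_subset_cbox[of L H] by blast
      then have "chart_inv c x \<in> chart_dom c" by (rule chart_inv_dom[OF c])
      moreover have "g c (chart_inv c x) *v Z c (chart_inv c x) = g c (chart_inv c x) *v 0"
        using * x by (simp add: \<xi>_def vec_eq_iff)
      ultimately show "Z c (chart_inv c x) = 0" using metric_inj[OF c] by blast
    qed
  qed
qed

text \<open>The chart image is a countable union of closed boxes, so the almost everywhere
  statements on boxes combine; finitely many charts then cover \<open>M\<close>.\<close>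

lemma weak_gradient_zero:
  assumes Z: "L2_field A g Z" and v: "\<And>k. smooth_fun A (v k)"
    and lim1: "(\<lambda>k. \<integral>p. (v k p)\<^sup>2 \<partial>vol) \<longlonglongrightarrow> 0"
    and lim2: "(\<lambda>k. \<integral>p. norm_sq A g (\<lambda>c q. grad g (v k) c q - Z c q) p \<partial>vol) \<longlonglongrightarrow> 0"
  shows "AE p in vol. norm_sq A g Z p = 0"
proof -
  have vf: "vector_field A Z" using Z by (simp add: L2_field_def)
  have m: "norm_sq A g Z \<in> borel_measurable borel" by (rule measurable_norm_sq[OF vf])
  note [measurable] = m
  have dom: "(\<integral>\<^sup>+p\<in>chart_dom c. ennreal (norm_sq A g Z p) \<partial>vol) = 0" if c: "c \<in> A" for c
  proof -
    obtain D where D: "countable D" "D \<subseteq> Pow (chart_img c)" "\<And>B. B \<in> D \<Longrightarrow> \<exists>L H. B = cbox L H" "\<Union> D = chart_img c"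
      using open_countable_Union_open_cbox[OF open_img[OF c]] by metis
    have "AE x in lborel. x \<in> B \<longrightarrow> Z c (chart_inv c x) = 0" if B: "B \<in> D" for B
    proof -
      obtain L H where LH: "B = cbox L H" using D(3)[OF B] by blast
      have "cbox L H \<subseteq> chart_img c" using D(2) B LH by blast
      from weak_gradient_zero_chart[OF Z v lim1 lim2 c this]
      have "AE x in lborel. x \<in> box L H \<longrightarrow> Z c (chart_inv c x) = 0" .
      \<comment> \<open>Closability speaks only of the interior of a box; its faces are null
        sets.\<close>
      moreover have "cbox L H - box L H \<in> null_sets lborel"
        using negligible_frontier_interval[of L H] by (simp add: negligible_iff_null_sets null_sets_completion_iff)
      then have "AE x in lborel. x \<notin> cbox L H - box L H" by (rule AE_not_in)
      ultimately show ?thesis by eventually_elim (auto simp: LH)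
    qed
    then have "AE x in lborel. \<forall>B\<in>D. x \<in> B \<longrightarrow> Z c (chart_inv c x) = 0"
      by (rule iffD2[OF AE_ball_countable[OF D(1)], rule_format])
    then have "AE x in lborel. x \<in> chart_img c \<longrightarrow> Z c (chart_inv c x) = 0"
      by eventually_elim (use D(4) in blast)
    then have "AE x in lborel. ennreal (dens c x) * ennreal (norm_sq A g Z (chart_inv c x)) * indicator (chart_img c) x = 0"
    proof eventually_elim
      fix x assume *: "x \<in> chart_img c \<longrightarrow> Z c (chart_inv c x) = 0"
      show "ennreal (dens c x) * ennreal (norm_sq A g Z (chart_inv c x)) * indicator (chart_img c) x = 0"
      proof (cases "x \<in> chart_img c")
        case True
        then show ?thesis
          using * norm_sq_chart[OF vector_field_tensorial[OF vf] c chart_inv_dom[OF c True]] by simp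
      qed simp
    qed
    then have "(\<integral>\<^sup>+x\<in>chart_img c. ennreal (dens c x) * ennreal (norm_sq A g Z (chart_inv c x)) \<partial>lborel) = (\<integral>\<^sup>+x. 0 \<partial>(lborel :: (real ^ 'n) measure))"
      by (rule nn_integral_cong_AE)
    then show ?thesis by (subst nn_integral_vol_chart[OF c]) auto
  qed
  obtain F where F: "finite F" "F \<subseteq> A" "(\<Union>c\<in>F. chart_dom c) = UNIV" by (rule finite_subatlas)
  have "AE p in vol. p \<in> chart_dom c \<longrightarrow> norm_sq A g Z p = 0" if c: "c \<in> A" for c
  proof -
    have "(\<lambda>p. ennreal (norm_sq A g Z p) * indicator (chart_dom c) p) \<in> borel_measurable vol"
      using borel_dom[OF c] by simp
    then have "AE p in vol. ennreal (norm_sq A g Z p) * indicator (chart_dom c) p = 0"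
      using dom[OF c] nn_integral_0_iff_AE by blast
    then show ?thesis
    proof eventually_elim
      fix p assume "ennreal (norm_sq A g Z p) * indicator (chart_dom c) p = 0"
      then show "p \<in> chart_dom c \<longrightarrow> norm_sq A g Z p = 0"
        using norm_sq_nonneg[of Z p] by (auto simp: ennreal_eq_0_iff)
    qed
  qed
  then have "AE p in vol. \<forall>c\<in>F. p \<in> chart_dom c \<longrightarrow> norm_sq A g Z p = 0"
    by (intro iffD2[OF AE_finite_all[OF F(1)]] ballI) (use F(2) in blast)
  then show ?thesis
    by eventually_elim (use F(3) in blast)
qed

text \<open>The difference of two gradients of u is a gradient of 0. This is what makes energy and
  H^1 norm independent of the choice in \<open>sobolev_grad\<close>.\<close>

lemma sobolev_grad_unique:
  assumes "has_sobolev_grad A g u X" "has_sobolev_grad A g u Y"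
  shows "AE p in vol. norm_sq A g X p = norm_sq A g Y p"
proof -
  let ?Z = "\<lambda>c q. X c q - Y c q"
  have d: "has_sobolev_grad A g (\<lambda>p. u p - u p) ?Z" by (rule has_sobolev_grad_diff[OF assms])
  then obtain v where v: "\<And>k. smooth_fun A (v k)" "(\<lambda>k. \<integral>p. (v k p - (u p - u p))\<^sup>2 \<partial>vol) \<longlonglongrightarrow> 0"
    "(\<lambda>k. \<integral>p. norm_sq A g (\<lambda>c q. grad g (v k) c q - (X c q - Y c q)) p \<partial>vol) \<longlonglongrightarrow> 0"
    unfolding has_sobolev_grad_def by blast
  have "L2_field A g ?Z" using d unfolding has_sobolev_grad_def by blast
  from weak_gradient_zero[OF this v(1) _ v(3)] v(2)
  have "AE p in vol. norm_sq A g ?Z p = 0" by simp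
  then show ?thesis
    by eventually_elim (intro norm_sq_cong, simp add: norm_sq_eq_0_iff)
qed

lemma has_sobolev_grad_sobolev_grad: "u \<in> H1 A g \<Longrightarrow> has_sobolev_grad A g u (sobolev_grad A g u)"
  unfolding sobolev_grad_def by (rule someI_ex[of "has_sobolev_grad A g u"]) (simp add: H1_def)

lemma has_sobolev_grad_H1: "has_sobolev_grad A g u X \<Longrightarrow> u \<in> H1 A g"
  unfolding H1_def by blast

text \<open>Allows any gradient at hand in place of the chosen one, in particular the classical
  gradient of a smooth function.\<close>

lemma energy_eq:
  assumes X: "has_sobolev_grad A g u X" and V: "continuous_on UNIV V"
  shows "energy A g V \<epsilon> u = (\<integral>p. \<epsilon> * norm_sq A g X p / 2 + V (u p) / \<epsilon> \<partial>vol)"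
proof -
  have Y: "has_sobolev_grad A g u (sobolev_grad A g u)"
    by (rule has_sobolev_grad_sobolev_grad[OF has_sobolev_grad_H1[OF X]])
  have m: "norm_sq A g X \<in> borel_measurable borel" "norm_sq A g (sobolev_grad A g u) \<in> borel_measurable borel"
    "u \<in> borel_measurable borel"
    using X Y measurable_norm_sq by (auto simp: has_sobolev_grad_def L2_field_def L2_fun_def)
  have mV: "(\<lambda>p. V (u p)) \<in> borel_measurable borel"
    using borel_measurable_continuous_onI[OF V] m(3) by measurable
  note [measurable] = m mV
  show ?thesis
    unfolding energy_def
  proof (rule integral_cong_AE)
    show "AE p in vol. \<epsilon> * norm_sq A g (sobolev_grad A g u) p / 2 + V (u p) / \<epsilon> = \<epsilon> * norm_sq A g X p / 2 + V (u p) / \<epsilon>"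
      using sobolev_grad_unique[OF Y X] by eventually_elim simp
  qed simp_all
qed

lemma H1_norm_sq_eq:
  assumes X: "has_sobolev_grad A g u X"
  shows "(H1_norm A g u)\<^sup>2 = (\<integral>p. (u p)\<^sup>2 + norm_sq A g X p \<partial>vol)"
proof -
  have Y: "has_sobolev_grad A g u (sobolev_grad A g u)"
    by (rule has_sobolev_grad_sobolev_grad[OF has_sobolev_grad_H1[OF X]])
  have m: "norm_sq A g X \<in> borel_measurable borel" "norm_sq A g (sobolev_grad A g u) \<in> borel_measurable borel"
    "u \<in> borel_measurable borel"
    using X Y measurable_norm_sq by (auto simp: has_sobolev_grad_def L2_field_def L2_fun_def)
  note [measurable] = m
  have "(\<integral>p. (u p)\<^sup>2 + norm_sq A g (sobolev_grad A g u) p \<partial>vol) = (\<integral>p. (u p)\<^sup>2 + norm_sq A g X p \<partial>vol)"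
  proof (rule integral_cong_AE)
    show "AE p in vol. (u p)\<^sup>2 + norm_sq A g (sobolev_grad A g u) p = (u p)\<^sup>2 + norm_sq A g X p"
      using sobolev_grad_unique[OF Y X] by eventually_elim simp
  qed simp_all
  moreover have "0 \<le> (\<integral>p. (u p)\<^sup>2 + norm_sq A g X p \<partial>vol)"
    by (intro integral_nonneg_AE) simp
  ultimately show ?thesis by (simp add: H1_norm_def)
qed

lemma L2_le_H1_norm:
  assumes "u \<in> H1 A g"
  shows "(\<integral>p. (u p)\<^sup>2 \<partial>vol) \<le> (H1_norm A g u)\<^sup>2"
proof -
  obtain X where X: "has_sobolev_grad A g u X" using assms unfolding H1_def by blast
  then have i: "integrable vol (\<lambda>p. (u p)\<^sup>2)" "integrable vol (norm_sq A g X)"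
    by (auto simp: has_sobolev_grad_def L2_fun_def L2_field_def)
  show ?thesis
    unfolding H1_norm_sq_eq[OF X] using i by (intro integral_mono) auto
qed

section \<open>The lower bound\<close>

text \<open>A mean only up to normalization: there is no division by the measure of
  \<open>K\<close>, and the integral is with respect to Lebesgue measure in the chart instead of the
  Riemannian volume.\<close>

definition chart_mean :: "('m, 'n) chart \<Rightarrow> (real ^ 'n) set \<Rightarrow> (real \<Rightarrow> real) \<Rightarrow> ('m \<Rightarrow> real) \<Rightarrow> real" where
  "chart_mean c K F u = (\<integral>x. indicator K x * F (pull c u x) \<partial>lborel)"

lemma integrable_chart_mean:
  fixes F :: "real \<Rightarrow> real" and u :: "'m \<Rightarrow> real"
  assumes c: "c \<in> A" and K: "K \<in> sets borel" "emeasure lborel K < \<infinity>"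
    and F: "F \<in> borel_measurable borel" "\<And>s. \<bar>F s\<bar> \<le> B" and u: "u \<in> borel_measurable borel"
  shows "integrable lborel (\<lambda>x. indicator K x * F (pull c u x))"
proof -
  note [measurable] = K(1) F(1) measurable_pull[OF c u]
  have "0 \<le> B" using F(2)[of 0] by linarith
  have "integrable lborel (\<lambda>x. B * indicator K x)"
    using K by (intro integrable_mult_right integrable_real_indicator) auto
  then show ?thesis
    by (rule Bochner_Integration.integrable_bound)
       (use F(2) \<open>0 \<le> B\<close> in \<open>auto simp: indicator_def\<close>)
qed

lemma chart_mean_lipschitz:
  assumes c: "c \<in> A" and K: "K \<in> sets borel" "emeasure lborel K < \<infinity>" "K \<subseteq> chart_img c"
    and a: "0 < a" "\<And>x. x \<in> K \<Longrightarrow> a \<le> dens c x"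
    and F: "F \<in> borel_measurable borel" "\<And>s. \<bar>F s\<bar> \<le> B"
    and lip: "\<And>s t. \<bar>F s - F t\<bar> \<le> C * \<bar>s - t\<bar>" and C: "0 \<le> C"
    and u: "u \<in> borel_measurable borel" and w: "w \<in> borel_measurable borel"
  shows "ennreal \<bar>chart_mean c K F u - chart_mean c K F w\<bar>
    \<le> ennreal (C / a) * (\<integral>\<^sup>+p. ennreal \<bar>u p - w p\<bar> \<partial>vol)"
proof -
  note i = integrable_chart_mean[OF c K(1,2) F]
  note [measurable] = u w K(1) measurable_pull[OF c u] measurable_pull[OF c w]
  let ?h = "\<lambda>x. indicator K x * F (pull c u x) - indicator K x * F (pull c w x)"
  have "ennreal \<bar>chart_mean c K F u - chart_mean c K F w\<bar> = ennreal (norm (\<integral>x. ?h x \<partial>lborel))"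
    using i[OF u] i[OF w] by (simp add: chart_mean_def)
  also have "\<dots> \<le> (\<integral>\<^sup>+x. ennreal (norm (?h x)) \<partial>lborel)"
    by (intro integral_norm_bound_ennreal Bochner_Integration.integrable_diff i u w)
  also have "\<dots> \<le> (\<integral>\<^sup>+x. ennreal C * (ennreal \<bar>pull c u x - pull c w x\<bar> * indicator K x) \<partial>lborel)"
  proof (intro nn_integral_mono)
    fix x
    show "ennreal (norm (?h x)) \<le> ennreal C * (ennreal \<bar>pull c u x - pull c w x\<bar> * indicator K x)"
      using lip[of "pull c u x" "pull c w x"] C
      by (cases "x \<in> K") (simp_all add: ennreal_mult'[symmetric] ennreal_leI)
  qed
  also have "\<dots> = ennreal C * (\<integral>\<^sup>+x. ennreal \<bar>pull c u x - pull c w x\<bar> * indicator K x \<partial>lborel)"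
    by (rule nn_integral_cmult) measurable
  also have "(\<integral>\<^sup>+x. ennreal \<bar>pull c u x - pull c w x\<bar> * indicator K x \<partial>lborel)
     = (\<integral>\<^sup>+x\<in>K. ennreal \<bar>u (chart_inv c x) - w (chart_inv c x)\<bar> \<partial>lborel)"
    using K(3) by (intro nn_integral_cong) (auto simp: indicator_def pull_eq subset_iff)
  also have "ennreal C * (\<integral>\<^sup>+x\<in>K. ennreal \<bar>u (chart_inv c x) - w (chart_inv c x)\<bar> \<partial>lborel)
     \<le> ennreal C * (ennreal (1 / a) * (\<integral>\<^sup>+p. ennreal \<bar>u p - w p\<bar> \<partial>vol))"
    by (intro mult_left_mono nn_integral_pull_le[OF c K(1,3) a]) auto
  also have "\<dots> = ennreal (C / a) * (\<integral>\<^sup>+p. ennreal \<bar>u p - w p\<bar> \<partial>vol)"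
    using a(1) C ennreal_mult[of C "1 / a"] by (simp add: mult.assoc[symmetric])
  finally show ?thesis .
qed

text \<open>A Lipschitz \<open>F\<close> makes this functional Lipschitz in L^1, hence continuous in
  L^2. The filter is arbitrary because the lemma is applied to sequences of smooth approximations
  and also to the parameter of a path.\<close>

lemma chart_mean_tendsto:
  fixes f :: "'i \<Rightarrow> 'm \<Rightarrow> real"
  assumes c: "c \<in> A" and K: "K \<in> sets borel" "emeasure lborel K < \<infinity>" "K \<subseteq> chart_img c"
    and a: "0 < a" "\<And>x. x \<in> K \<Longrightarrow> a \<le> dens c x"
    and F: "F \<in> borel_measurable borel" "\<And>s. \<bar>F s\<bar> \<le> B"
    and lip: "\<And>s t. \<bar>F s - F t\<bar> \<le> C * \<bar>s - t\<bar>" and C: "0 \<le> C"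
    and f: "\<And>i. L2_fun A g (f i)" and u: "L2_fun A g u"
    and lim: "((\<lambda>i. \<integral>p. (f i p - u p)\<^sup>2 \<partial>vol) \<longlongrightarrow> 0) \<F>"
  shows "((\<lambda>i. chart_mean c K F (f i)) \<longlongrightarrow> chart_mean c K F u) \<F>"
proof -
  have d: "L2_fun A g (\<lambda>p. f i p - u p)" for i by (rule L2_fun_diff[OF f u])
  then have m: "(\<lambda>p. f i p - u p) \<in> borel_measurable borel" "integrable vol (\<lambda>p. (f i p - u p)\<^sup>2)" for i
    by (auto simp: L2_fun_def)
  have l: "((\<lambda>i. \<integral>p. \<bar>f i p - u p\<bar> \<partial>vol) \<longlongrightarrow> 0) \<F>"
    using integral_abs_tendsto_0[OF finite_measure_vol _ m(2) lim] m(1) by simp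
  have bd: "\<bar>chart_mean c K F (f i) - chart_mean c K F u\<bar> \<le> C / a * (\<integral>p. \<bar>f i p - u p\<bar> \<partial>vol)" for i
  proof -
    have "integrable vol (\<lambda>p. f i p - u p)"
      by (rule integral_abs_le_sqrt_integral_square(1)[OF finite_measure_vol _ m(2)]) (simp add: m(1))
    then have e: "(\<integral>\<^sup>+p. ennreal \<bar>f i p - u p\<bar> \<partial>vol) = ennreal (\<integral>p. \<bar>f i p - u p\<bar> \<partial>vol)"
      by (intro nn_integral_eq_integral) auto
    have nn: "0 \<le> (\<integral>p. \<bar>f i p - u p\<bar> \<partial>vol)" by (intro integral_nonneg_AE) simp
    have "ennreal \<bar>chart_mean c K F (f i) - chart_mean c K F u\<bar> \<le> ennreal (C / a) * ennreal (\<integral>p. \<bar>f i p - u p\<bar> \<partial>vol)"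
      unfolding e[symmetric]
      by (rule chart_mean_lipschitz[OF c K a F lip C]) (use f[of i] u in \<open>auto simp: L2_fun_def\<close>)
    also have "\<dots> = ennreal (C / a * (\<integral>p. \<bar>f i p - u p\<bar> \<partial>vol))"
      by (rule ennreal_mult[symmetric]) (use a(1) C nn in auto)
    finally show ?thesis using a(1) C nn by (subst (asm) ennreal_le_iff) auto
  qed
  have l': "((\<lambda>i. C / a * (\<integral>p. \<bar>f i p - u p\<bar> \<partial>vol)) \<longlongrightarrow> C / a * 0) \<F>"
    by (rule tendsto_mult[OF tendsto_const l])
  have "((\<lambda>i. chart_mean c K F (f i) - chart_mean c K F u) \<longlongrightarrow> 0) \<F>"
  proof (rule tendsto_rabs_zero_cancel, rule tendsto_sandwich[OF _ _ tendsto_const])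
    show "((\<lambda>i. C / a * (\<integral>p. \<bar>f i p - u p\<bar> \<partial>vol)) \<longlongrightarrow> 0) \<F>"
      using l' by (simp only: mult_zero_right)
    show "\<forall>\<^sub>F i in \<F>. \<bar>chart_mean c K F (f i) - chart_mean c K F u\<bar> \<le> C / a * (\<integral>p. \<bar>f i p - u p\<bar> \<partial>vol)"
      by (rule always_eventually, rule allI, rule bd)
  qed simp
  then show ?thesis by (rule Lim_null[THEN iffD2])
qed

text \<open>For f = G(v) in coordinates and \<kappa> the measure of the ball, \<kappa> |f(x)| is at
  most the integral of |f(x) - f(z)| over z plus |integral of f|. Integrating over x bounds the
  first term by the double-integral inequality; then divide by \<kappa>. All quantifiers stand
  inside so that C depends on the ball only.\<close>

lemma smooth_poincare_chart:
  assumes c: "c \<in> A" and r: "0 < r" "cball y r \<subseteq> chart_img c"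
  obtains C where "0 < C"
    "\<forall>v G G'. smooth_fun A v \<longrightarrow> (\<forall>s. (G has_real_derivative G' s) (at s)) \<longrightarrow> continuous_on UNIV G' \<longrightarrow>
      (\<forall>s. \<bar>G s\<bar> \<le> 1) \<longrightarrow>
      chart_mean c (cball y r) (\<lambda>s. \<bar>G s\<bar>) v \<le> \<bar>chart_mean c (cball y r) G v\<bar> +
        C * (\<integral>p. \<bar>G' (v p)\<bar> * sqrt (norm_sq A g (grad g v) p) \<partial>vol)"
proof -
  let ?K = "cball y r"
  obtain a b where ab: "0 < a" "0 < b"
    "\<And>x v. x \<in> ?K \<Longrightarrow> a * (norm v)\<^sup>2 \<le> v \<bullet> (g c (chart_inv c x) *v v)"
    "\<And>x v. x \<in> ?K \<Longrightarrow> norm (g c (chart_inv c x) *v v) \<le> b * norm v"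
    "\<And>x. x \<in> ?K \<Longrightarrow> a \<le> dens c x"
    using metric_bounds[OF c compact_cball r(2)] unfolding dens_def by metis
  define \<beta> where "\<beta> = b / sqrt a"
  have \<beta>: "0 < \<beta>" using ab by (simp add: \<beta>_def)
  define \<kappa> where "\<kappa> = measure lborel ?K"
  have Kfin: "emeasure lborel ?K < \<infinity>" by (rule emeasure_lborel_cball_finite)
  have \<kappa>: "emeasure lborel ?K = ennreal \<kappa>" "0 < \<kappa>"
    using Kfin r(1) content_cball_pos[of r y] by (auto simp: \<kappa>_def emeasure_eq_ennreal_measure less_top)
  have Kb: "?K \<in> sets borel" by simp
  \<comment> \<open>Diameter 2r and factor 2^n from the double-integral inequality, \<beta> from
    comparing covectors with Riemannian norms, 1/a from comparing Lebesgue measure with the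
    volume.\<close>
  define C where "C = 2 * r * 2 ^ DIM(real ^ 'n) * (\<beta> / a)"
  have C: "0 < C" using r(1) ab(1) \<beta> by (simp add: C_def)
  show ?thesis
  proof (rule that[OF C], intro allI impI)
    fix v :: "'m \<Rightarrow> real" and G G' :: "real \<Rightarrow> real"
    assume v: "smooth_fun A v" and "\<forall>s. (G has_real_derivative G' s) (at s)"
      and G': "continuous_on UNIV G'" and "\<forall>s. \<bar>G s\<bar> \<le> 1"
    then have G: "(G has_real_derivative G' s) (at s)" and G1: "\<bar>G s\<bar> \<le> 1" for s by auto
    have cont_v: "continuous_on UNIV v" by (rule continuous_on_smooth[OF v])
    have cont_G: "continuous_on UNIV G"
      using G by (auto simp: continuous_on_eq_continuous_at intro: DERIV_isCont)
    define q where "q = (\<lambda>p. \<bar>G' (v p)\<bar> * sqrt (norm_sq A g (grad g v) p))"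
    have cont_q: "continuous_on UNIV q"
      unfolding q_def
      by (intro continuous_intros continuous_on_norm_sq_grad[OF v] continuous_on_compose2[OF G' cont_v]) auto
    have q0: "0 \<le> q p" for p by (simp add: q_def)
    note iq = integrable_continuous_M[OF cont_q]
    have [measurable]: "v \<in> borel_measurable borel" "G \<in> borel_measurable borel" "q \<in> borel_measurable borel"
      using cont_v cont_G cont_q by (auto intro: borel_measurable_continuous_onI)
    define f where "f = (\<lambda>x. G (pull c v x))"
    \<comment> \<open>Dominates the Euclidean derivative of G(v): the factor |G'(v)| |grad v| lives
      on \<open>M\<close>, and \<beta> converts it to coordinates.\<close>
    define \<psi> where "\<psi> = (\<lambda>x. \<beta> * pull c q x)"
    have [measurable]: "pull c v \<in> borel_measurable borel" "pull c q \<in> borel_measurable borel"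
      by (intro measurable_pull[OF c]; simp)+
    have [measurable]: "f \<in> borel_measurable borel" "\<psi> \<in> borel_measurable borel"
      unfolding f_def \<psi>_def by measurable
    define f' where "f' = (\<lambda>x w. G' (v (chart_inv c x)) * (dcoord v c (chart_inv c x) \<bullet> w))"
    have img: "x \<in> chart_img c" if "x \<in> ?K" for x using that r(2) by blast
    have der: "(f has_derivative f' x) (at x)" if x: "x \<in> ?K" for x
    proof -
      have "((v \<circ> chart_inv c) has_derivative (\<lambda>w. dcoord v c (chart_inv c x) \<bullet> w)) (at x)"
        using smooth_fun_derivative[OF v c chart_inv_dom[OF c img[OF x]]] by (simp add: chart_chart_inv[OF c img[OF x]])
      moreover have "(G has_derivative (*) (G' ((v \<circ> chart_inv c) x))) (at ((v \<circ> chart_inv c) x))"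
        using G by (simp add: has_field_derivative_def)
      ultimately have "((\<lambda>x. G ((v \<circ> chart_inv c) x)) has_derivative
          (\<lambda>w. G' ((v \<circ> chart_inv c) x) * (dcoord v c (chart_inv c x) \<bullet> w))) (at x)"
        by (rule has_derivative_compose)
      then have "((\<lambda>x. G ((v \<circ> chart_inv c) x)) has_derivative f' x) (at x)" by (simp add: f'_def)
      then show ?thesis
        by (rule has_derivative_transform_within_open[OF _ open_img[OF c] img[OF x]]) (simp add: f_def pull_eq)
    qed
    have cont_f': "continuous_on ?K (\<lambda>x. f' x w)" for w
    proof -
      have ci: "continuous_on ?K (chart_inv c)" by (rule continuous_on_subset[OF continuous_on_chart_inv[OF c] r(2)])
      have "continuous_on ?K (\<lambda>x. dcoord v c (chart_inv c x))"
        by (rule continuous_on_compose2[OF continuous_on_dcoord[OF v c] ci]) (use chart_inv_dom[OF c] img in blast)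
      moreover have "continuous_on ?K (\<lambda>x. v (chart_inv c x))"
        by (rule continuous_on_compose2[OF cont_v ci]) simp
      then have "continuous_on ?K (\<lambda>x. G' (v (chart_inv c x)))"
        by (rule continuous_on_compose2[OF G']) simp
      ultimately show ?thesis unfolding f'_def by (intro continuous_intros)
    qed
    have bd: "\<bar>f' x w\<bar> \<le> \<psi> x * norm w" if x: "x \<in> ?K" for x w
    proof -
      define p where "p = chart_inv c x"
      have p: "p \<in> chart_dom c" unfolding p_def by (rule chart_inv_dom[OF c img[OF x]])
      have "norm (dcoord v c p) \<le> \<beta> * sqrt (norm_sq A g (grad g v) p)"
        unfolding metric_grad[OF c p, symmetric] \<beta>_def
        by (rule norm_covector_le[OF tensorial_grad[OF v] c p ab(1,2)]) (use ab(3,4)[OF x] in \<open>simp_all add: p_def\<close>)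
      then have "\<bar>dcoord v c p \<bullet> w\<bar> \<le> \<beta> * sqrt (norm_sq A g (grad g v) p) * norm w"
        using Cauchy_Schwarz_ineq2[of "dcoord v c p" w] by (meson mult_right_mono norm_ge_zero order_trans)
      then have "\<bar>G' (v p)\<bar> * \<bar>dcoord v c p \<bullet> w\<bar> \<le> \<bar>G' (v p)\<bar> * (\<beta> * sqrt (norm_sq A g (grad g v) p) * norm w)"
        by (intro mult_left_mono) auto
      then show ?thesis
        using img[OF x] by (simp add: f'_def \<psi>_def pull_eq q_def p_def abs_mult mult_ac)
    qed
    have diam: "norm (z - x) \<le> 2 * r" if "x \<in> ?K" "z \<in> ?K" for x z
      using that dist_triangle2[of z x y] by (simp add: dist_norm[symmetric] dist_commute)
    have \<psi>0: "0 \<le> \<psi> x" for x using \<beta> q0 by (simp add: \<psi>_def pull_def)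
    define J where "J = (\<integral>x. indicator ?K x * f x \<partial>lborel)"
    have f1: "\<bar>f x\<bar> \<le> 1" for x unfolding f_def by (rule G1)
    have intf: "integrable lborel (\<lambda>x. indicator ?K x * f x)"
      unfolding f_def by (rule integrable_chart_mean[OF c Kb Kfin _ G1]) simp_all
    \<comment> \<open>Averaging f(x) - f(z) over z gives \<kappa> f(x) - J, with J the integral of f
      over the ball.\<close>
    have row: "ennreal (\<kappa> * \<bar>f x\<bar>) \<le> (\<integral>\<^sup>+z. ennreal \<bar>f x - f z\<bar> * indicator ?K z \<partial>lborel) + ennreal \<bar>J\<bar>" for x
    proof -
      have i1: "integrable lborel (\<lambda>z. indicator ?K z * f x)"
        using Kfin by (intro integrable_mult_left integrable_real_indicator) auto
      have "(\<integral>z. indicator ?K z * f x - indicator ?K z * f z \<partial>lborel) = \<kappa> * f x - J"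
        using i1 intf by (simp add: J_def \<kappa>_def)
      then have "\<kappa> * \<bar>f x\<bar> \<le> \<bar>\<integral>z. indicator ?K z * f x - indicator ?K z * f z \<partial>lborel\<bar> + \<bar>J\<bar>"
        using \<kappa>(2) by (simp add: abs_mult[symmetric] abs_of_pos)
      then have "ennreal (\<kappa> * \<bar>f x\<bar>) \<le> ennreal (norm (\<integral>z. indicator ?K z * f x - indicator ?K z * f z \<partial>lborel)) + ennreal \<bar>J\<bar>"
        by (simp add: ennreal_plus[symmetric] ennreal_leI del: ennreal_plus)
      also have "ennreal (norm (\<integral>z. indicator ?K z * f x - indicator ?K z * f z \<partial>lborel))
         \<le> (\<integral>\<^sup>+z. ennreal (norm (indicator ?K z * f x - indicator ?K z * f z)) \<partial>lborel)"
        by (intro integral_norm_bound_ennreal Bochner_Integration.integrable_diff i1 intf)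
      also have "\<dots> = (\<integral>\<^sup>+z. ennreal \<bar>f x - f z\<bar> * indicator ?K z \<partial>lborel)"
        by (intro nn_integral_cong) (auto simp: indicator_def)
      finally show ?thesis by (simp add: add_right_mono)
    qed
    have nn: "(\<integral>\<^sup>+x. ennreal (\<kappa> * \<bar>f x\<bar>) * indicator ?K x \<partial>lborel) = ennreal (\<kappa> * chart_mean c ?K (\<lambda>s. \<bar>G s\<bar>) v)"
    proof -
      have i: "integrable lborel (\<lambda>x. indicator ?K x * \<bar>G (pull c v x)\<bar>)"
        by (rule integrable_chart_mean[OF c Kb Kfin, where B = 1]) (use G1 in simp_all)
      have "(\<integral>\<^sup>+x. ennreal (\<kappa> * \<bar>f x\<bar>) * indicator ?K x \<partial>lborel) = (\<integral>\<^sup>+x. ennreal (\<kappa> * (indicator ?K x * \<bar>G (pull c v x)\<bar>)) \<partial>lborel)"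
        by (intro nn_integral_cong) (auto simp: indicator_def f_def)
      also have "\<dots> = ennreal (\<integral>x. \<kappa> * (indicator ?K x * \<bar>G (pull c v x)\<bar>) \<partial>lborel)"
        using \<kappa>(2) by (intro nn_integral_eq_integral integrable_mult_right i) auto
      finally show ?thesis by (simp add: chart_mean_def)
    qed
    have P: "(\<integral>\<^sup>+x. \<integral>\<^sup>+z. ennreal \<bar>f x - f z\<bar> * indicator ?K x * indicator ?K z \<partial>lborel \<partial>lborel)
       \<le> ennreal (2 * r) * 2 ^ DIM(real ^ 'n) * emeasure lborel ?K * (\<integral>\<^sup>+x\<in>?K. ennreal (\<psi> x) \<partial>lborel)"
      by (rule poincare_double_integral[where f' = f' and \<psi> = \<psi> and d = "2 * r"])
         (use der cont_f' bd \<psi>0 diam in \<open>auto\<close>)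
    have psi_le: "(\<integral>\<^sup>+x\<in>?K. ennreal (\<psi> x) \<partial>lborel) \<le> ennreal (\<beta> / a * (\<integral>p. q p \<partial>vol))"
    proof -
      have "(\<integral>\<^sup>+x\<in>?K. ennreal (\<psi> x) \<partial>lborel) = (\<integral>\<^sup>+x\<in>?K. ennreal (\<beta> * q (chart_inv c x)) \<partial>lborel)"
        using img by (intro nn_integral_cong) (auto simp: indicator_def \<psi>_def pull_eq)
      also have "\<dots> \<le> ennreal (1 / a) * (\<integral>\<^sup>+p. ennreal (\<beta> * q p) \<partial>vol)"
        by (rule nn_integral_pull_le[OF c Kb r(2) ab(1,5), where f = "\<lambda>p. ennreal (\<beta> * q p)"]) simp_all
      also have "(\<integral>\<^sup>+p. ennreal (\<beta> * q p) \<partial>vol) = ennreal (\<beta> * (\<integral>p. q p \<partial>vol))"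
        using nn_integral_eq_integral[OF integrable_mult_right[OF iq, of \<beta>]] \<beta> q0 by simp
      also have "ennreal (1 / a) * ennreal (\<beta> * (\<integral>p. q p \<partial>vol)) = ennreal (\<beta> / a * (\<integral>p. q p \<partial>vol))"
        using ab(1) \<beta> q0 by (simp add: ennreal_mult[symmetric] integral_nonneg_AE)
      finally show ?thesis .
    qed
    define R where "R = (\<lambda>x. \<integral>\<^sup>+z. ennreal \<bar>f x - f z\<bar> * indicator ?K z \<partial>lborel)"
    have [measurable]: "R \<in> borel_measurable borel"
    proof -
      define K where "K = ?K"
      have [measurable]: "K \<in> sets borel" by (simp add: K_def)
      show ?thesis unfolding R_def K_def[symmetric] by measurable
    qed
    have "ennreal (\<kappa> * chart_mean c ?K (\<lambda>s. \<bar>G s\<bar>) v)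
       \<le> (\<integral>\<^sup>+x. (R x + ennreal \<bar>J\<bar>) * indicator ?K x \<partial>lborel)"
      unfolding nn[symmetric] R_def by (intro nn_integral_mono mult_right_mono row) simp
    also have "\<dots> = (\<integral>\<^sup>+x. R x * indicator ?K x + ennreal \<bar>J\<bar> * indicator ?K x \<partial>lborel)"
      by (simp only: distrib_right)
    also have "\<dots> = (\<integral>\<^sup>+x. R x * indicator ?K x \<partial>lborel) + (\<integral>\<^sup>+x. ennreal \<bar>J\<bar> * indicator ?K x \<partial>lborel)"
    proof -
      have m: "(\<lambda>x. h x * indicator K x) \<in> borel_measurable lborel"
        if [measurable]: "h \<in> borel_measurable borel" "K \<in> sets borel" for h :: "real ^ 'n \<Rightarrow> ennreal" and K
        by measurable
      show ?thesis by (intro nn_integral_add m) simp_all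
    qed
    also have "(\<integral>\<^sup>+x. ennreal \<bar>J\<bar> * indicator ?K x \<partial>lborel) = ennreal \<bar>J\<bar> * emeasure lborel ?K"
      by (rule nn_integral_cmult_indicator) simp
    also have "(\<integral>\<^sup>+x. R x * indicator ?K x \<partial>lborel)
       = (\<integral>\<^sup>+x. \<integral>\<^sup>+z. ennreal \<bar>f x - f z\<bar> * indicator ?K x * indicator ?K z \<partial>lborel \<partial>lborel)"
      unfolding R_def by (intro nn_integral_cong) (auto simp: indicator_def)
    also have "\<dots> \<le> ennreal (2 * r) * 2 ^ DIM(real ^ 'n) * emeasure lborel ?K * ennreal (\<beta> / a * (\<integral>p. q p \<partial>vol))"
      by (rule order_trans[OF P mult_left_mono[OF psi_le]]) simp
    also have "\<dots> + ennreal \<bar>J\<bar> * emeasure lborel ?K = ennreal (\<kappa> * (C * (\<integral>p. q p \<partial>vol) + \<bar>J\<bar>))"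
    proof -
      have two: "(2::ennreal) ^ DIM(real ^ 'n) = ennreal (2 ^ DIM(real ^ 'n))"
        using ennreal_power[of 2 "DIM(real ^ 'n)"] by simp
      have q_int: "0 \<le> (\<integral>p. q p \<partial>vol)" using q0 by (simp add: integral_nonneg_AE)
      have "ennreal (2 * r) * 2 ^ DIM(real ^ 'n) * emeasure lborel ?K * ennreal (\<beta> / a * (\<integral>p. q p \<partial>vol))
        = ennreal (2 * r * 2 ^ DIM(real ^ 'n) * \<kappa> * (\<beta> / a * (\<integral>p. q p \<partial>vol)))"
        unfolding \<kappa>(1) two using r(1) \<kappa>(2) ab(1) \<beta> q_int
        by (simp only: ennreal_mult[symmetric] mult_nonneg_nonneg zero_le_power less_imp_le divide_nonneg_nonneg zero_le_numeral)
      moreover have "ennreal \<bar>J\<bar> * emeasure lborel ?K = ennreal (\<bar>J\<bar> * \<kappa>)"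
        unfolding \<kappa>(1) using \<kappa>(2) by (simp add: ennreal_mult)
      moreover have "2 * r * 2 ^ DIM(real ^ 'n) * \<kappa> * (\<beta> / a * (\<integral>p. q p \<partial>vol)) + \<bar>J\<bar> * \<kappa> = \<kappa> * (C * (\<integral>p. q p \<partial>vol) + \<bar>J\<bar>)"
        by (simp add: C_def algebra_simps)
      moreover have "0 \<le> 2 * r * 2 ^ DIM(real ^ 'n) * \<kappa> * (\<beta> / a * (\<integral>p. q p \<partial>vol))"
        using r(1) \<kappa>(2) ab(1) \<beta> q_int by (intro mult_nonneg_nonneg) auto
      ultimately show ?thesis
        using \<kappa>(2) by (simp add: ennreal_plus[symmetric] del: ennreal_plus)
    qed
    finally have "ennreal (\<kappa> * chart_mean c ?K (\<lambda>s. \<bar>G s\<bar>) v) \<le> ennreal (\<kappa> * (C * (\<integral>p. q p \<partial>vol) + \<bar>J\<bar>))"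
      by (simp add: add_right_mono)
    moreover have "0 \<le> \<kappa> * (C * (\<integral>p. q p \<partial>vol) + \<bar>J\<bar>)"
      using \<kappa>(2) C q0 by (intro mult_nonneg_nonneg add_nonneg_nonneg) (auto simp: integral_nonneg_AE)
    ultimately have "\<kappa> * chart_mean c ?K (\<lambda>s. \<bar>G s\<bar>) v \<le> \<kappa> * (C * (\<integral>p. q p \<partial>vol) + \<bar>J\<bar>)"
      by (simp add: ennreal_le_iff)
    then have "chart_mean c ?K (\<lambda>s. \<bar>G s\<bar>) v \<le> C * (\<integral>p. q p \<partial>vol) + \<bar>J\<bar>"
      using \<kappa>(2) by (simp only: mult_le_cancel_left_pos)
    then show "chart_mean c ?K (\<lambda>s. \<bar>G s\<bar>) v \<le> \<bar>chart_mean c ?K G v\<bar> + C * (\<integral>p. \<bar>G' (v p)\<bar> * sqrt (norm_sq A g (grad g v) p) \<partial>vol)"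
      by (simp add: J_def f_def chart_mean_def q_def)
  qed
qed

text \<open>The bound is proved for every function with vanishing mean of G, and each path contains
  one by the intermediate value theorem. The constant depends on the ball, the step function and v0,
  and not on \<epsilon>; the restriction to \<epsilon> at most 1 bounds the integral of V(u) by the
  energy itself.\<close>

lemma minmax_value_lower_bound:
  assumes V: "continuous_on UNIV V" "\<And>s. 0 \<le> V s" "\<And>s. V s \<le> B" and v0: "0 < v0"
    and V_low: "\<And>s. \<bar>s\<bar> \<le> 1 / 2 \<Longrightarrow> v0 \<le> V s"
  obtains e where "0 < e" "\<forall>\<epsilon>. 0 < \<epsilon> \<longrightarrow> \<epsilon> \<le> 1 \<longrightarrow> ereal e \<le> minmax_value A g V \<epsilon>"
proof -
  interpret vol: finite_measure vol by (rule finite_measure_vol)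
  obtain \<sigma> \<sigma>' :: "real \<Rightarrow> real" and C where \<sigma>: "\<And>x. (\<sigma> has_real_derivative \<sigma>' x) (at x)" "0 < C"
    "\<And>x. x \<le> 0 \<Longrightarrow> \<sigma> x = 0" "\<And>x. 1 \<le> x \<Longrightarrow> \<sigma> x = 1" "\<And>x. 0 \<le> \<sigma> x" "\<And>x. \<sigma> x \<le> 1"
    "\<And>x. x \<le> 0 \<or> 1 \<le> x \<Longrightarrow> \<sigma>' x = 0" "\<And>x. \<bar>\<sigma>' x\<bar> \<le> C"
    "\<And>x y. \<bar>\<sigma> x - \<sigma> y\<bar> \<le> C * \<bar>x - y\<bar>" "\<And>x y. \<bar>\<sigma>' x - \<sigma>' y\<bar> \<le> C * \<bar>x - y\<bar>"
    by (rule smooth_step) blast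
  define G where "G = (\<lambda>s. \<sigma> (s + 1 / 2) - 1 / 2)"
  define G' where "G' = (\<lambda>s. \<sigma>' (s + 1 / 2))"
  have dG: "(G has_real_derivative G' s) (at s)" for s
    unfolding G_def G'_def by (auto intro!: derivative_eq_intros DERIV_chain2[OF \<sigma>(1)])
  have G_half: "\<bar>G s\<bar> \<le> 1 / 2" for s using \<sigma>(5,6)[of "s + 1 / 2"] unfolding G_def by linarith
  have G_out: "\<bar>G s\<bar> = 1 / 2" if "1 / 2 \<le> \<bar>s\<bar>" for s
    using that \<sigma>(3)[of "s + 1 / 2"] \<sigma>(4)[of "s + 1 / 2"] by (cases "0 \<le> s") (auto simp: G_def)
  have G'_out: "G' s = 0" if "1 / 2 \<le> \<bar>s\<bar>" for s
    using that \<sigma>(7)[of "s + 1 / 2"] by (cases "0 \<le> s") (auto simp: G'_def)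
  have G'_bd: "\<bar>G' s\<bar> \<le> C" for s unfolding G'_def by (rule \<sigma>(8))
  have G_lip: "\<bar>G s - G t\<bar> \<le> C * \<bar>s - t\<bar>" for s t
    using \<sigma>(9)[of "s + 1 / 2" "t + 1 / 2"] by (simp add: G_def)
  have aG_lip: "\<bar>\<bar>G s\<bar> - \<bar>G t\<bar>\<bar> \<le> C * \<bar>s - t\<bar>" for s t
    using G_lip[of s t] abs_triangle_ineq3[of "G s" "G t"] by linarith
  have G'_lip: "\<bar>G' s - G' t\<bar> \<le> C * \<bar>s - t\<bar>" for s t
    using \<sigma>(10)[of "s + 1 / 2" "t + 1 / 2"] by (simp add: G'_def)
  \<comment> \<open>Lets the integral of (G'(v_k))^2 pass to the limit using only L^1 convergence of
    v_k.\<close>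
  have G'2_lip: "\<bar>(G' s)\<^sup>2 - (G' t)\<^sup>2\<bar> \<le> 2 * C\<^sup>2 * \<bar>s - t\<bar>" for s t
  proof -
    have "\<bar>(G' s)\<^sup>2 - (G' t)\<^sup>2\<bar> = \<bar>G' s + G' t\<bar> * \<bar>G' s - G' t\<bar>"
      by (simp add: power2_eq_square abs_mult[symmetric] algebra_simps)
    also have "\<dots> \<le> (2 * C) * (C * \<bar>s - t\<bar>)"
      using G'_bd[of s] G'_bd[of t] \<sigma>(2) by (intro mult_mono G'_lip) auto
    finally show ?thesis by (simp add: power2_eq_square mult_ac)
  qed
  have cont_G: "continuous_on UNIV G"
    using dG by (auto simp: continuous_on_eq_continuous_at intro: DERIV_isCont)
  have cont_G': "continuous_on UNIV G'"
    by (rule lipschitz_on_continuous_on[of C]) (use G'_lip \<sigma>(2) in \<open>auto intro!: lipschitz_onI simp: dist_real_def\<close>)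
  have mG: "G \<in> borel_measurable borel" "(\<lambda>s. \<bar>G s\<bar>) \<in> borel_measurable borel" "G' \<in> borel_measurable borel" "V \<in> borel_measurable borel"
    using cont_G cont_G' V(1) by (auto intro!: borel_measurable_continuous_onI continuous_intros)
  \<comment> \<open>Any point would do; one chart around it supplies the ball.\<close>
  obtain c where c: "c \<in> A" "undefined \<in> chart_dom c" using chart_exists by blast
  then obtain y r where r: "0 < r" "cball y r \<subseteq> chart_img c"
    using open_img[OF c(1)] open_contains_cball by blast
  define K where "K = cball y r"
  have K: "K \<in> sets borel" "emeasure lborel K < \<infinity>" "K \<subseteq> chart_img c"
    unfolding K_def using r emeasure_lborel_cball_finite by auto
  obtain a where a: "0 < a" "\<And>x. x \<in> K \<Longrightarrow> a \<le> dens c x"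
    using metric_bounds[OF c(1) compact_cball r(2)] unfolding dens_def K_def by metis
  define \<kappa> where "\<kappa> = measure lborel K"
  have \<kappa>: "0 < \<kappa>" using content_cball_pos[OF r(1), of y] by (simp add: \<kappa>_def K_def)
  obtain C2 where C2_pos: "0 < C2" and
    poin: "\<forall>v G G'. smooth_fun A v \<longrightarrow> (\<forall>s. (G has_real_derivative G' s) (at s)) \<longrightarrow> continuous_on UNIV G' \<longrightarrow>
      (\<forall>s. \<bar>G s\<bar> \<le> 1) \<longrightarrow>
      chart_mean c (cball y r) (\<lambda>s. \<bar>G s\<bar>) v \<le> \<bar>chart_mean c (cball y r) G v\<bar> +
        C2 * (\<integral>p. \<bar>G' (v p)\<bar> * sqrt (norm_sq A g (grad g v) p) \<partial>vol)"
    by (rule smooth_poincare_chart[OF c(1) r])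
  have "\<bar>G s\<bar> \<le> 1" for s using G_half[of s] by simp
  with poin dG cont_G' have "chart_mean c K (\<lambda>s. \<bar>G s\<bar>) v \<le> \<bar>chart_mean c K G v\<bar> +
        C2 * (\<integral>p. \<bar>G' (v p)\<bar> * sqrt (norm_sq A g (grad g v) p) \<partial>vol)" if "smooth_fun A v" for v
    using that unfolding K_def by blast
  note C2 = C2_pos this
  \<comment> \<open>Read off from the final inequality: half the measure of the ball is at most this
    denominator times the energy.\<close>
  define e where "e = \<kappa> / 2 / (C2 * (2 + C\<^sup>2 / v0) + 1 / (2 * v0 * a))"
  have den: "0 < C2 * (2 + C\<^sup>2 / v0) + 1 / (2 * v0 * a)"
    using C2(1) v0 a(1) \<sigma>(2) by (intro add_pos_pos mult_pos_pos divide_pos_pos) auto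
  have e: "0 < e" unfolding e_def using \<kappa> by (intro divide_pos_pos den) auto
  have iG'2: "integrable vol (\<lambda>p. (G' (w p))\<^sup>2)" if "w \<in> borel_measurable borel" for w
  proof (rule vol.integrable_const_bound[of _ "C\<^sup>2"])
    show "AE p in vol. norm ((G' (w p))\<^sup>2) \<le> C\<^sup>2"
      using G'_bd by (intro AE_I2) (simp add: abs_le_square_iff[symmetric] abs_of_pos[OF \<sigma>(2)])
    show "(\<lambda>p. (G' (w p))\<^sup>2) \<in> borel_measurable vol"
      using measurable_compose[OF that mG(3)] by simp
  qed
  \<comment> \<open>Young's inequality is applied to smooth v_k before the limit, since each
    resulting term is stable under convergence in H^1; the product |G'(u)| |grad u| never has to be
    formed for the limit u.\<close>
  have weak: "chart_mean c K (\<lambda>s. \<bar>G s\<bar>) u \<le> \<bar>chart_mean c K G u\<bar> +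
      C2 * (\<epsilon> * (\<integral>p. norm_sq A g X p \<partial>vol) + (\<integral>p. (G' (u p))\<^sup>2 \<partial>vol) / (2 * \<epsilon>))"
    if X: "has_sobolev_grad A g u X" and \<epsilon>: "0 < \<epsilon>" for u X \<epsilon>
  proof -
    obtain v where v: "\<And>k. smooth_fun A (v k)" "(\<lambda>k. \<integral>p. (v k p - u p)\<^sup>2 \<partial>vol) \<longlonglongrightarrow> 0"
      "(\<lambda>k. \<integral>p. norm_sq A g (\<lambda>c q. grad g (v k) c q - X c q) p \<partial>vol) \<longlonglongrightarrow> 0"
      using X unfolding has_sobolev_grad_def by blast
    have L2: "L2_fun A g u" "L2_field A g X" using X unfolding has_sobolev_grad_def by auto
    have L2v: "L2_fun A g (v k)" for k by (rule L2_fun_smooth[OF v(1)])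
    have um: "u \<in> borel_measurable borel" and vm: "v k \<in> borel_measurable borel" for k
      using L2(1) L2v[of k] by (auto simp: L2_fun_def)
    have l1: "(\<lambda>k. chart_mean c K (\<lambda>s. \<bar>G s\<bar>) (v k)) \<longlonglongrightarrow> chart_mean c K (\<lambda>s. \<bar>G s\<bar>) u"
      by (rule chart_mean_tendsto[OF c(1) K a mG(2) _ aG_lip _ L2v L2(1) v(2), of "1 / 2"]) (use G_half \<sigma>(2) in auto)
    have l2: "(\<lambda>k. chart_mean c K G (v k)) \<longlonglongrightarrow> chart_mean c K G u"
      by (rule chart_mean_tendsto[OF c(1) K a mG(1) _ G_lip _ L2v L2(1) v(2), of "1 / 2"]) (use G_half \<sigma>(2) in auto)
    have d2: "integrable vol (\<lambda>p. (v k p - u p)\<^sup>2)" "(\<lambda>p. v k p - u p) \<in> borel_measurable borel" for k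
      using L2_fun_diff[OF L2v L2(1)] by (auto simp: L2_fun_def)
    have d1: "integrable vol (\<lambda>p. v k p - u p)" for k
      by (rule integral_abs_le_sqrt_integral_square(1)[OF finite_measure_vol _ d2(1)]) (simp add: d2(2))
    have l3: "(\<lambda>k. \<integral>p. \<bar>v k p - u p\<bar> \<partial>vol) \<longlonglongrightarrow> 0"
      using integral_abs_tendsto_0[OF finite_measure_vol _ d2(1) v(2)] d2(2) by simp
    have iN: "integrable vol (norm_sq A g X)" "integrable vol (norm_sq A g (\<lambda>c q. grad g (v k) c q - X c q))"
      "integrable vol (norm_sq A g (grad g (v k)))" for k
      using L2(2) L2_field_diff[OF L2_field_grad[OF v(1)] L2(2)] L2_field_grad[OF v(1)] by (auto simp: L2_field_def)
    define R where "R = (\<lambda>k. \<epsilon> * (\<integral>p. norm_sq A g X p \<partial>vol) + \<epsilon> * (\<integral>p. norm_sq A g (\<lambda>c q. grad g (v k) c q - X c q) p \<partial>vol)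
       + ((\<integral>p. (G' (u p))\<^sup>2 \<partial>vol) + 2 * C\<^sup>2 * (\<integral>p. \<bar>v k p - u p\<bar> \<partial>vol)) / (2 * \<epsilon>))"
    have step: "chart_mean c K (\<lambda>s. \<bar>G s\<bar>) (v k) \<le> \<bar>chart_mean c K G (v k)\<bar> + C2 * R k" for k
    proof -
      let ?N = "norm_sq A g (grad g (v k))"
      let ?D = "norm_sq A g (\<lambda>c q. grad g (v k) c q - X c q)"
      \<comment> \<open>Young gives \<epsilon>/2 times |grad v_k|^2; replacing grad v_k by X plus an
        error doubles the coefficient. The square (G'(v_k))^2 is exchanged for (G'(u))^2 by the
        Lipschitz bound.\<close>
      have pt: "\<bar>G' (v k p)\<bar> * sqrt (?N p) \<le> \<epsilon> * norm_sq A g X p + \<epsilon> * ?D p + ((G' (u p))\<^sup>2 + 2 * C\<^sup>2 * \<bar>v k p - u p\<bar>) / (2 * \<epsilon>)" for p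
      proof -
        have "0 \<le> (\<epsilon> * sqrt (?N p) - \<bar>G' (v k p)\<bar>)\<^sup>2" by simp
        then have "2 * \<epsilon> * (\<bar>G' (v k p)\<bar> * sqrt (?N p)) \<le> \<epsilon>\<^sup>2 * ?N p + (G' (v k p))\<^sup>2"
          by (simp add: power2_diff power_mult_distrib mult_ac)
        then have "\<bar>G' (v k p)\<bar> * sqrt (?N p) \<le> (\<epsilon>\<^sup>2 * ?N p + (G' (v k p))\<^sup>2) / (2 * \<epsilon>)"
          using \<epsilon> by (simp add: field_simps)
        also have "\<dots> = \<epsilon> / 2 * ?N p + (G' (v k p))\<^sup>2 / (2 * \<epsilon>)"
          using \<epsilon> by (simp add: field_simps power2_eq_square)
        also have "\<dots> \<le> \<epsilon> / 2 * (2 * ?D p + 2 * norm_sq A g X p) + ((G' (u p))\<^sup>2 + 2 * C\<^sup>2 * \<bar>v k p - u p\<bar>) / (2 * \<epsilon>)"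
        proof (intro add_mono mult_left_mono divide_right_mono)
          show "?N p \<le> 2 * ?D p + 2 * norm_sq A g X p"
            using norm_sq_add_le[of "\<lambda>c q. grad g (v k) c q - X c q" X p] by simp
          show "(G' (v k p))\<^sup>2 \<le> (G' (u p))\<^sup>2 + 2 * C\<^sup>2 * \<bar>v k p - u p\<bar>"
            using G'2_lip[of "v k p" "u p"] by linarith
        qed (use \<epsilon> in auto)
        also have "\<dots> = \<epsilon> * norm_sq A g X p + \<epsilon> * ?D p + ((G' (u p))\<^sup>2 + 2 * C\<^sup>2 * \<bar>v k p - u p\<bar>) / (2 * \<epsilon>)"
          by (simp add: algebra_simps)
        finally show ?thesis .
      qed
      have "(\<integral>p. \<bar>G' (v k p)\<bar> * sqrt (?N p) \<partial>vol) \<le> (\<integral>p. \<epsilon> * norm_sq A g X p + \<epsilon> * ?D p + ((G' (u p))\<^sup>2 + 2 * C\<^sup>2 * \<bar>v k p - u p\<bar>) / (2 * \<epsilon>) \<partial>vol)"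
      proof (rule integral_mono[OF _ _ pt])
        show "integrable vol (\<lambda>p. \<bar>G' (v k p)\<bar> * sqrt (?N p))"
          by (intro integrable_continuous_M continuous_on_mult continuous_on_rabs continuous_on_real_sqrt
              continuous_on_norm_sq_grad[OF v(1)] continuous_on_compose2[OF cont_G' continuous_on_smooth[OF v(1)]]) auto
        show "integrable vol (\<lambda>p. \<epsilon> * norm_sq A g X p + \<epsilon> * ?D p + ((G' (u p))\<^sup>2 + 2 * C\<^sup>2 * \<bar>v k p - u p\<bar>) / (2 * \<epsilon>))"
          using iN iG'2[OF um] d1 by simp
      qed
      also have "\<dots> = R k"
        using iN iG'2[OF um] d1 by (simp add: R_def)
      finally show ?thesis
        using C2(2)[OF v(1), of k] mult_left_mono[of _ "R k" C2] C2(1) by (smt (verit))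
    qed
    have "(\<lambda>k. \<bar>chart_mean c K G (v k)\<bar> + C2 * R k) \<longlonglongrightarrow> \<bar>chart_mean c K G u\<bar> + C2 * (\<epsilon> * (\<integral>p. norm_sq A g X p \<partial>vol) + \<epsilon> * 0
       + ((\<integral>p. (G' (u p))\<^sup>2 \<partial>vol) + 2 * C\<^sup>2 * 0) / (2 * \<epsilon>))"
      unfolding R_def using \<epsilon> by (intro tendsto_intros l2 l3 v(3)) auto
    from LIMSEQ_le[OF l1 this] step show ?thesis by auto
  qed
  have low: "e \<le> energy A g V \<epsilon> u"
    if u: "u \<in> H1 A g" "chart_mean c K G u = 0" and \<epsilon>: "0 < \<epsilon>" "\<epsilon> \<le> 1" for u \<epsilon>
  proof -
    obtain X where X: "has_sobolev_grad A g u X" using u(1) unfolding H1_def by blast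
    have um: "u \<in> borel_measurable borel" and iN: "integrable vol (norm_sq A g X)"
      using X by (auto simp: has_sobolev_grad_def L2_fun_def L2_field_def)
    have Vm: "(\<lambda>p. V (u p)) \<in> borel_measurable borel" by (rule measurable_compose[OF um mG(4)])
    have iV: "integrable vol (\<lambda>p. V (u p))"
      by (rule vol.integrable_const_bound[of _ B]) (use V(2,3) Vm in auto)
    define N where "N = (\<integral>p. norm_sq A g X p \<partial>vol)"
    define P where "P = (\<integral>p. V (u p) \<partial>vol)"
    define E where "E = energy A g V \<epsilon> u"
    have N0: "0 \<le> N" and P0: "0 \<le> P" using V(2) by (auto simp: N_def P_def intro!: integral_nonneg_AE)
    have E: "E = \<epsilon> * N / 2 + P / \<epsilon>"
      unfolding E_def energy_eq[OF X V(1)] using iN iV by (simp add: N_def P_def)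
    have N_le: "\<epsilon> * N \<le> 2 * E" and P_le: "P / \<epsilon> \<le> E"
      using N0 P0 \<epsilon> by (auto simp: E)
    have E0: "0 \<le> E" using N0 P0 \<epsilon> by (simp add: E)
    \<comment> \<open>Uses \<epsilon> <= 1; otherwise only P <= \<epsilon> E is available.\<close>
    have P_le': "P \<le> E"
      using P_le \<epsilon> E0 mult_left_le_one_le[of E \<epsilon>] by (simp add: field_simps)
    have G'V: "(G' s)\<^sup>2 \<le> C\<^sup>2 / v0 * V s" for s
    proof (cases "\<bar>s\<bar> \<le> 1 / 2")
      case True
      have "(G' s)\<^sup>2 \<le> C\<^sup>2" using G'_bd[of s] by (simp add: abs_le_square_iff[symmetric] abs_of_pos[OF \<sigma>(2)])
      also have "\<dots> = C\<^sup>2 / v0 * v0" using v0 by simp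
      also have "\<dots> \<le> C\<^sup>2 / v0 * V s" using V_low[OF True] v0 by (intro mult_left_mono) auto
      finally show ?thesis .
    next
      case False
      then show ?thesis using G'_out[of s] V(2)[of s] v0 by simp
    qed
    have "(\<integral>p. (G' (u p))\<^sup>2 \<partial>vol) \<le> (\<integral>p. C\<^sup>2 / v0 * V (u p) \<partial>vol)"
      by (intro integral_mono iG'2 um integrable_mult_right iV G'V)
    then have "(\<integral>p. (G' (u p))\<^sup>2 \<partial>vol) / (2 * \<epsilon>) \<le> C\<^sup>2 / v0 * P / (2 * \<epsilon>)"
      using \<epsilon> by (intro divide_right_mono) (auto simp: P_def)
    also have "\<dots> = C\<^sup>2 / v0 * ((P / \<epsilon>) / 2)" by simp
    also have "\<dots> \<le> C\<^sup>2 / v0 * E" using P_le E0 v0 by (intro mult_left_mono) auto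
    finally have G'_le: "(\<integral>p. (G' (u p))\<^sup>2 \<partial>vol) / (2 * \<epsilon>) \<le> C\<^sup>2 / v0 * E" .
    have "chart_mean c K (\<lambda>s. \<bar>G s\<bar>) u \<le> C2 * (\<epsilon> * N + (\<integral>p. (G' (u p))\<^sup>2 \<partial>vol) / (2 * \<epsilon>))"
      using weak[OF X \<epsilon>(1)] u(2) by (simp add: N_def)
    also have "\<dots> \<le> C2 * (2 * E + C\<^sup>2 / v0 * E)"
      using N_le G'_le C2(1) by (intro mult_left_mono add_mono) auto
    finally have up: "chart_mean c K (\<lambda>s. \<bar>G s\<bar>) u \<le> C2 * (2 + C\<^sup>2 / v0) * E" by (simp add: algebra_simps)
    have iK: "integrable lborel (\<lambda>x. indicator K x * \<bar>G (pull c u x)\<bar>)" "integrable lborel (\<lambda>x. indicator K x * V (pull c u x))"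
      using integrable_chart_mean[OF c(1) K(1,2) mG(2) _ um, of "1 / 2"] integrable_chart_mean[OF c(1) K(1,2) mG(4) _ um, of B]
        G_half V(2,3) by (simp_all add: abs_of_nonneg)
    have meanV: "chart_mean c K V u \<le> P / a"
    proof -
      have "ennreal (chart_mean c K V u) = (\<integral>\<^sup>+x. ennreal (indicator K x * V (pull c u x)) \<partial>lborel)"
        unfolding chart_mean_def using V(2) by (intro nn_integral_eq_integral[symmetric] iK) auto
      also have "\<dots> = (\<integral>\<^sup>+x\<in>K. ennreal (V (u (chart_inv c x))) \<partial>lborel)"
        using K(3) by (intro nn_integral_cong) (auto simp: indicator_def pull_eq subset_iff)
      also have "\<dots> \<le> ennreal (1 / a) * (\<integral>\<^sup>+p. ennreal (V (u p)) \<partial>vol)"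
        by (rule nn_integral_pull_le[OF c(1) K(1,3) a, where f = "\<lambda>p. ennreal (V (u p))"]) (use Vm in simp_all)
      also have "(\<integral>\<^sup>+p. ennreal (V (u p)) \<partial>vol) = ennreal P"
        unfolding P_def using V(2) by (intro nn_integral_eq_integral iV) auto
      also have "ennreal (1 / a) * ennreal P = ennreal (P / a)"
        using a(1) P0 by (simp add: ennreal_mult[symmetric])
      finally show ?thesis using a(1) P0 by (subst (asm) ennreal_le_iff) auto
    qed
    \<comment> \<open>Pointwise, |G(u)| is 1/2 where |u| >= 1/2, and elsewhere V(u) >= v0 makes 1/2
      - V(u)/(2 v0) nonpositive.\<close>
    have "\<kappa> / 2 - chart_mean c K V u / (2 * v0) = (\<integral>x. indicator K x * (1 / 2) - indicator K x * V (pull c u x) / (2 * v0) \<partial>lborel)"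
      using iK(2) K by (simp add: \<kappa>_def chart_mean_def)
    also have "\<dots> \<le> chart_mean c K (\<lambda>s. \<bar>G s\<bar>) u"
      unfolding chart_mean_def
    proof (intro integral_mono iK Bochner_Integration.integrable_diff)
      fix x
      have "1 / 2 - V s / (2 * v0) \<le> \<bar>G s\<bar>" for s
      proof (cases "\<bar>s\<bar> \<le> 1 / 2")
        case True
        then have "v0 / (2 * v0) \<le> V s / (2 * v0)" using V_low v0 by (intro divide_right_mono) auto
        then have "1 / 2 \<le> V s / (2 * v0)" using v0 by simp
        then show ?thesis using abs_ge_zero[of "G s"] by linarith
      next
        case False
        moreover have "0 \<le> V s / (2 * v0)" using V(2)[of s] v0 by simp
        ultimately show ?thesis using G_out[of s] by simp
      qed
      from this[of "pull c u x"] show "indicator K x * (1 / 2) - indicator K x * V (pull c u x) / (2 * v0) \<le> indicator K x * \<bar>G (pull c u x)\<bar>"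
        by (auto simp: indicator_def)
    qed (use iK(2) K in \<open>auto\<close>)
    finally have "\<kappa> / 2 \<le> C2 * (2 + C\<^sup>2 / v0) * E + chart_mean c K V u / (2 * v0)"
      using up by linarith
    also have "chart_mean c K V u / (2 * v0) \<le> (E / a) / (2 * v0)"
      using meanV P_le' a(1) v0 by (intro divide_right_mono order_trans[OF meanV]) auto
    finally have "\<kappa> / 2 \<le> (C2 * (2 + C\<^sup>2 / v0) + 1 / (2 * v0 * a)) * E"
      by (simp add: algebra_simps)
    then show ?thesis unfolding e_def E_def[symmetric] pos_divide_le_eq[OF den] by (simp only: mult.commute)
  qed
  show ?thesis
  proof (rule that[OF e], safe)
    fix \<epsilon> :: real assume \<epsilon>: "0 < \<epsilon>" "\<epsilon> \<le> 1"
    show "ereal e \<le> minmax_value A g V \<epsilon>"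
      unfolding minmax_value_def
    proof (rule INF_greatest)
      fix h assume h: "h \<in> minmax_paths A g"
      have hH: "h t \<in> H1 A g" if "t \<in> {0..1}" for t using h that unfolding minmax_paths_def by blast
      have hL: "L2_fun A g (h t)" if "t \<in> {0..1}" for t
        using hH[OF that] by (auto simp: H1_def has_sobolev_grad_def)
      have ends: "chart_mean c K G (h t) = k * \<kappa> / 2" if t: "t \<in> {0..1}" "AE p in vol. h t p = k" and k: "k = 1 \<or> k = - 1" for t k
      proof -
        have "(\<integral>\<^sup>+p. ennreal \<bar>h t p - k\<bar> \<partial>vol) = (\<integral>\<^sup>+p. 0 \<partial>vol)"
          by (rule nn_integral_cong_AE) (use t(2) in eventually_elim, simp)
        moreover have "ennreal \<bar>chart_mean c K G (h t) - chart_mean c K G (\<lambda>_. k)\<bar> \<le> ennreal (C / a) * (\<integral>\<^sup>+p. ennreal \<bar>h t p - k\<bar> \<partial>vol)"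
          by (rule chart_mean_lipschitz[OF c(1) K a mG(1) G_half G_lip]) (use \<sigma>(2) hL[OF t(1)] in \<open>auto simp: L2_fun_def\<close>)
        ultimately have "chart_mean c K G (h t) = chart_mean c K G (\<lambda>_. k)" by (simp add: ennreal_eq_0_iff)
        also have "\<dots> = G k * \<kappa>" using K by (simp add: chart_mean_def pull_def \<kappa>_def)
        also have "G k = k / 2" using k \<sigma>(3)[of "k + 1 / 2"] \<sigma>(4)[of "k + 1 / 2"] by (auto simp: G_def)
        finally show ?thesis by simp
      qed
      have "continuous_on {0..1} (\<lambda>t. chart_mean c K G (h t))"
        unfolding continuous_on_def
      proof
        fix t :: real assume t: "t \<in> {0..1}"
        let ?F = "at t within {0..1}"
        \<comment> \<open>A path is unconstrained outside [0,1], whereas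
          \<open>chart_mean_tendsto\<close> wants every member of the family in L^2; the values
          outside are therefore frozen at h t.\<close>
        define f where "f = (\<lambda>s. if s \<in> {0..1} then h s else h t)"
        have L2f: "L2_fun A g (f s)" for s using hL t by (simp add: f_def)
        have ev: "eventually (\<lambda>s. s \<in> {0..1}) ?F" by (simp add: eventually_at_filter)
        have "((\<lambda>s. H1_norm A g (\<lambda>p. h s p - h t p)) \<longlongrightarrow> 0) ?F"
          using h t unfolding minmax_paths_def by blast
        then have "((\<lambda>s. (H1_norm A g (\<lambda>p. h s p - h t p))\<^sup>2) \<longlongrightarrow> 0\<^sup>2) ?F"
          by (rule tendsto_power)
        then have H1_lim: "((\<lambda>s. (H1_norm A g (\<lambda>p. h s p - h t p))\<^sup>2) \<longlongrightarrow> 0) ?F"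
          by simp
        have lim: "((\<lambda>s. \<integral>p. (f s p - h t p)\<^sup>2 \<partial>vol) \<longlongrightarrow> 0) ?F"
        proof (rule tendsto_sandwich[OF _ _ tendsto_const H1_lim])
          show "\<forall>\<^sub>F s in ?F. (\<integral>p. (f s p - h t p)\<^sup>2 \<partial>vol) \<le> (H1_norm A g (\<lambda>p. h s p - h t p))\<^sup>2"
            using ev
          proof eventually_elim
            fix s :: real assume s: "s \<in> {0..1}"
            have "(\<lambda>p. h s p - h t p) \<in> H1 A g"
              by (rule has_sobolev_grad_H1[OF has_sobolev_grad_diff[OF has_sobolev_grad_sobolev_grad[OF hH[OF s]]
                      has_sobolev_grad_sobolev_grad[OF hH[OF t]]]])
            from L2_le_H1_norm[OF this] show "(\<integral>p. (f s p - h t p)\<^sup>2 \<partial>vol) \<le> (H1_norm A g (\<lambda>p. h s p - h t p))\<^sup>2"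
              using s by (simp add: f_def)
          qed
        qed simp_all
        have "((\<lambda>s. chart_mean c K G (f s)) \<longlongrightarrow> chart_mean c K G (h t)) ?F"
          by (rule chart_mean_tendsto[OF c(1) K a mG(1) G_half G_lip less_imp_le[OF \<sigma>(2)] L2f hL[OF t] lim])
        then show "((\<lambda>s. chart_mean c K G (h s)) \<longlongrightarrow> chart_mean c K G (h t)) ?F"
          by (rule Lim_transform_eventually) (use ev in eventually_elim, simp add: f_def)
      qed
      moreover have "chart_mean c K G (h 0) \<le> 0" "0 \<le> chart_mean c K G (h 1)"
      proof -
        have "AE p in vol. h 0 p = - 1" "AE p in vol. h 1 p = 1" using h unfolding minmax_paths_def by blast+
        from ends[OF _ this(1)] ends[OF _ this(2)] show "chart_mean c K G (h 0) \<le> 0" "0 \<le> chart_mean c K G (h 1)"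
          using \<kappa> by simp_all
      qed
      ultimately obtain t where t: "0 \<le> t" "t \<le> 1" "chart_mean c K G (h t) = 0"
        using IVT'[of "\<lambda>t. chart_mean c K G (h t)" 0 0 1] by auto
      then have "e \<le> energy A g V \<epsilon> (h t)" using low[OF hH t(3) \<epsilon>] by auto
      then show "ereal e \<le> (SUP t\<in>{0..1}. ereal (energy A g V \<epsilon> (h t)))"
        using t by (intro SUP_upper2[of t]) auto
    qed
  qed
qed

section \<open>The upper bound\<close>

lemma grad_const: "c \<in> A \<Longrightarrow> p \<in> chart_dom c \<Longrightarrow> grad g (\<lambda>p. k) c p = 0"
  using dcoord_eqI[of "\<lambda>p. k" c 0 p] by (simp add: grad_eq o_def)

lemma smooth_fun_affine: "smooth_fun A u \<Longrightarrow> smooth_fun A (\<lambda>p. k - l * u p)"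
  by (intro smooth_fun_diff smooth_fun_mult smooth_fun_const)

lemma norm_sq_grad_affine:
  assumes u: "smooth_fun A u"
  shows "norm_sq A g (grad g (\<lambda>p. k - l * u p)) p = l\<^sup>2 * norm_sq A g (grad g u) p"
proof -
  have "grad g (\<lambda>p. k - l * u p) (chart_at A p) p = (- l) *\<^sub>R grad g u (chart_at A p) p"
    using grad_diff[OF smooth_fun_const smooth_fun_mult[OF smooth_fun_const u] chart_at, of k l]
      grad_mult[OF smooth_fun_const u chart_at, of l] by (simp add: grad_const[OF chart_at])
  then have "norm_sq A g (grad g (\<lambda>p. k - l * u p)) p = norm_sq A g (\<lambda>c q. (- l) *\<^sub>R grad g u c q) p"
    by (rule norm_sq_cong)
  also have "\<dots> = l\<^sup>2 * norm_sq A g (grad g u) p"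
    using norm_sq_scaleR[of "\<lambda>_. - l"] by simp
  finally show ?thesis .
qed

text \<open>
  Each \<open>w t\<close> is a phase transition on the scale \<open>\<epsilon>\<close>. The Lipschitz constant \<open>L\<close>, needed only
  for continuity of the path, may depend on \<open>\<epsilon>\<close>, but \<open>C\<close> must not. The conditions are
  stable under products, which is how local families are combined.
\<close>

definition transition_family :: "real \<Rightarrow> real \<Rightarrow> 'm set \<Rightarrow> (real \<Rightarrow> 'm \<Rightarrow> real) \<Rightarrow> bool" where
  "transition_family \<epsilon> C U w \<longleftrightarrow>
     (\<forall>t\<in>{0..1}. smooth_fun A (w t)) \<and> (\<forall>t\<in>{0..1}. \<forall>p. 0 \<le> w t p \<and> w t p \<le> 1) \<and>
     (\<exists>L\<ge>0. \<forall>t\<in>{0..1}. \<forall>s\<in>{0..1}. \<forall>p. \<bar>w t p - w s p\<bar> \<le> L * \<bar>t - s\<bar> \<and>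
        norm_sq A g (grad g (w t)) p \<le> L\<^sup>2 \<and>
        norm_sq A g (grad g (\<lambda>p. w t p - w s p)) p \<le> (L * \<bar>t - s\<bar>)\<^sup>2) \<and>
     (\<forall>t\<in>{0..1}. \<exists>S\<in>sets borel. emeasure vol S \<le> ennreal (C * \<epsilon>) \<and>
        (\<forall>p. norm_sq A g (grad g (w t)) p \<le> C / \<epsilon>\<^sup>2 * indicator S p) \<and> (\<forall>p. p \<notin> S \<longrightarrow> w t p \<in> {0, 1})) \<and>
     (\<forall>p. w 0 p = 1) \<and> (\<forall>p\<in>U. w 1 p = 0)"

lemma transition_familyD:
  assumes "transition_family \<epsilon> C U w"
  shows "t \<in> {0..1} \<Longrightarrow> smooth_fun A (w t)" "t \<in> {0..1} \<Longrightarrow> 0 \<le> w t p" "t \<in> {0..1} \<Longrightarrow> w t p \<le> 1"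
    and "\<exists>L\<ge>0. \<forall>t\<in>{0..1}. \<forall>s\<in>{0..1}. \<forall>p. \<bar>w t p - w s p\<bar> \<le> L * \<bar>t - s\<bar> \<and>
        norm_sq A g (grad g (w t)) p \<le> L\<^sup>2 \<and>
        norm_sq A g (grad g (\<lambda>p. w t p - w s p)) p \<le> (L * \<bar>t - s\<bar>)\<^sup>2"
    and "t \<in> {0..1} \<Longrightarrow> \<exists>S\<in>sets borel. emeasure vol S \<le> ennreal (C * \<epsilon>) \<and>
        (\<forall>p. norm_sq A g (grad g (w t)) p \<le> C / \<epsilon>\<^sup>2 * indicator S p) \<and> (\<forall>p. p \<notin> S \<longrightarrow> w t p \<in> {0, 1})"
    and "w 0 p = 1" "p \<in> U \<Longrightarrow> w 1 p = 0"
proof -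
  note T = assms[unfolded transition_family_def]
  note T1 = T[THEN conjunct1] and T2 = T[THEN conjunct2]
  note T3 = T2[THEN conjunct1] and T4 = T2[THEN conjunct2]
  note T5 = T4[THEN conjunct1] and T6 = T4[THEN conjunct2]
  show "t \<in> {0..1} \<Longrightarrow> smooth_fun A (w t)" by (rule bspec[OF T1])
  show "t \<in> {0..1} \<Longrightarrow> 0 \<le> w t p" "t \<in> {0..1} \<Longrightarrow> w t p \<le> 1" using T3 by blast+
  show "\<exists>L\<ge>0. \<forall>t\<in>{0..1}. \<forall>s\<in>{0..1}. \<forall>p. \<bar>w t p - w s p\<bar> \<le> L * \<bar>t - s\<bar> \<and>
        norm_sq A g (grad g (w t)) p \<le> L\<^sup>2 \<and>
        norm_sq A g (grad g (\<lambda>p. w t p - w s p)) p \<le> (L * \<bar>t - s\<bar>)\<^sup>2" by (rule T5)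
  show "t \<in> {0..1} \<Longrightarrow> \<exists>S\<in>sets borel. emeasure vol S \<le> ennreal (C * \<epsilon>) \<and>
        (\<forall>p. norm_sq A g (grad g (w t)) p \<le> C / \<epsilon>\<^sup>2 * indicator S p) \<and> (\<forall>p. p \<notin> S \<longrightarrow> w t p \<in> {0, 1})"
    by (rule bspec[OF T6[THEN conjunct1]])
  show "w 0 p = 1" "p \<in> U \<Longrightarrow> w 1 p = 0" using T6[THEN conjunct2] by blast+
qed

lemma norm_sq_grad_mult_le:
  assumes u: "smooth_fun A u" and v: "smooth_fun A v" and bd: "\<bar>u p\<bar> \<le> 1" "\<bar>v p\<bar> \<le> 1"
  shows "norm_sq A g (grad g (\<lambda>p. u p * v p)) p \<le> 2 * norm_sq A g (grad g u) p + 2 * norm_sq A g (grad g v) p"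
proof -
  have "norm_sq A g (grad g (\<lambda>p. u p * v p)) p = norm_sq A g (\<lambda>c q. v q *\<^sub>R grad g u c q + u q *\<^sub>R grad g v c q) p"
    by (rule norm_sq_cong) (simp add: grad_mult[OF u v chart_at])
  also have "\<dots> \<le> 2 * ((v p)\<^sup>2 * norm_sq A g (grad g u) p) + 2 * ((u p)\<^sup>2 * norm_sq A g (grad g v) p)"
    using norm_sq_add_le[of "\<lambda>c q. v q *\<^sub>R grad g u c q" "\<lambda>c q. u q *\<^sub>R grad g v c q" p]
    by (simp only: norm_sq_scaleR)
  also have "\<dots> \<le> 2 * (1 * norm_sq A g (grad g u) p) + 2 * (1 * norm_sq A g (grad g v) p)"
    using bd by (intro add_mono mult_left_mono mult_right_mono) (auto simp: abs_square_le_1)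
  finally show ?thesis by simp
qed

text \<open>The gradient of uv - u'v' is regrouped as (u - u') grad v + u' grad (v - v') plus the
  same with the roles exchanged, so that every term contains one difference. It provides continuity
  in t of products of families.\<close>

lemma norm_sq_grad_mult_diff_le:
  assumes u: "smooth_fun A u" "smooth_fun A u'" and v: "smooth_fun A v" "smooth_fun A v'"
    and bd: "\<bar>u' p\<bar> \<le> 1" "\<bar>v' p\<bar> \<le> 1"
    and uv: "\<bar>u p - u' p\<bar> \<le> a" "\<bar>v p - v' p\<bar> \<le> b"
  shows "norm_sq A g (grad g (\<lambda>p. u p * v p - u' p * v' p)) p
    \<le> 4 * (a\<^sup>2 * norm_sq A g (grad g v) p + norm_sq A g (grad g (\<lambda>p. v p - v' p)) p)
      + 4 * (b\<^sup>2 * norm_sq A g (grad g u) p + norm_sq A g (grad g (\<lambda>p. u p - u' p)) p)"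
proof -
  let ?n = "\<lambda>X. norm_sq A g X p"
  let ?X1 = "\<lambda>c q. (u q - u' q) *\<^sub>R grad g v c q" and ?X2 = "\<lambda>c q. u' q *\<^sub>R grad g (\<lambda>p. v p - v' p) c q"
  let ?X3 = "\<lambda>c q. (v q - v' q) *\<^sub>R grad g u c q" and ?X4 = "\<lambda>c q. v' q *\<^sub>R grad g (\<lambda>p. u p - u' p) c q"
  have "?n (grad g (\<lambda>p. u p * v p - u' p * v' p)) = ?n (\<lambda>c q. (?X1 c q + ?X2 c q) + (?X3 c q + ?X4 c q))"
    by (rule norm_sq_cong)
       (simp add: grad_diff[OF smooth_fun_mult smooth_fun_mult chart_at] grad_mult[OF _ _ chart_at]
          grad_diff[OF _ _ chart_at] u v algebra_simps)
  also have "\<dots> \<le> 2 * ?n (\<lambda>c q. ?X1 c q + ?X2 c q) + 2 * ?n (\<lambda>c q. ?X3 c q + ?X4 c q)"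
    by (rule norm_sq_add_le)
  also have "\<dots> \<le> 2 * (2 * ?n ?X1 + 2 * ?n ?X2) + 2 * (2 * ?n ?X3 + 2 * ?n ?X4)"
    by (intro add_mono mult_left_mono norm_sq_add_le) auto
  also have "\<dots> = 4 * (?n ?X1 + ?n ?X2) + 4 * (?n ?X3 + ?n ?X4)" by simp
  also have "\<dots> \<le> 4 * (a\<^sup>2 * ?n (grad g v) + 1 * ?n (grad g (\<lambda>p. v p - v' p)))
      + 4 * (b\<^sup>2 * ?n (grad g u) + 1 * ?n (grad g (\<lambda>p. u p - u' p)))"
    unfolding norm_sq_scaleR
    using bd power_mono[OF uv(1), of 2] power_mono[OF uv(2), of 2]
    by (intro add_mono mult_left_mono mult_right_mono) (auto simp: abs_square_le_1)
  finally show ?thesis by simp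
qed

text \<open>The union of the two layers is a layer for the product: outside it both factors are 0 or
  1 with vanishing gradient. The product vanishes where either factor does, so the sets cleared at
  time 1 are united. The factor 2 in the constant comes from
  \<open>norm_sq_grad_mult_le\<close>.\<close>

lemma transition_family_mult:
  assumes w: "transition_family \<epsilon> C U w" and w': "transition_family \<epsilon> C' U' w'"
    and pos: "0 \<le> C" "0 \<le> C'" "0 < \<epsilon>"
  shows "transition_family \<epsilon> (2 * (C + C')) (U \<union> U') (\<lambda>t p. w t p * w' t p)"
proof -
  note wD = transition_familyD[OF w] and wD' = transition_familyD[OF w']
  note sm = wD(1) wD'(1) and bd = wD(2,3) wD'(2,3)
  have abd: "\<bar>w t p\<bar> \<le> 1" "\<bar>w' t p\<bar> \<le> 1" if "t \<in> {0..1}" for t p using bd[OF that, of p] by auto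
  obtain L where L: "0 \<le> L" "\<forall>t\<in>{0..1}. \<forall>s\<in>{0..1}. \<forall>p. \<bar>w t p - w s p\<bar> \<le> L * \<bar>t - s\<bar> \<and>
        norm_sq A g (grad g (w t)) p \<le> L\<^sup>2 \<and> norm_sq A g (grad g (\<lambda>p. w t p - w s p)) p \<le> (L * \<bar>t - s\<bar>)\<^sup>2"
    using wD(4) by blast
  obtain L' where L': "0 \<le> L'" "\<forall>t\<in>{0..1}. \<forall>s\<in>{0..1}. \<forall>p. \<bar>w' t p - w' s p\<bar> \<le> L' * \<bar>t - s\<bar> \<and>
        norm_sq A g (grad g (w' t)) p \<le> L'\<^sup>2 \<and> norm_sq A g (grad g (\<lambda>p. w' t p - w' s p)) p \<le> (L' * \<bar>t - s\<bar>)\<^sup>2"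
    using wD'(4) by blast
  \<comment> \<open>Generous enough that its square dominates both quadratic expressions in M1 and
    M2, and M itself dominates L + L'.\<close>
  define M where "M = 2 * (L + L' + 2 * (L * L'))"
  have LL: "0 \<le> L * L'" using L(1) L'(1) by simp
  have M0: "0 \<le> M" using L(1) L'(1) LL by (simp add: M_def)
  have M1: "2 * L\<^sup>2 + 2 * L'\<^sup>2 \<le> M\<^sup>2" and M2: "8 * (L\<^sup>2 * L'\<^sup>2) + 4 * L\<^sup>2 + 4 * L'\<^sup>2 \<le> M\<^sup>2"
  proof -
    have "M\<^sup>2 = 4 * L\<^sup>2 + 4 * L'\<^sup>2 + 16 * (L * L')\<^sup>2 + 8 * (L * L') + 16 * (L * (L * L')) + 16 * (L' * (L * L'))"
      by (simp add: M_def power2_eq_square algebra_simps)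
    moreover have "0 \<le> L * (L * L')" "0 \<le> L' * (L * L')" using L(1) L'(1) by simp_all
    ultimately show "2 * L\<^sup>2 + 2 * L'\<^sup>2 \<le> M\<^sup>2" "8 * (L\<^sup>2 * L'\<^sup>2) + 4 * L\<^sup>2 + 4 * L'\<^sup>2 \<le> M\<^sup>2"
      using LL zero_le_power2[of L] zero_le_power2[of L'] zero_le_power2[of "L * L'"] by (simp_all add: power_mult_distrib)
  qed
  have lip: "\<bar>w t p * w' t p - w s p * w' s p\<bar> \<le> M * \<bar>t - s\<bar>"
    "norm_sq A g (grad g (\<lambda>p. w t p * w' t p)) p \<le> M\<^sup>2"
    "norm_sq A g (grad g (\<lambda>p. w t p * w' t p - w s p * w' s p)) p \<le> (M * \<bar>t - s\<bar>)\<^sup>2"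
    if t: "t \<in> {0..1}" and s: "s \<in> {0..1}" for t s p
  proof -
    let ?d = "\<bar>t - s\<bar>"
    have d1: "\<bar>w t p - w s p\<bar> \<le> L * ?d" "\<bar>w' t p - w' s p\<bar> \<le> L' * ?d"
      and d2: "norm_sq A g (grad g (w t)) p \<le> L\<^sup>2" "norm_sq A g (grad g (w' t)) p \<le> L'\<^sup>2"
      and d3: "norm_sq A g (grad g (\<lambda>p. w t p - w s p)) p \<le> (L * ?d)\<^sup>2" "norm_sq A g (grad g (\<lambda>p. w' t p - w' s p)) p \<le> (L' * ?d)\<^sup>2"
      using L(2) L'(2) t s by blast+
    have "w t p * w' t p - w s p * w' s p = (w t p - w s p) * w' t p + w s p * (w' t p - w' s p)"
      by (simp add: algebra_simps)
    then have "\<bar>w t p * w' t p - w s p * w' s p\<bar> \<le> \<bar>w t p - w s p\<bar> * \<bar>w' t p\<bar> + \<bar>w s p\<bar> * \<bar>w' t p - w' s p\<bar>"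
      by (metis abs_mult abs_triangle_ineq)
    also have "\<dots> \<le> L * ?d * 1 + 1 * (L' * ?d)"
      using d1 abd[OF t] abd[OF s] L(1) L'(1) by (intro add_mono mult_mono) auto
    also have "\<dots> = (L + L') * ?d" by (simp add: algebra_simps)
    also have "\<dots> \<le> M * ?d" using L(1) L'(1) LL by (intro mult_right_mono) (auto simp: M_def)
    finally show "\<bar>w t p * w' t p - w s p * w' s p\<bar> \<le> M * ?d" .
    show "norm_sq A g (grad g (\<lambda>p. w t p * w' t p)) p \<le> M\<^sup>2"
      using norm_sq_grad_mult_le[OF sm[OF t] abd[OF t]] d2 M1 by (smt (verit))
    have "norm_sq A g (grad g (\<lambda>p. w t p * w' t p - w s p * w' s p)) p
      \<le> 4 * ((L * ?d)\<^sup>2 * norm_sq A g (grad g (w' t)) p + norm_sq A g (grad g (\<lambda>p. w' t p - w' s p)) p)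
      + 4 * ((L' * ?d)\<^sup>2 * norm_sq A g (grad g (w t)) p + norm_sq A g (grad g (\<lambda>p. w t p - w s p)) p)"
      by (rule norm_sq_grad_mult_diff_le[OF sm(1)[OF t] sm(1)[OF s] sm(2)[OF t] sm(2)[OF s] abd[OF s] d1])
    also have "\<dots> \<le> 4 * ((L * ?d)\<^sup>2 * L'\<^sup>2 + (L' * ?d)\<^sup>2) + 4 * ((L' * ?d)\<^sup>2 * L\<^sup>2 + (L * ?d)\<^sup>2)"
      by (intro add_mono mult_left_mono d2 d3) auto
    also have "\<dots> = (8 * (L\<^sup>2 * L'\<^sup>2) + 4 * L\<^sup>2 + 4 * L'\<^sup>2) * ?d\<^sup>2"
      unfolding power_mult_distrib by (simp add: algebra_simps)
    also have "\<dots> \<le> M\<^sup>2 * ?d\<^sup>2" by (intro mult_right_mono M2) simp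
    finally show "norm_sq A g (grad g (\<lambda>p. w t p * w' t p - w s p * w' s p)) p \<le> (M * ?d)\<^sup>2"
      by (simp only: power_mult_distrib)
  qed
  have shell: "\<exists>S\<in>sets borel. emeasure vol S \<le> ennreal (2 * (C + C') * \<epsilon>) \<and>
        (\<forall>p. norm_sq A g (grad g (\<lambda>p. w t p * w' t p)) p \<le> 2 * (C + C') / \<epsilon>\<^sup>2 * indicator S p) \<and>
        (\<forall>p. p \<notin> S \<longrightarrow> w t p * w' t p \<in> {0, 1})"
    if t: "t \<in> {0..1}" for t
  proof -
    obtain S where S: "S \<in> sets borel" "emeasure vol S \<le> ennreal (C * \<epsilon>)"
      "\<forall>p. norm_sq A g (grad g (w t)) p \<le> C / \<epsilon>\<^sup>2 * indicator S p" "\<forall>p. p \<notin> S \<longrightarrow> w t p \<in> {0, 1}"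
      using wD(5)[OF t] by blast
    obtain S' where S': "S' \<in> sets borel" "emeasure vol S' \<le> ennreal (C' * \<epsilon>)"
      "\<forall>p. norm_sq A g (grad g (w' t)) p \<le> C' / \<epsilon>\<^sup>2 * indicator S' p" "\<forall>p. p \<notin> S' \<longrightarrow> w' t p \<in> {0, 1}"
      using wD'(5)[OF t] by blast
    have CC: "0 \<le> C / \<epsilon>\<^sup>2" "0 \<le> C' / \<epsilon>\<^sup>2" "0 \<le> C * \<epsilon>" "0 \<le> C' * \<epsilon>" using pos by auto
    show ?thesis
    proof (intro bexI[of _ "S \<union> S'"] conjI allI impI)
      have "emeasure vol (S \<union> S') \<le> emeasure vol S + emeasure vol S'"
        using S(1) S'(1) by (intro emeasure_subadditive) auto
      also have "\<dots> \<le> ennreal (C * \<epsilon>) + ennreal (C' * \<epsilon>)" by (intro add_mono S(2) S'(2))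
      also have "\<dots> = ennreal (C * \<epsilon> + C' * \<epsilon>)" using CC by simp
      also have "\<dots> \<le> ennreal (2 * (C + C') * \<epsilon>)" using CC by (intro ennreal_leI) (simp add: algebra_simps)
      finally show "emeasure vol (S \<union> S') \<le> ennreal (2 * (C + C') * \<epsilon>)" .
      show "norm_sq A g (grad g (\<lambda>p. w t p * w' t p)) p \<le> 2 * (C + C') / \<epsilon>\<^sup>2 * indicator (S \<union> S') p" for p
      proof -
        have "norm_sq A g (grad g (\<lambda>p. w t p * w' t p)) p \<le> 2 * norm_sq A g (grad g (w t)) p + 2 * norm_sq A g (grad g (w' t)) p"
          by (rule norm_sq_grad_mult_le[OF sm[OF t] abd[OF t]])
        also have "\<dots> \<le> 2 * (C / \<epsilon>\<^sup>2 * indicator S p) + 2 * (C' / \<epsilon>\<^sup>2 * indicator S' p)"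
          using S(3) S'(3) by (intro add_mono mult_left_mono) auto
        also have "\<dots> \<le> 2 * (C / \<epsilon>\<^sup>2 * indicator (S \<union> S') p) + 2 * (C' / \<epsilon>\<^sup>2 * indicator (S \<union> S') p)"
          using CC by (intro add_mono mult_left_mono) (auto simp: indicator_def)
        also have "\<dots> = 2 * (C + C') / \<epsilon>\<^sup>2 * indicator (S \<union> S') p"
          by (simp add: add_divide_distrib algebra_simps)
        finally show ?thesis .
      qed
      show "w t p * w' t p \<in> {0, 1}" if "p \<notin> S \<union> S'" for p
        using that S(4) S'(4) by fastforce
    qed (use S(1) S'(1) in auto)
  qed
  show ?thesis
    unfolding transition_family_def
  proof (intro conjI)
    show "\<forall>t\<in>{0..1}. smooth_fun A (\<lambda>p. w t p * w' t p)"
      using sm smooth_fun_mult by blast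
    show "\<forall>t\<in>{0..1}. \<forall>p. 0 \<le> w t p * w' t p \<and> w t p * w' t p \<le> 1"
      using bd by (simp add: mult_le_one)
    show "\<exists>L\<ge>0. \<forall>t\<in>{0..1}. \<forall>s\<in>{0..1}. \<forall>p. \<bar>w t p * w' t p - w s p * w' s p\<bar> \<le> L * \<bar>t - s\<bar> \<and>
        norm_sq A g (grad g (\<lambda>p. w t p * w' t p)) p \<le> L\<^sup>2 \<and>
        norm_sq A g (grad g (\<lambda>p. w t p * w' t p - w s p * w' s p)) p \<le> (L * \<bar>t - s\<bar>)\<^sup>2"
      using M0 lip by blast
    show "\<forall>t\<in>{0..1}. \<exists>S\<in>sets borel. emeasure vol S \<le> ennreal (2 * (C + C') * \<epsilon>) \<and>
        (\<forall>p. norm_sq A g (grad g (\<lambda>p. w t p * w' t p)) p \<le> 2 * (C + C') / \<epsilon>\<^sup>2 * indicator S p) \<and>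
        (\<forall>p. p \<notin> S \<longrightarrow> w t p * w' t p \<in> {0, 1})"
      using shell by blast
    show "\<forall>p. w 0 p * w' 0 p = 1" using wD(6) wD'(6) by simp
    show "\<forall>p\<in>U \<union> U'. w 1 p * w' 1 p = 0" using wD(7) wD'(7) by auto
  qed
qed

section \<open>Cutoffs sweeping a coordinate ball\<close>

text \<open>The preimage of \<open>K\<close> is compact, hence closed in the Hausdorff space
  \<open>M\<close>. A point outside the chart domain thus has a neighbourhood on which the extension
  is 0, and elsewhere smoothness is that of f composed with a transition map.\<close>

lemma smooth_fun_chart_extension:
  assumes c: "c \<in> A" and K: "compact K" "K \<subseteq> chart_img c"
    and f: "\<And>k. Ck_on k UNIV f" "\<And>x. x \<notin> K \<Longrightarrow> f x = (0 :: real)"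
  shows "smooth_fun A (\<lambda>p. if p \<in> chart_dom c then f (snd c p) else 0)" (is "smooth_fun A ?u")
  unfolding smooth_fun_def smooth_on_def
proof (intro ballI allI)
  fix d k assume d: "d \<in> A"
  show "Ck_on k (chart_img d) (?u \<circ> chart_inv d)"
  proof (rule Ck_on_local[OF open_img[OF d]])
    fix x assume x: "x \<in> chart_img d"
    show "\<exists>T. open T \<and> x \<in> T \<and> Ck_on k T (?u \<circ> chart_inv d)"
    proof (cases "chart_inv d x \<in> chart_dom c")
      case True
      let ?T = "snd d ` (chart_dom c \<inter> chart_dom d)"
      have oT: "open ?T" by (rule open_chart_image[OF d open_dom[OF c]])
      have T: "y \<in> chart_img d" "chart_inv d y \<in> chart_dom c" if "y \<in> ?T" for y
        using that chart_inv_chart[OF d] by auto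
      have "Ck_on k ?T (transition d c)"
        using atlas c d unfolding smooth_atlas_def smooth_on_def by (metis Int_commute)
      then have "Ck_on k ?T (\<lambda>y. f (transition d c y))"
        by (rule Ck_on_compose[OF oT open_UNIV subset_UNIV _ f(1)])
      then have "Ck_on k ?T (?u \<circ> chart_inv d)"
        by (rule Ck_on_cong[OF oT, rotated]) (simp add: transition_def T)
      moreover have "x \<in> ?T"
        using True x chart_inv_dom[OF d x] chart_chart_inv[OF d x] by (intro image_eqI[of _ _ "chart_inv d x"]) auto
      ultimately show ?thesis using oT by blast
    next
      case False
      let ?T = "snd d ` (- (chart_inv c ` K) \<inter> chart_dom d)"
      have "closed (chart_inv c ` K)"
        by (rule compact_imp_closed[OF compact_chart_inv_image[OF c K]])
      then have oT: "open ?T" by (intro open_chart_image[OF d]) auto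
      have "chart_inv d x \<notin> chart_inv c ` K"
      proof
        assume "chart_inv d x \<in> chart_inv c ` K"
        then obtain y where "chart_inv d x = chart_inv c y" "y \<in> K" by (rule imageE)
        then show False using False K(2) chart_inv_dom[OF c, of y] by auto
      qed
      then have "x \<in> ?T"
        using chart_inv_dom[OF d x] chart_chart_inv[OF d x] by (intro image_eqI[of _ _ "chart_inv d x"]) auto
      moreover have "Ck_on k ?T (?u \<circ> chart_inv d)"
      proof (rule Ck_on_cong[OF oT _ Ck_on_const[OF oT]])
        fix y assume "y \<in> ?T"
        then obtain p where p: "p \<notin> chart_inv c ` K" "p \<in> chart_dom d" "y = snd d p" by blast
        have "f (snd c p) = 0" if "p \<in> chart_dom c"
        proof (rule f(2))
          show "snd c p \<notin> K" using p(1) chart_inv_chart[OF c that] by (metis imageI)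
        qed
        then show "0 = (?u \<circ> chart_inv d) y" using p chart_inv_chart[OF d p(2)] by simp
      qed
      ultimately show ?thesis using oT by blast
    qed
  qed
qed

text \<open>With X the gradient and D the Euclidean one, gX = D gives |X|_g^2 = X . D. Ellipticity
  yields a |X|^2 <= |X| |D|, so |X| <= |D| / a and X . D <= |D|^2 / a.\<close>

lemma norm_sq_grad_chart_extension_le:
  assumes c: "c \<in> A" and K: "compact K" "K \<subseteq> chart_img c"
    and f: "\<And>k. Ck_on k UNIV f" "\<And>x. x \<notin> K \<Longrightarrow> f x = (0 :: real)"
    and D: "\<And>x. (f has_derivative (\<lambda>v. D x \<bullet> v)) (at x)"
    and a: "0 < a" "\<And>x v. x \<in> K \<Longrightarrow> a * (norm v)\<^sup>2 \<le> v \<bullet> (g c (chart_inv c x) *v v)"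
  shows "norm_sq A g (grad g (\<lambda>p. if p \<in> chart_dom c then f (snd c p) else 0)) p
    \<le> (if p \<in> chart_inv c ` K then (norm (D (snd c p)))\<^sup>2 / a else 0)"
proof -
  let ?u = "\<lambda>p. if p \<in> chart_dom c then f (snd c p) else 0"
  have u: "smooth_fun A ?u" by (rule smooth_fun_chart_extension[OF c K f])
  show ?thesis
  proof (cases "p \<in> chart_inv c ` K")
    case True
    then obtain x where x: "x \<in> K" "p = chart_inv c x" by blast
    then have xi: "x \<in> chart_img c" using K(2) by blast
    have p: "p \<in> chart_dom c" "snd c p = x" unfolding x(2) by (rule chart_inv_dom[OF c xi], rule chart_chart_inv[OF c xi])
    have "(?u \<circ> chart_inv c has_derivative (\<lambda>v. D x \<bullet> v)) (at x)"
      by (rule has_derivative_transform_within_open[OF D open_img[OF c] xi])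
         (use chart_inv_dom[OF c] chart_chart_inv[OF c] in simp)
    then have dc: "dcoord ?u c p = D x" by (intro dcoord_eqI) (simp add: p(2))
    define X where "X = grad g ?u c p"
    have gX: "g c p *v X = D x" unfolding X_def metric_grad[OF c p(1)] by (rule dc)
    have n: "norm_sq A g (grad g ?u) p = X \<bullet> D x"
      unfolding norm_sq_chart[OF tensorial_grad[OF u] c p(1)] X_def[symmetric] gX ..
    have le: "a * (norm X)\<^sup>2 \<le> norm X * norm (D x)"
      using a(2)[OF x(1), of X] norm_cauchy_schwarz[of X "D x"] gX by (simp add: x(2))
    have "norm X \<le> norm (D x) / a"
    proof (cases "X = 0")
      case False
      then have "norm X * (a * norm X) \<le> norm X * norm (D x)" using le by (simp add: power2_eq_square mult_ac)
      then have "a * norm X \<le> norm (D x)" using False by simp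
      then show ?thesis using a(1) by (simp add: field_simps)
    qed (use a(1) in simp)
    then have "norm X * norm (D x) \<le> norm (D x) / a * norm (D x)" by (intro mult_right_mono) auto
    then have "X \<bullet> D x \<le> (norm (D x))\<^sup>2 / a"
      using norm_cauchy_schwarz[of X "D x"] by (simp add: power2_eq_square)
    then show ?thesis using True n p(2) by simp
  next
    case False
    let ?d = "chart_at A p" let ?T = "snd ?d ` (- (chart_inv c ` K) \<inter> chart_dom ?d)"
    note d = chart_at[of p]
    have "closed (chart_inv c ` K)"
      by (rule compact_imp_closed[OF compact_chart_inv_image[OF c K]])
    then have oT: "open ?T" by (intro open_chart_image[OF d(1)]) auto
    have "((\<lambda>x. 0) has_derivative (\<lambda>v. 0)) (at (snd ?d p))" by simp
    then have "(?u \<circ> chart_inv ?d has_derivative (\<lambda>v. 0)) (at (snd ?d p))"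
    proof (rule has_derivative_transform_within_open[OF _ oT])
      show "snd ?d p \<in> ?T" using False d(2) by blast
      fix y assume "y \<in> ?T"
      then obtain q where q: "q \<notin> chart_inv c ` K" "q \<in> chart_dom ?d" "y = snd ?d q" by blast
      have "f (snd c q) = 0" if "q \<in> chart_dom c"
      proof (rule f(2))
        show "snd c q \<notin> K" using q(1) chart_inv_chart[OF c that] by (metis imageI)
      qed
      then show "0 = (?u \<circ> chart_inv ?d) y" using q chart_inv_chart[OF d(1) q(2)] by simp
    qed
    then have "dcoord ?u ?d p = 0" by (intro dcoord_eqI) simp
    then have "norm_sq A g (grad g ?u) p = 0" by (simp add: norm_sq_eq_0_iff grad_eq)
    then show ?thesis using False by simp
  qed
qed

text \<open>With \<sigma> the smooth step, w_t(x) = 1 - \<sigma>((t r^2 - |x - y|^2) / \<epsilon>):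
  it is 1 where |x - y|^2 >= t r^2 and 0 where |x - y|^2 <= t r^2 - \<epsilon>. At t = 0 it is 1
  everywhere, and for every t in [0,1] it equals 1 off the closed ball, so it extends to
  \<open>M\<close>.\<close>

lemma ball_transition_family:
  assumes c: "c \<in> A" and r: "0 < r" "cball y r \<subseteq> chart_img c" and dim: "2 \<le> CARD('n)"
  shows "\<exists>C\<ge>0. \<exists>\<epsilon>0>0. \<forall>\<epsilon>. 0 < \<epsilon> \<longrightarrow> \<epsilon> \<le> \<epsilon>0 \<longrightarrow>
    (\<exists>w. transition_family \<epsilon> C (chart_inv c ` ball y (r / 2)) w)"
proof -
  let ?K = "cball y r" let ?n = "DIM(real ^ 'n)"
  obtain a b where ab: "0 < a" "0 < b"
    "\<And>x v. x \<in> ?K \<Longrightarrow> a * (norm v)\<^sup>2 \<le> v \<bullet> (g c (chart_inv c x) *v v)"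
    "\<And>x. x \<in> ?K \<Longrightarrow> dens c x \<le> b"
    using metric_bounds[OF c compact_cball r(2)] unfolding dens_def by metis
  obtain \<sigma> \<sigma>' :: "real \<Rightarrow> real" and M where \<sigma>: "smooth_on UNIV \<sigma>" "\<And>x. (\<sigma> has_real_derivative \<sigma>' x) (at x)" "0 < M"
    "\<And>x. x \<le> 0 \<Longrightarrow> \<sigma> x = 0" "\<And>x. 1 \<le> x \<Longrightarrow> \<sigma> x = 1" "\<And>x. 0 \<le> \<sigma> x" "\<And>x. \<sigma> x \<le> 1"
    "\<And>x. x \<le> 0 \<or> 1 \<le> x \<Longrightarrow> \<sigma>' x = 0" "\<And>x. \<bar>\<sigma>' x\<bar> \<le> M"
    "\<And>x y. \<bar>\<sigma> x - \<sigma> y\<bar> \<le> M * \<bar>x - y\<bar>" "\<And>x y. \<bar>\<sigma>' x - \<sigma>' y\<bar> \<le> M * \<bar>x - y\<bar>"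
    by (rule smooth_step) blast
  \<comment> \<open>C1 accounts for the volume of a layer, C2 for the squared gradient up to the
    factor 1 / \<epsilon>^2; neither involves \<epsilon>.\<close>
  define C1 where "C1 = b * (unit_ball_vol ?n * ?n * r ^ (?n - 2))"
  define C2 where "C2 = (2 * M * r)\<^sup>2 / a"
  have C: "0 \<le> C1" "0 \<le> C2" using ab r(1) by (simp_all add: C1_def C2_def)
  \<comment> \<open>At t = 1 the half ball must be fully cleared: there |x - y|^2 <= r^2 / 4, so
    \<epsilon> <= r^2 - r^2 / 4 is needed, and r^2 / 2 is a convenient smaller threshold.\<close>
  have main: "\<exists>w. transition_family \<epsilon> (C1 + C2) (chart_inv c ` ball y (r / 2)) w"
    if \<epsilon>: "0 < \<epsilon>" "\<epsilon> \<le> r\<^sup>2 / 2" for \<epsilon>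
  proof -
    define q where "q = (\<lambda>x. (x - y) \<bullet> (x - y))"
    have q_dist: "q x = (dist y x)\<^sup>2" for x
      by (simp add: q_def dist_norm norm_minus_commute power2_norm_eq_inner[symmetric])
    define arg where "arg = (\<lambda>t x. (t * r\<^sup>2 - q x) * (1 / \<epsilon>))"
    define f where "f = (\<lambda>t x. \<sigma> (arg t x))"
    define D where "D = (\<lambda>t x. (\<sigma>' (arg t x) * (- 2 / \<epsilon>)) *\<^sub>R (x - y))"
    \<comment> \<open>The inner product is expanded into a sum over coordinates, which turns the
      squared distance into sums and products of affine functions.\<close>
    have Ck_arg: "Ck_on k UNIV (arg t)" for k t
      unfolding arg_def q_def euclidean_inner[of "_ - y" "_ - y"]
      by (intro Ck_on_mult Ck_on_diff Ck_on_const Ck_on_sum Ck_on_bounded_linear[OF _ bounded_linear_inner_left]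
          Ck_on_bounded_linear_self bounded_linear_ident open_UNIV)
    have Ck_f: "Ck_on k UNIV (f t)" for k t
      unfolding f_def using \<sigma>(1)
      by (intro Ck_on_compose[OF open_UNIV open_UNIV subset_UNIV Ck_arg]) (simp add: smooth_on_def)
    have der_f: "(f t has_derivative (\<lambda>v. D t x \<bullet> v)) (at x)" for t x
    proof -
      have "(arg t has_derivative (\<lambda>v. - 2 / \<epsilon> * ((x - y) \<bullet> v))) (at x)"
        unfolding arg_def q_def using \<epsilon>(1) by (auto intro!: derivative_eq_intros simp: inner_commute field_simps)
      moreover have "(\<sigma> has_derivative (*) (\<sigma>' (arg t x))) (at (arg t x))"
        using \<sigma>(2) by (simp add: has_field_derivative_def)
      ultimately have "((\<lambda>x. \<sigma> (arg t x)) has_derivative (\<lambda>v. \<sigma>' (arg t x) * (- 2 / \<epsilon> * ((x - y) \<bullet> v)))) (at x)"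
        by (rule has_derivative_compose)
      then show ?thesis by (simp add: f_def D_def mult_ac)
    qed
    have f0: "f t x = 0" if "x \<notin> ?K" "t \<in> {0..1}" for t x
    proof -
      have "r\<^sup>2 \<le> q x" using that(1) r(1) unfolding q_dist by (intro power_mono) auto
      moreover have "t * r\<^sup>2 \<le> r\<^sup>2" using that(2) by (simp add: mult_left_le_one_le)
      ultimately have "arg t x \<le> 0" using \<epsilon>(1) by (simp add: arg_def divide_nonpos_pos)
      then show ?thesis by (simp add: f_def \<sigma>(4))
    qed
    define ext where "ext = (\<lambda>h p. if p \<in> chart_dom c then h (snd c p) else (0 :: real))"
    \<comment> \<open>The redundant factor 1 matches the shape k - l * u of
      \<open>smooth_fun_affine\<close> and \<open>norm_sq_grad_affine\<close>.\<close>
    define w where "w = (\<lambda>t p. 1 - 1 * ext (f t) p)"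
    have sm_ext: "smooth_fun A (ext (f t))" if "t \<in> {0..1}" for t
      unfolding ext_def by (rule smooth_fun_chart_extension[OF c compact_cball r(2) Ck_f f0[OF _ that]])
    have sm: "smooth_fun A (w t)" if "t \<in> {0..1}" for t
      unfolding w_def by (rule smooth_fun_affine[OF sm_ext[OF that]])
    have nsq_w: "norm_sq A g (grad g (w t)) p \<le> (if p \<in> chart_inv c ` ?K then (norm (D t (snd c p)))\<^sup>2 / a else 0)"
      if t: "t \<in> {0..1}" for t p
    proof -
      have "norm_sq A g (grad g (w t)) p = norm_sq A g (grad g (ext (f t))) p"
        unfolding w_def norm_sq_grad_affine[OF sm_ext[OF t]] by simp
      also have "\<dots> \<le> (if p \<in> chart_inv c ` ?K then (norm (D t (snd c p)))\<^sup>2 / a else 0)"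
        unfolding ext_def
        by (rule norm_sq_grad_chart_extension_le[OF c compact_cball r(2) Ck_f f0[OF _ t] der_f ab(1,3)])
      finally show ?thesis .
    qed
    have nx: "norm (x - y) \<le> r" if "x \<in> ?K" for x
      using that by (simp add: dist_norm norm_minus_commute)
    have D_bd: "norm (D t x) \<le> 2 * M * r / \<epsilon>" if "x \<in> ?K" for t x
    proof -
      have "norm (D t x) = \<bar>\<sigma>' (arg t x)\<bar> * (2 / \<epsilon>) * norm (x - y)"
        using \<epsilon>(1) by (simp add: D_def abs_mult)
      also have "\<dots> \<le> M * (2 / \<epsilon>) * r"
        using \<epsilon>(1) \<sigma>(3) by (intro mult_mono \<sigma>(9) nx that) auto
      finally show ?thesis by (simp add: mult_ac)
    qed
    have arg_diff: "\<bar>arg t x - arg s x\<bar> = r\<^sup>2 / \<epsilon> * \<bar>t - s\<bar>" for t s x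
    proof -
      have "arg t x - arg s x = r\<^sup>2 / \<epsilon> * (t - s)" using \<epsilon>(1) by (simp add: arg_def field_simps)
      then show ?thesis using \<epsilon>(1) by (simp add: abs_mult)
    qed
    have D_diff: "norm (D t x - D s x) \<le> 2 * M * r ^ 3 / \<epsilon>\<^sup>2 * \<bar>t - s\<bar>" if "x \<in> ?K" for t s x
    proof -
      have "D t x - D s x = ((\<sigma>' (arg t x) - \<sigma>' (arg s x)) * (- 2 / \<epsilon>)) *\<^sub>R (x - y)"
        by (simp only: D_def left_diff_distrib scaleR_diff_left)
      then have "norm (D t x - D s x) = \<bar>\<sigma>' (arg t x) - \<sigma>' (arg s x)\<bar> * (2 / \<epsilon>) * norm (x - y)"
        using \<epsilon>(1) by (simp only: norm_scaleR abs_mult) simp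
      also have "\<dots> \<le> (M * (r\<^sup>2 / \<epsilon> * \<bar>t - s\<bar>)) * (2 / \<epsilon>) * r"
        using \<epsilon>(1) \<sigma>(3) \<sigma>(11)[of "arg t x" "arg s x"] unfolding arg_diff by (intro mult_mono nx that) auto
      also have "\<dots> = 2 * M * r ^ 3 / \<epsilon>\<^sup>2 * \<bar>t - s\<bar>"
        by (simp add: power2_eq_square power3_eq_cube)
      finally show ?thesis .
    qed
    have nsq_diff: "norm_sq A g (grad g (\<lambda>p. w t p - w s p)) p \<le> (2 * M * r ^ 3 / \<epsilon>\<^sup>2 * \<bar>t - s\<bar>)\<^sup>2 / a"
      if t: "t \<in> {0..1}" and s: "s \<in> {0..1}" for t s p
    proof -
      \<comment> \<open>The difference of two members is, up to sign, again an extension by zero, so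
        the same gradient estimate applies to it.\<close>
      have fd: "(\<lambda>p. w t p - w s p) = (\<lambda>p. 0 - 1 * ext (\<lambda>x. f t x - f s x) p)"
        by (auto simp: w_def ext_def fun_eq_iff)
      have Ckd: "Ck_on k UNIV (\<lambda>x. f t x - f s x)" for k by (intro Ck_on_diff Ck_f open_UNIV)
      have f0d: "f t x - f s x = 0" if "x \<notin> ?K" for x using f0[OF that t] f0[OF that s] by simp
      have sme: "smooth_fun A (ext (\<lambda>x. f t x - f s x))"
        unfolding ext_def by (rule smooth_fun_chart_extension[OF c compact_cball r(2) Ckd f0d])
      have derd: "((\<lambda>x. f t x - f s x) has_derivative (\<lambda>v. (D t x - D s x) \<bullet> v)) (at x)" for x
        using has_derivative_diff[OF der_f der_f] by (simp add: inner_diff_left)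
      have "norm_sq A g (grad g (\<lambda>p. w t p - w s p)) p = norm_sq A g (grad g (ext (\<lambda>x. f t x - f s x))) p"
        unfolding fd norm_sq_grad_affine[OF sme] by simp
      also have "\<dots> \<le> (if p \<in> chart_inv c ` ?K then (norm (D t (snd c p) - D s (snd c p)))\<^sup>2 / a else 0)"
        unfolding ext_def
        by (rule norm_sq_grad_chart_extension_le[OF c compact_cball r(2) Ckd f0d derd ab(1,3)])
      also have "\<dots> \<le> (2 * M * r ^ 3 / \<epsilon>\<^sup>2 * \<bar>t - s\<bar>)\<^sup>2 / a"
      proof (cases "p \<in> chart_inv c ` ?K")
        case True
        then have "snd c p \<in> ?K" using chart_chart_inv[OF c] r(2) by auto
        then show ?thesis using True D_diff[of "snd c p" t s] ab(1) by (simp add: divide_right_mono power_mono)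
      qed (use ab(1) in simp)
      finally show ?thesis .
    qed
    \<comment> \<open>The three summands are the bounds for the increments of w, for its gradient,
      and for the increments of its gradient; division by sqrt a converts to Riemannian
      norms.\<close>
    define L where "L = M * r\<^sup>2 / \<epsilon> + 2 * M * r / \<epsilon> / sqrt a + 2 * M * r ^ 3 / \<epsilon>\<^sup>2 / sqrt a"
    have L_parts: "0 \<le> M * r\<^sup>2 / \<epsilon>" "0 \<le> 2 * M * r / \<epsilon> / sqrt a" "0 \<le> 2 * M * r ^ 3 / \<epsilon>\<^sup>2 / sqrt a"
      using \<sigma>(3) r(1) \<epsilon>(1) ab(1) by simp_all
    have L: "0 \<le> L" "M * r\<^sup>2 / \<epsilon> \<le> L" "2 * M * r / \<epsilon> / sqrt a \<le> L" "2 * M * r ^ 3 / \<epsilon>\<^sup>2 / sqrt a \<le> L"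
      using L_parts by (auto simp: L_def)
    have nsq_bd: "norm_sq A g (grad g (w t)) p \<le> (2 * M * r / \<epsilon>)\<^sup>2 / a" if t: "t \<in> {0..1}" for t p
    proof (rule order_trans[OF nsq_w[OF t]])
      show "(if p \<in> chart_inv c ` ?K then (norm (D t (snd c p)))\<^sup>2 / a else 0) \<le> (2 * M * r / \<epsilon>)\<^sup>2 / a"
      proof (cases "p \<in> chart_inv c ` ?K")
        case True
        then have "snd c p \<in> ?K" using chart_chart_inv[OF c] r(2) by auto
        then show ?thesis using True D_bd[of "snd c p" t] ab(1) by (simp add: divide_right_mono power_mono)
      qed (use ab(1) in simp)
    qed
    have lip: "\<bar>w t p - w s p\<bar> \<le> L * \<bar>t - s\<bar> \<and> norm_sq A g (grad g (w t)) p \<le> L\<^sup>2 \<and>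
        norm_sq A g (grad g (\<lambda>p. w t p - w s p)) p \<le> (L * \<bar>t - s\<bar>)\<^sup>2"
      if t: "t \<in> {0..1}" and s: "s \<in> {0..1}" for t s p
    proof (intro conjI)
      have "\<bar>w t p - w s p\<bar> \<le> M * (r\<^sup>2 / \<epsilon> * \<bar>t - s\<bar>)"
      proof (cases "p \<in> chart_dom c")
        case True
        then have "\<bar>w t p - w s p\<bar> = \<bar>\<sigma> (arg t (snd c p)) - \<sigma> (arg s (snd c p))\<bar>"
          by (simp add: w_def ext_def f_def)
        then show ?thesis using \<sigma>(10)[of "arg t (snd c p)" "arg s (snd c p)"] by (simp add: arg_diff)
      qed (use \<sigma>(3) \<epsilon>(1) in \<open>simp add: w_def ext_def\<close>)
      also have "\<dots> = M * r\<^sup>2 / \<epsilon> * \<bar>t - s\<bar>" by simp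
      also have "\<dots> \<le> L * \<bar>t - s\<bar>" by (intro mult_right_mono L(2)) simp
      finally show "\<bar>w t p - w s p\<bar> \<le> L * \<bar>t - s\<bar>" .
      have "(2 * M * r / \<epsilon>)\<^sup>2 / a = (2 * M * r / \<epsilon> / sqrt a)\<^sup>2" using ab(1) by (simp add: power_divide power_mult_distrib)
      also have "\<dots> \<le> L\<^sup>2" by (intro power_mono L(3) L_parts)
      finally show "norm_sq A g (grad g (w t)) p \<le> L\<^sup>2" using nsq_bd[OF t, of p] by linarith
      have "(2 * M * r ^ 3 / \<epsilon>\<^sup>2 * \<bar>t - s\<bar>)\<^sup>2 / a = (2 * M * r ^ 3 / \<epsilon>\<^sup>2 / sqrt a * \<bar>t - s\<bar>)\<^sup>2"
        using ab(1) by (simp add: power_divide power_mult_distrib)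
      also have "\<dots> \<le> (L * \<bar>t - s\<bar>)\<^sup>2" by (intro power_mono mult_right_mono L(4) mult_nonneg_nonneg L_parts) auto
      finally show "norm_sq A g (grad g (\<lambda>p. w t p - w s p)) p \<le> (L * \<bar>t - s\<bar>)\<^sup>2"
        using nsq_diff[OF t s, of p] by linarith
    qed
    have shell: "\<exists>S\<in>sets borel. emeasure vol S \<le> ennreal ((C1 + C2) * \<epsilon>) \<and>
        (\<forall>p. norm_sq A g (grad g (w t)) p \<le> (C1 + C2) / \<epsilon>\<^sup>2 * indicator S p) \<and> (\<forall>p. p \<notin> S \<longrightarrow> w t p \<in> {0, 1})"
      if t: "t \<in> {0..1}" for t
    proof -
      \<comment> \<open>Exactly the set where the argument of \<sigma> lies in [0,1]; off it
        \<sigma> is 0 or 1 and its derivative vanishes.\<close>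
      define B where "B = {x. t * r\<^sup>2 - \<epsilon> \<le> (dist y x)\<^sup>2 \<and> (dist y x)\<^sup>2 \<le> t * r\<^sup>2}"
      have tr: "0 \<le> t * r\<^sup>2" "t * r\<^sup>2 \<le> r\<^sup>2" using t by (simp_all add: mult_left_le_one_le)
      have "closed B"
        unfolding B_def by (intro closed_Collect_conj closed_Collect_le continuous_intros)
      then have Bb: "B \<in> sets borel" by simp
      have BK: "B \<subseteq> ?K"
      proof
        fix x assume "x \<in> B"
        then have "(dist y x)\<^sup>2 \<le> r\<^sup>2" using tr by (simp add: B_def)
        then show "x \<in> ?K" using r(1) by (simp add: power2_le_iff_abs_le)
      qed
      have dB: "\<And>x. x \<in> B \<Longrightarrow> dens c x \<le> b" using BK ab(4) by blast
      have Bi: "B \<subseteq> chart_img c" using BK r(2) by blast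
      note em = emeasure_vol_chart_inv_le[OF c Bb Bi dB]
      have off: "arg t x \<le> 0 \<or> 1 \<le> arg t x" if "x \<notin> B" for x
      proof -
        have "t * r\<^sup>2 - q x \<le> 0 \<or> \<epsilon> \<le> t * r\<^sup>2 - q x" using that by (auto simp: B_def q_dist)
        then show ?thesis using \<epsilon>(1) by (auto simp: arg_def field_simps)
      qed
      show ?thesis
      proof (intro bexI[of _ "chart_inv c ` B"] conjI allI impI em(1))
        have "emeasure lborel B \<le> ennreal (unit_ball_vol ?n * ?n * r ^ (?n - 2) * \<epsilon>)"
          unfolding B_def by (rule emeasure_shell_le) (use tr r(1) \<epsilon>(1) dim in auto)
        then have "ennreal b * emeasure lborel B \<le> ennreal b * ennreal (unit_ball_vol ?n * ?n * r ^ (?n - 2) * \<epsilon>)"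
          by (intro mult_left_mono) auto
        also have "\<dots> = ennreal (C1 * \<epsilon>)"
          using ab(2) r(1) \<epsilon>(1) by (subst ennreal_mult[symmetric]) (auto simp: C1_def mult_ac)
        also have "\<dots> \<le> ennreal ((C1 + C2) * \<epsilon>)"
          using C \<epsilon>(1) by (intro ennreal_leI mult_right_mono) auto
        finally show "emeasure vol (chart_inv c ` B) \<le> ennreal ((C1 + C2) * \<epsilon>)"
          using em(2) by (rule order_trans[rotated])
        show "norm_sq A g (grad g (w t)) p \<le> (C1 + C2) / \<epsilon>\<^sup>2 * indicator (chart_inv c ` B) p" for p
        proof (cases "p \<in> chart_inv c ` B")
          case True
          have "(2 * M * r / \<epsilon>)\<^sup>2 / a = C2 / \<epsilon>\<^sup>2" by (simp add: C2_def power_divide)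
          also have "\<dots> \<le> (C1 + C2) / \<epsilon>\<^sup>2" using C by (intro divide_right_mono) auto
          finally show ?thesis using True nsq_bd[OF t, of p] by simp
        next
          case False
          have "norm_sq A g (grad g (w t)) p \<le> 0"
          proof (rule order_trans[OF nsq_w[OF t]])
            show "(if p \<in> chart_inv c ` ?K then (norm (D t (snd c p)))\<^sup>2 / a else 0) \<le> 0"
            proof (cases "p \<in> chart_inv c ` ?K")
              case True
              then obtain x where x: "x \<in> ?K" "p = chart_inv c x" by blast
              then have "x \<notin> B" using False by blast
              then have "\<sigma>' (arg t x) = 0" using off \<sigma>(8) by blast
              moreover have "snd c p = x" using x r(2) chart_chart_inv[OF c] by blast
              ultimately show ?thesis by (simp add: D_def)
            qed simp
          qed
          then show ?thesis using False by simp
        qed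
        show "w t p \<in> {0, 1}" if p: "p \<notin> chart_inv c ` B" for p
        proof (cases "p \<in> chart_dom c")
          case True
          then have "snd c p \<notin> B" using p chart_inv_chart[OF c True] by (metis imageI)
          then have "f t (snd c p) = 0 \<or> f t (snd c p) = 1"
            unfolding f_def using off \<sigma>(4,5) by blast
          then show ?thesis using True by (auto simp: w_def ext_def)
        qed (simp add: w_def ext_def)
      qed
    qed
    have "transition_family \<epsilon> (C1 + C2) (chart_inv c ` ball y (r / 2)) w"
      unfolding transition_family_def
    proof (intro conjI ballI allI)
      show "\<exists>L\<ge>0. \<forall>t\<in>{0..1}. \<forall>s\<in>{0..1}. \<forall>p. \<bar>w t p - w s p\<bar> \<le> L * \<bar>t - s\<bar> \<and>
        norm_sq A g (grad g (w t)) p \<le> L\<^sup>2 \<and> norm_sq A g (grad g (\<lambda>p. w t p - w s p)) p \<le> (L * \<bar>t - s\<bar>)\<^sup>2"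
        using L(1) lip by blast
      show "0 \<le> w t p" "w t p \<le> 1" for t p using \<sigma>(6,7) by (simp_all add: w_def ext_def f_def)
      show "w 0 p = 1" for p
      proof -
        have "arg 0 x \<le> 0" for x using \<epsilon>(1) by (simp add: arg_def q_dist)
        then show ?thesis by (simp add: w_def ext_def f_def \<sigma>(4))
      qed
      show "w 1 p = 0" if pU: "p \<in> chart_inv c ` ball y (r / 2)" for p
      proof -
        obtain x where x: "x \<in> ball y (r / 2)" "p = chart_inv c x" using pU by blast
        have "x \<in> ?K" using x(1) r(1) by auto
        then have xi: "x \<in> chart_img c" using r(2) by blast
        have "q x \<le> (r / 2)\<^sup>2" using x(1) unfolding q_dist by (intro power_mono) auto
        then have "\<epsilon> \<le> r\<^sup>2 - q x" using \<epsilon>(2) zero_le_power2[of r] unfolding power_divide power2_eq_square[of "2 :: real"] by linarith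
        then have "1 \<le> arg 1 x" using \<epsilon>(1) by (simp add: arg_def field_simps)
        then show ?thesis
          using x(2) chart_inv_dom[OF c xi] chart_chart_inv[OF c xi] by (simp add: w_def ext_def f_def \<sigma>(5))
      qed
    qed (use sm shell in blast)+
    then show ?thesis by blast
  qed
  show ?thesis
    by (intro exI[of _ "C1 + C2"] conjI exI[of _ "r\<^sup>2 / 2"] allI impI main) (use C r(1) in auto)
qed

text \<open>Induction over the finite cover, starting from the constant family 1, which clears the
  empty set. The constant grows at each step, but only with the number of balls, and the finitely
  many thresholds for \<epsilon> have a positive minimum.\<close>

lemma transition_family_exists:
  assumes dim: "2 \<le> CARD('n)"
  shows "\<exists>C\<ge>0. \<exists>\<epsilon>0>0. \<forall>\<epsilon>. 0 < \<epsilon> \<longrightarrow> \<epsilon> \<le> \<epsilon>0 \<longrightarrow> (\<exists>w. transition_family \<epsilon> C UNIV w)"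
proof -
  obtain I :: "(('m, 'n) chart \<times> (real ^ 'n) \<times> real) set" where I: "finite I"
    "\<forall>c y r. (c, y, r) \<in> I \<longrightarrow> c \<in> A \<and> 0 < r \<and> cball y r \<subseteq> chart_img c"
    "(\<Union>(c, y, r)\<in>I. chart_inv c ` ball y (r / 2)) = UNIV"
    by (rule finite_chart_balls)
  let ?N = "\<lambda>(c :: ('m, 'n) chart, y, r). chart_inv c ` ball y (r / 2)"
  have "\<exists>C\<ge>0. \<exists>\<epsilon>0>0. \<forall>\<epsilon>. 0 < \<epsilon> \<longrightarrow> \<epsilon> \<le> \<epsilon>0 \<longrightarrow> (\<exists>w. transition_family \<epsilon> C (\<Union>i\<in>J. ?N i) w)"
    if "finite J" "J \<subseteq> I" for J
    using that
  proof (induction J)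
    case empty
    have z: "norm_sq A g (grad g (\<lambda>p. k)) p = 0" for k p
      by (simp add: norm_sq_eq_0_iff grad_const[OF chart_at])
    have "transition_family \<epsilon> 0 {} (\<lambda>t p. 1)" if "0 < \<epsilon>" for \<epsilon>
      unfolding transition_family_def by (auto simp: z smooth_fun_const intro!: exI[of _ 0] bexI[of _ "{}"])
    then show ?case by (intro exI[of _ 0] conjI exI[of _ 1] allI impI exI[of _ "\<lambda>t p. 1"]) auto
  next
    case (insert i J)
    obtain c y r where i: "i = (c, y, r)" by (cases i) auto
    have cr: "c \<in> A" "0 < r" "cball y r \<subseteq> chart_img c" using insert.prems I(2) i by blast+
    obtain C \<epsilon>0 where C: "0 \<le> C" "0 < \<epsilon>0" "\<forall>\<epsilon>. 0 < \<epsilon> \<longrightarrow> \<epsilon> \<le> \<epsilon>0 \<longrightarrow> (\<exists>w. transition_family \<epsilon> C (\<Union>i\<in>J. ?N i) w)"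
      using insert.IH insert.prems by auto
    obtain C' \<epsilon>0' where C': "0 \<le> C'" "0 < \<epsilon>0'"
      "\<forall>\<epsilon>. 0 < \<epsilon> \<longrightarrow> \<epsilon> \<le> \<epsilon>0' \<longrightarrow> (\<exists>w. transition_family \<epsilon> C' (chart_inv c ` ball y (r / 2)) w)"
      using ball_transition_family[OF cr dim] by blast
    have "\<exists>w. transition_family \<epsilon> (2 * (C' + C)) (\<Union>i\<in>insert i J. ?N i) w"
      if \<epsilon>: "0 < \<epsilon>" "\<epsilon> \<le> min \<epsilon>0 \<epsilon>0'" for \<epsilon>
    proof -
      obtain w where w: "transition_family \<epsilon> C (\<Union>i\<in>J. ?N i) w" using C(3) \<epsilon> by auto
      obtain w' where w': "transition_family \<epsilon> C' (chart_inv c ` ball y (r / 2)) w'" using C'(3) \<epsilon> by auto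
      have "(\<Union>i\<in>insert i J. ?N i) = chart_inv c ` ball y (r / 2) \<union> (\<Union>i\<in>J. ?N i)" by (simp add: i)
      then show ?thesis using transition_family_mult[OF w' w C'(1) C(1) \<epsilon>(1)] by metis
    qed
    then show ?case
      using C(1,2) C'(1,2) by (intro exI[of _ "2 * (C' + C)"] conjI exI[of _ "min \<epsilon>0 \<epsilon>0'"] allI impI) auto
  qed
  from this[OF I(1) order_refl] show ?thesis unfolding I(3) .
qed

text \<open>Since |grad h|^2 = 4 |grad w|^2 <= 4C / \<epsilon>^2, the gradient part of the energy
  density is at most 2C / \<epsilon>; the potential part is at most B / \<epsilon>. Both vanish
  outside a layer of volume at most C \<epsilon>, where h is 1 or -1.\<close>

lemma minmax_value_upper_bound:
  assumes dim: "2 \<le> CARD('n)"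
    and V: "continuous_on UNIV V" "\<And>s. 0 \<le> V s" "\<And>s. V s \<le> B" "V (- 1) = 0" "V 1 = 0"
  obtains C \<epsilon>0 where "0 < \<epsilon>0" "\<forall>\<epsilon>. 0 < \<epsilon> \<longrightarrow> \<epsilon> \<le> \<epsilon>0 \<longrightarrow> minmax_value A g V \<epsilon> \<le> ereal C"
proof -
  interpret vol: finite_measure vol by (rule finite_measure_vol)
  obtain C \<epsilon>0 where C: "0 \<le> C" "0 < \<epsilon>0" "\<forall>\<epsilon>. 0 < \<epsilon> \<longrightarrow> \<epsilon> \<le> \<epsilon>0 \<longrightarrow> (\<exists>w. transition_family \<epsilon> C UNIV w)"
    using transition_family_exists[OF dim] by blast
  have B0: "0 \<le> B" using V(2,3)[of 0] by linarith
  show ?thesis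
  proof (rule that[of \<epsilon>0 "(2 * C + B) * C"], safe)
    fix \<epsilon> :: real assume \<epsilon>: "0 < \<epsilon>" "\<epsilon> \<le> \<epsilon>0"
    then obtain w where "transition_family \<epsilon> C UNIV w" using C(3) by blast
    note w = transition_familyD[OF this]
    \<comment> \<open>Sends w = 1 to -1 and w = 0 to 1, so the path starts and ends at the
      prescribed constants.\<close>
    define h where "h = (\<lambda>t p. 1 - 2 * w t p)"
    have sm: "smooth_fun A (h t)" if "t \<in> {0..1}" for t
      unfolding h_def by (rule smooth_fun_affine[OF w(1)[OF that]])
    have energy_le: "energy A g V \<epsilon> (h t) \<le> (2 * C + B) * C" if t: "t \<in> {0..1}" for t
    proof -
      obtain S where S: "S \<in> sets borel" "emeasure vol S \<le> ennreal (C * \<epsilon>)"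
        "\<forall>p. norm_sq A g (grad g (w t)) p \<le> C / \<epsilon>\<^sup>2 * indicator S p" "\<forall>p. p \<notin> S \<longrightarrow> w t p \<in> {0, 1}"
        using w(5)[OF t] by blast
      have pt: "\<epsilon> * norm_sq A g (grad g (h t)) p / 2 + V (h t p) / \<epsilon> \<le> (2 * C + B) / \<epsilon> * indicator S p" for p
      proof -
        have "\<epsilon> * norm_sq A g (grad g (h t)) p / 2 = 2 * \<epsilon> * norm_sq A g (grad g (w t)) p"
          unfolding h_def norm_sq_grad_affine[OF w(1)[OF t]] by simp
        also have "\<dots> \<le> 2 * \<epsilon> * (C / \<epsilon>\<^sup>2 * indicator S p)" using S(3) \<epsilon>(1) by (intro mult_left_mono) auto
        also have "\<dots> = 2 * C / \<epsilon> * indicator S p" using \<epsilon>(1) by (simp add: power2_eq_square)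
        finally have 1: "\<epsilon> * norm_sq A g (grad g (h t)) p / 2 \<le> 2 * C / \<epsilon> * indicator S p" .
        have 2: "V (h t p) / \<epsilon> \<le> B / \<epsilon> * indicator S p"
        proof (cases "p \<in> S")
          case True
          then show ?thesis using V(3) \<epsilon>(1) by (simp add: divide_right_mono)
        next
          case False
          then have "h t p = 1 \<or> h t p = - 1" using S(4) by (fastforce simp: h_def)
          then show ?thesis using V(4,5) False by auto
        qed
        show ?thesis using add_mono[OF 1 2] by (simp only: add_divide_distrib distrib_right)
      qed
      have cont: "continuous_on UNIV (\<lambda>p. \<epsilon> * norm_sq A g (grad g (h t)) p / 2 + V (h t p) / \<epsilon>)"
        using \<epsilon>(1) by (intro continuous_intros continuous_on_norm_sq_grad sm t
            continuous_on_compose2[OF V(1) continuous_on_smooth[OF sm[OF t]]]) auto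
      have "energy A g V \<epsilon> (h t) = (\<integral>p. \<epsilon> * norm_sq A g (grad g (h t)) p / 2 + V (h t p) / \<epsilon> \<partial>vol)"
        by (rule energy_eq[OF has_sobolev_grad_smooth[OF sm[OF t]] V(1)])
      also have "\<dots> \<le> (\<integral>p. (2 * C + B) / \<epsilon> * indicator S p \<partial>vol)"
        using S(1) by (intro integral_mono integrable_continuous_M cont pt integrable_mult_right integrable_real_indicator)
          (auto simp: less_top[symmetric])
      also have "\<dots> = (2 * C + B) / \<epsilon> * measure vol S" using S(1) by simp
      also have "\<dots> \<le> (2 * C + B) / \<epsilon> * (C * \<epsilon>)"
      proof (intro mult_left_mono)
        have "ennreal (measure vol S) \<le> ennreal (C * \<epsilon>)" using S(2) by (simp add: vol.emeasure_eq_measure)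
        then show "measure vol S \<le> C * \<epsilon>" using C(1) \<epsilon>(1) by (subst (asm) ennreal_le_iff) auto
      qed (use C(1) B0 \<epsilon>(1) in auto)
      also have "\<dots> = (2 * C + B) * C" using \<epsilon>(1) by simp
      finally show ?thesis .
    qed
    obtain L where L: "0 \<le> L" "\<forall>t\<in>{0..1}. \<forall>s\<in>{0..1}. \<forall>p. \<bar>w t p - w s p\<bar> \<le> L * \<bar>t - s\<bar> \<and>
        norm_sq A g (grad g (w t)) p \<le> L\<^sup>2 \<and> norm_sq A g (grad g (\<lambda>p. w t p - w s p)) p \<le> (L * \<bar>t - s\<bar>)\<^sup>2"
      using w(4) by blast
    define m where "m = measure vol UNIV"
    \<comment> \<open>The path is Lipschitz in H^1. The factor 8 is 4 + 4: values and gradients of h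
      are each -2 times those of w up to a constant, and squared.\<close>
    have H1_le: "H1_norm A g (\<lambda>p. h s p - h t p) \<le> L * sqrt (8 * m) * \<bar>s - t\<bar>"
      if s: "s \<in> {0..1}" and t: "t \<in> {0..1}" for s t
    proof -
      let ?d = "\<lambda>p. h s p - h t p"
      have smd: "smooth_fun A ?d" by (rule smooth_fun_diff[OF sm[OF s] sm[OF t]])
      have fd: "?d = (\<lambda>p. 0 - 2 * (w s p - w t p))" by (auto simp: h_def fun_eq_iff)
      have pt: "(?d p)\<^sup>2 + norm_sq A g (grad g ?d) p \<le> 8 * (L * \<bar>s - t\<bar>)\<^sup>2" for p
      proof -
        have l: "\<bar>w s p - w t p\<bar> \<le> L * \<bar>s - t\<bar>" "norm_sq A g (grad g (\<lambda>p. w s p - w t p)) p \<le> (L * \<bar>s - t\<bar>)\<^sup>2"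
          using L(2) s t by blast+
        have "norm_sq A g (grad g ?d) p = 4 * norm_sq A g (grad g (\<lambda>p. w s p - w t p)) p"
          unfolding fd norm_sq_grad_affine[OF smooth_fun_diff[OF w(1)[OF s] w(1)[OF t]]] by simp
        moreover have "(?d p)\<^sup>2 = 4 * (w s p - w t p)\<^sup>2"
          by (simp add: h_def power2_eq_square algebra_simps)
        moreover have "(w s p - w t p)\<^sup>2 \<le> (L * \<bar>s - t\<bar>)\<^sup>2"
          using power_mono[OF l(1), of 2] by simp
        ultimately show ?thesis using l(2) by linarith
      qed
      have "(H1_norm A g ?d)\<^sup>2 = (\<integral>p. (?d p)\<^sup>2 + norm_sq A g (grad g ?d) p \<partial>vol)"
        by (rule H1_norm_sq_eq[OF has_sobolev_grad_smooth[OF smd]])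
      also have "\<dots> \<le> (\<integral>p. 8 * (L * \<bar>s - t\<bar>)\<^sup>2 \<partial>vol)"
      proof (rule integral_mono[OF _ _ pt])
        show "integrable vol (\<lambda>p. (?d p)\<^sup>2 + norm_sq A g (grad g ?d) p)"
          by (intro integrable_continuous_M continuous_on_add continuous_on_power continuous_on_smooth[OF smd]
              continuous_on_norm_sq_grad[OF smd])
      qed simp
      also have "\<dots> = (L * sqrt (8 * m) * \<bar>s - t\<bar>)\<^sup>2"
        by (simp add: m_def power_mult_distrib)
      finally show ?thesis
        by (rule power2_le_imp_le) (use L(1) in \<open>simp add: m_def\<close>)
    qed
    have "h \<in> minmax_paths A g"
      unfolding minmax_paths_def mem_Collect_eq
    proof (intro conjI ballI)
      show "h t \<in> H1 A g" if "t \<in> {0..1}" for t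
        by (rule has_sobolev_grad_H1[OF has_sobolev_grad_smooth[OF sm[OF that]]])
      show "((\<lambda>s. H1_norm A g (\<lambda>p. h s p - h t p)) \<longlongrightarrow> 0) (at t within {0..1})" if t: "t \<in> {0..1}" for t
      proof (rule tendsto_sandwich[OF _ _ tendsto_const])
        have "((\<lambda>s. L * sqrt (8 * m) * \<bar>s - t\<bar>) \<longlongrightarrow> L * sqrt (8 * m) * \<bar>t - t\<bar>) (at t within {0..1})"
          by (intro tendsto_intros)
        then show "((\<lambda>s. L * sqrt (8 * m) * \<bar>s - t\<bar>) \<longlongrightarrow> 0) (at t within {0..1})" by simp
        have ev: "eventually (\<lambda>s. s \<in> {0..1}) (at t within {0..1})" by (simp add: eventually_at_filter)
        then show "\<forall>\<^sub>F s in at t within {0..1}. H1_norm A g (\<lambda>p. h s p - h t p) \<le> L * sqrt (8 * m) * \<bar>s - t\<bar>"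
          by eventually_elim (rule H1_le[OF _ t])
        show "\<forall>\<^sub>F s in at t within {0..1}. 0 \<le> H1_norm A g (\<lambda>p. h s p - h t p)"
          unfolding H1_norm_def by (intro always_eventually allI real_sqrt_ge_zero integral_nonneg_AE) simp
      qed
      show "AE p in vol. h 0 p = - 1" by (simp add: h_def w(6))
      show "AE p in vol. h 1 p = 1" by (simp add: h_def w(7))
    qed
    then have "minmax_value A g V \<epsilon> \<le> (SUP t\<in>{0..1}. ereal (energy A g V \<epsilon> (h t)))"
      unfolding minmax_value_def by (rule INF_lower)
    also have "\<dots> \<le> ereal ((2 * C + B) * C)"
      by (rule SUP_least) (use energy_le in simp)
    finally show "minmax_value A g V \<epsilon> \<le> ereal ((2 * C + B) * C)" .
  qed (rule C(2))
qed

end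

section \<open>Double-well potentials\<close>

lemma Ck_on_real_differentiable:
  fixes W :: "real \<Rightarrow> real"
  assumes "Ck_on (Suc k) UNIV W"
  shows "(W has_real_derivative deriv W x) (at x)"
  using Ck_on_imp_differentiable[OF assms, of x]
  by (simp add: DERIV_deriv_iff_real_differentiable)

text \<open>A zero of W >= 0 is a minimum, hence critical, so inside (-1,1) only \<gamma> could be
  one. Being also a local maximum, W would vanish near \<gamma>, and a nonempty open set would
  consist of critical points, which are only three.\<close>

lemma double_well_pos:
  assumes W: "double_well W" and s: "- 1 < s" "s < 1"
  shows "0 < W s"
proof (rule ccontr)
  have Ck: "Ck_on (Suc (Suc (Suc 0))) UNIV W" and nn: "\<And>x. 0 \<le> W x"
    using W by (auto simp: double_well_def numeral_3_eq_3)
  obtain \<gamma> where \<gamma>: "{x. deriv W x = 0} = {- 1, \<gamma>, 1}" "\<forall>\<^sub>F x in nhds \<gamma>. W x \<le> W \<gamma>"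
    using W unfolding double_well_def by blast
  assume "\<not> ?thesis"
  then have Ws: "W s = 0" using nn[of s] by simp
  have crit: "deriv W x = 0" if "W x = 0" for x
    by (rule DERIV_local_min[OF Ck_on_real_differentiable[OF Ck], of 1]) (use nn that in auto)
  then have "s \<in> {- 1, \<gamma>, 1}" using \<gamma>(1) Ws by blast
  then have "s = \<gamma>" using s by auto
  then have "\<forall>\<^sub>F x in nhds \<gamma>. W x = 0"
    using \<gamma>(2) by (elim eventually_mono) (use nn Ws in \<open>auto intro: antisym\<close>)
  then obtain T where T: "open T" "\<gamma> \<in> T" "\<forall>x\<in>T. W x = 0" unfolding eventually_nhds by blast
  have "T \<subseteq> {- 1, \<gamma>, 1}" using T(3) crit \<gamma>(1) by blast
  then have "finite T" by (rule finite_subset) simp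
  then show False using T(1,2) finite_imp_not_open by blast
qed

theorem proposition5p2:
  fixes A :: "('m::{t2_space, second_countable_topology}, 'n::finite) chart set"
    and g :: "('m, 'n) metric"
    and W V :: "real \<Rightarrow> real"
  assumes "closed_riemannian_manifold A g"
    and "CARD('n) \<ge> 3"
    and "double_well W"
    and "minmax_modification W V"
  shows "0 < Liminf (at_right 0) (\<lambda>\<epsilon>. minmax_value A g V \<epsilon>) \<and>
    Liminf (at_right 0) (\<lambda>\<epsilon>. minmax_value A g V \<epsilon>)
      \<le> Limsup (at_right 0) (\<lambda>\<epsilon>. minmax_value A g V \<epsilon>) \<and>
    Limsup (at_right 0) (\<lambda>\<epsilon>. minmax_value A g V \<epsilon>) < \<infinity>"
proof (intro conjI)
  interpret closed_riemannian A g by unfold_locales (rule assms(1))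
  have V: "continuous_on UNIV V" "\<And>x. x \<in> {- 1..1} \<Longrightarrow> V x = W x" "\<And>x. 1 < \<bar>x\<bar> \<Longrightarrow> 0 < V x"
    using assms(4) Ck_on_imp_continuous_on by (auto simp: minmax_modification_def)
  obtain k where k: "\<And>x. x \<notin> {- 2..2} \<Longrightarrow> V x = k"
    using assms(4) unfolding minmax_modification_def by blast
  have W: "\<And>x. 0 \<le> W x" "W (- 1) = 0" "W 1 = 0"
    using assms(3) by (auto simp: double_well_def)
  have V1: "V (- 1) = 0" "V 1 = 0" using V(2) W by auto
  have V0: "0 \<le> V x" for x
    using V(2)[of x] V(3)[of x] W(1)[of x] by (cases "x \<in> {- 1..1}") auto
  obtain z where z: "\<And>x. x \<in> {- 2..2} \<Longrightarrow> V x \<le> V z"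
    using continuous_attains_sup[of "{- 2..2::real}" V] continuous_on_subset[OF V(1)] by force
  \<comment> \<open>V is bounded above by its maximum on [-2,2] and by its constant value
    outside.\<close>
  have VB: "V x \<le> max (V z) k" for x
    using z[of x] k[of x] by (cases "x \<in> {- 2..2}") auto
  \<comment> \<open>The minimum of V on [-1/2, 1/2] is the constant v0 of the lower bound; it is
    positive because V agrees there with W.\<close>
  obtain s where s: "s \<in> {- (1/2)..1/2}" "\<And>x. x \<in> {- (1/2)..1/2} \<Longrightarrow> V s \<le> V x"
    using continuous_attains_inf[of "{- (1/2)..1/2::real}" V] continuous_on_subset[OF V(1)] by force
  have v0: "0 < V s"
    using V(2)[of s] double_well_pos[OF assms(3), of s] s(1) by auto
  have vs: "V s \<le> V x" if "\<bar>x\<bar> \<le> 1 / 2" for x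
    by (rule s(2)) (use that in auto)
  obtain e where e: "0 < e" "\<forall>\<epsilon>. 0 < \<epsilon> \<longrightarrow> \<epsilon> \<le> 1 \<longrightarrow> ereal e \<le> minmax_value A g V \<epsilon>"
    by (rule minmax_value_lower_bound[OF V(1) V0 VB v0 vs])
  have "\<forall>\<^sub>F \<epsilon> in at_right 0. ereal e \<le> minmax_value A g V \<epsilon>"
    unfolding eventually_at_right_field by (rule exI[of _ 1]) (use e(2) in simp)
  then have "ereal e \<le> Liminf (at_right 0) (\<lambda>\<epsilon>. minmax_value A g V \<epsilon>)"
    by (rule Liminf_bounded)
  then show "0 < Liminf (at_right 0) (\<lambda>\<epsilon>. minmax_value A g V \<epsilon>)"
    by (rule less_le_trans[rotated]) (use e(1) in simp)
  show "Liminf (at_right 0) (\<lambda>\<epsilon>. minmax_value A g V \<epsilon>) \<le> Limsup (at_right 0) (\<lambda>\<epsilon>. minmax_value A g V \<epsilon>)"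
    by (rule Liminf_le_Limsup) simp
  have dim: "2 \<le> CARD('n)" using assms(2) by simp
  obtain C \<epsilon>0 where C: "0 < \<epsilon>0" "\<forall>\<epsilon>. 0 < \<epsilon> \<longrightarrow> \<epsilon> \<le> \<epsilon>0 \<longrightarrow> minmax_value A g V \<epsilon> \<le> ereal C"
    by (rule minmax_value_upper_bound[OF dim V(1) V0 VB V1])
  have "\<forall>\<^sub>F \<epsilon> in at_right 0. minmax_value A g V \<epsilon> \<le> ereal C"
    unfolding eventually_at_right_field by (rule exI[of _ \<epsilon>0]) (use C in simp)
  then have "Limsup (at_right 0) (\<lambda>\<epsilon>. minmax_value A g V \<epsilon>) \<le> ereal C"
    by (rule Limsup_bounded)
  then show "Limsup (at_right 0) (\<lambda>\<epsilon>. minmax_value A g V \<epsilon>) < \<infinity>"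
    by (rule le_less_trans) simp
qed

end
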